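(* Let $\theta,\omega>0$, $\xi\in(0,1]$, $a\in(0,1)$. There exist $\nu^-,\nu^+\in(0,1)$, depending only on $N$, $p_1,\dots,p_N$, $\theta,\omega,\xi,a$ (in particular not on the radius $\rho$ below), such that the following holds for the equation $$\partial_t u=\sum_{i=1}^N\partial_i\big(|\partial_i u|^{p_i-2}\partial_i u\big)\quad\text{in }\Omega_T=\Omega\times(-T,T).$$ Let $(y,s)\in\Omega_T$ and $\rho>0$ be such that $(y,s)+\mathcal{Q}_{2\rho}(\theta)\subset\subset\Omega_T$, and let $\mu^-,\mu^+\in[-\infty,+\infty]$ satisfy $$\mu^-\le\operatorname*{ess\,inf}_{(y,s)+\mathcal{Q}_{2\rho}(\theta)}u\le\operatorname*{ess\,sup}_{(y,s)+\mathcal{Q}_{2\rho}(\theta)}u\le\mu^+.$$ (i) If $u$ is a local weak super-solution in $\Omega_T$ that is locally bounded from below, $\mu^-$ is finite and $$\big|[u\le\mu^-+\xi\omega]\cap[(y,s)+\mathcal{Q}^-_{2\rho}(\theta)]\big|\le\nu^-\,|\mathcal{Q}^-_{2\rho}(\theta)|,$$ then $u\ge\mu^-+a\xi\omega$ a.e. in $(y,s)+\mathcal{Q}^-_\rho(\theta)$. (ii) If $u$ is a local weak sub-solution in $\Omega_T$ that is locally bounded from above, $\mu^+$ is finite and $$\big|[u\ge\mu^+-\xi\omega]\cap[(y,s)+\mathcal{Q}^-_{2\rho}(\theta)]\big|\le\nu^+\,|\mathcal{Q}^-_{2\rho}(\theta)|,$$ then $u\le\mu^+-a\xi\omega$ a.e.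 in $(y,s)+\mathcal{Q}^-_\rho(\theta)$.
   Context: $N\in\mathbb{N}$, $N>1$; $\Omega\subset\mathbb{R}^N$ is a bounded open set, $T>0$. The exponents $p_1,\dots,p_N$ are fixed, $\bar p=N\big(\sum_{i=1}^N 1/p_i\big)^{-1}$, $\bar p<N$, $\bar p^*=N\bar p/(N-\bar p)$, and $2<p_1\le p_2\le\dots\le p_N<\bar p^*$. For $\rho,M>0$: $\mathcal{K}_\rho(M)=\prod_{i=1}^N\{|x_i|<M^{\frac{p_i-2}{p_i}}\rho^{\frac{\bar p}{p_i}}\}$, $\mathcal{Q}^-_\rho(M)=\mathcal{K}_\rho(M)\times(-\rho^{\bar p},0]$, $\mathcal{Q}_\rho(M)=\mathcal{K}_\rho(M)\times(-\rho^{\bar p},\rho^{\bar p}]$. $A\subset\subset B$ means $A$ is compactly contained in $B$; $|\cdot|$ is Lebesgue measure; $[u\le c]$ denotes the set where $u\le c$. Local weak super-solution (sub-solution): a function $u\in C^0((-T,T);L^2_{loc}(\Omega))$ with $u\in L^1_{loc}((-T,T);W^{1,1}_{loc}(\Omega))$ and $\partial_i u\in L^{p_i}_{loc}((-T,T);L^{p_i}_{loc}(\Omega))$ for all $i$ such that for all $-T<t_1<t_2<T$, all compact $K\subset\Omega$ and all nonnegative smooth $\varphi$ on $\Omega_T$ with $\varphi(\cdot,t)$ supported in $K$ for every $t$, $$\int_K u\varphi\,dx\Big|_{t_1}^{t_2}+\int_{t_1}^{t_2}\!\!\int_K\Big(-u\,\partial_t\varphi+\sum_{i=1}^N|\partial_i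 u|^{p_i-2}\partial_i u\,\partial_i\varphi\Big)dx\,dt\ \ge0\quad(\text{resp. }\le0).$$ *)

theory Defs
  imports "HOL-Probability.Essential_Supremum"
begin

section \<open>Exponents and intrinsic cylinders\<close>

definition harm_mean :: "('n::finite \<Rightarrow> real) \<Rightarrow> real" where
  "harm_mean p = real CARD('n) / (\<Sum>i\<in>UNIV. 1 / p i)"

definition sobolev_exp :: "('n::finite \<Rightarrow> real) \<Rightarrow> real" where
  "sobolev_exp p = real CARD('n) * harm_mean p / (real CARD('n) - harm_mean p)"

definition cyl_base :: "('n::finite \<Rightarrow> real) \<Rightarrow> real \<Rightarrow> real \<Rightarrow> (real^'n) set" where
  "cyl_base p M \<rho> =
     {x. \<forall>i. \<bar>x $ i\<bar> < M powr ((p i - 2) / p i) * \<rho> powr (harm_mean p / p i)}"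

definition cyl_minus :: "('n::finite \<Rightarrow> real) \<Rightarrow> real \<Rightarrow> real \<Rightarrow> ((real^'n) \<times> real) set" where
  "cyl_minus p M \<rho> = cyl_base p M \<rho> \<times> {- (\<rho> powr harm_mean p) <.. 0}"

definition cyl_full :: "('n::finite \<Rightarrow> real) \<Rightarrow> real \<Rightarrow> real \<Rightarrow> ((real^'n) \<times> real) set" where
  "cyl_full p M \<rho> = cyl_base p M \<rho> \<times> {- (\<rho> powr harm_mean p) <.. \<rho> powr harm_mean p}"

definition spacetime :: "(real^'n) set \<Rightarrow> real \<Rightarrow> ((real^'n::finite) \<times> real) set" where
  "spacetime \<Omega> T = \<Omega> \<times> {-T<..<T}"

definition compactly_contained :: "'a::topological_space set \<Rightarrow> 'a set \<Rightarrow> bool" where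
  "compactly_contained A B \<longleftrightarrow> compact (closure A) \<and> closure A \<subseteq> B"


section \<open>Essential bounds of real functions, with values in the extended reals\<close>

definition ess_sup_on :: "'a::euclidean_space set \<Rightarrow> ('a \<Rightarrow> real) \<Rightarrow> ereal" where
  "ess_sup_on A u = esssup (lebesgue_on A) (\<lambda>z. ereal (u z))"

definition ess_inf_on :: "'a::euclidean_space set \<Rightarrow> ('a \<Rightarrow> real) \<Rightarrow> ereal" where
  "ess_inf_on A u = - esssup (lebesgue_on A) (\<lambda>z. - ereal (u z))"

definition locally_bounded_below :: "'a::euclidean_space set \<Rightarrow> ('a \<Rightarrow> real) \<Rightarrow> bool" where
  "locally_bounded_below U u \<longleftrightarrow>
     (\<forall>C. compact C \<longrightarrow> C \<subseteq> U \<longrightarrow> (\<exists>m. AE z in lebesgue. z \<in> C \<longrightarrow> m \<le> u z))"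

definition locally_bounded_above :: "'a::euclidean_space set \<Rightarrow> ('a \<Rightarrow> real) \<Rightarrow> bool" where
  "locally_bounded_above U u \<longleftrightarrow>
     (\<forall>C. compact C \<longrightarrow> C \<subseteq> U \<longrightarrow> (\<exists>m. AE z in lebesgue. z \<in> C \<longrightarrow> u z \<le> m))"


section \<open>Smooth functions and weak derivatives\<close>

text \<open>Only meant for open \<open>U\<close>: all iterated directional derivatives up to order \<open>k\<close> exist and
  are continuous.\<close>

primrec Ck_on :: "nat \<Rightarrow> 'a::euclidean_space set \<Rightarrow> ('a \<Rightarrow> real) \<Rightarrow> bool" where
  "Ck_on 0 U f \<longleftrightarrow> continuous_on U f"
| "Ck_on (Suc k) U f \<longleftrightarrow> (\<forall>x\<in>U. f differentiable (at x)) \<and>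
     (\<forall>v. Ck_on k U (\<lambda>x. frechet_derivative f (at x) v))"

definition smooth_on :: "'a::euclidean_space set \<Rightarrow> ('a \<Rightarrow> real) \<Rightarrow> bool" where
  "smooth_on U f \<longleftrightarrow> (\<forall>k. Ck_on k U f)"

text \<open>The partial derivative in \<open>x\<^sub>i\<close> is the one in direction \<open>axis i 1\<close>; on space-time the
  directions are \<open>(axis i 1, 0)\<close> for \<open>x\<^sub>i\<close> and \<open>(0, 1)\<close> for the time variable.\<close>

abbreviation ddir :: "'a::euclidean_space \<Rightarrow> ('a \<Rightarrow> real) \<Rightarrow> 'a \<Rightarrow> real" where
  "ddir v f x \<equiv> frechet_derivative f (at x) v"

definition test_function :: "'a::euclidean_space set \<Rightarrow> ('a \<Rightarrow> real) \<Rightarrow> bool" where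
  "test_function U \<phi> \<longleftrightarrow> smooth_on UNIV \<phi> \<and> compactly_contained {x. \<phi> x \<noteq> 0} U"

definition Lp_loc :: "real \<Rightarrow> 'a::euclidean_space set \<Rightarrow> ('a \<Rightarrow> real) \<Rightarrow> bool" where
  "Lp_loc q U f \<longleftrightarrow> f \<in> borel_measurable (lebesgue_on U) \<and>
     (\<forall>K. compact K \<longrightarrow> K \<subseteq> U \<longrightarrow> set_integrable lebesgue K (\<lambda>x. \<bar>f x\<bar> powr q))"

definition has_weak_partial ::
  "'n::finite \<Rightarrow> (real^'n) set \<Rightarrow> (real^'n \<Rightarrow> real) \<Rightarrow> (real^'n \<Rightarrow> real) \<Rightarrow> bool" where
  "has_weak_partial i \<Omega> f g \<longleftrightarrow> Lp_loc 1 \<Omega> f \<and> Lp_loc 1 \<Omega> g \<and>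
     (\<forall>\<phi>. test_function \<Omega> \<phi> \<longrightarrow>
        (LINT x:\<Omega>|lebesgue. f x * ddir (axis i 1) \<phi> x) = - (LINT x:\<Omega>|lebesgue. g x * \<phi> x))"


section \<open>Function spaces on the space-time domain\<close>

text \<open>The local Bochner space of functions of time with values in the local Lebesgue space of
  exponent \<open>q\<close> over \<open>\<Omega>\<close>: functions are identified with jointly measurable functions on space-time,
  and by Tonelli the iterated integral over a compact set of times and a compact subset of \<open>\<Omega>\<close> is the
  integral over their product.\<close>

definition Lp_loc_time :: "real \<Rightarrow> (real^'n::finite) set \<Rightarrow> real \<Rightarrow> ((real^'n) \<times> real \<Rightarrow> real) \<Rightarrow> bool"
  where
  "Lp_loc_time q \<Omega> T f \<longleftrightarrow> f \<in> borel_measurable (lebesgue_on (spacetime \<Omega> T)) \<and>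
     (\<forall>K I. compact K \<longrightarrow> K \<subseteq> \<Omega> \<longrightarrow> compact I \<longrightarrow> I \<subseteq> {-T<..<T} \<longrightarrow>
        set_integrable lebesgue (K \<times> I) (\<lambda>z. \<bar>f z\<bar> powr q))"

definition C0_L2_loc :: "(real^'n::finite) set \<Rightarrow> real \<Rightarrow> ((real^'n) \<times> real \<Rightarrow> real) \<Rightarrow> bool" where
  "C0_L2_loc \<Omega> T u \<longleftrightarrow>
     (\<forall>t\<in>{-T<..<T}. Lp_loc 2 \<Omega> (\<lambda>x. u (x, t))) \<and>
     (\<forall>K. compact K \<longrightarrow> K \<subseteq> \<Omega> \<longrightarrow> (\<forall>t\<in>{-T<..<T}.
        ((\<lambda>\<tau>. LINT x:K|lebesgue. (u (x, \<tau>) - u (x, t))\<^sup>2) \<longlongrightarrow> 0) (at t)))"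

text \<open>\<open>Du i\<close> is a representative of the weak derivative of \<open>u\<close> in \<open>x\<^sub>i\<close>, which is unique up to
  null sets. The first three conditions say that \<open>u\<close> is locally integrable in time with values in the
  local Sobolev space with exponents (1,1) over \<open>\<Omega>\<close>.\<close>

definition spatial_gradient ::
  "('n::finite \<Rightarrow> real) \<Rightarrow> (real^'n) set \<Rightarrow> real \<Rightarrow> ((real^'n) \<times> real \<Rightarrow> real) \<Rightarrow>
   ('n \<Rightarrow> (real^'n) \<times> real \<Rightarrow> real) \<Rightarrow> bool" where
  "spatial_gradient p \<Omega> T u Du \<longleftrightarrow>
     Lp_loc_time 1 \<Omega> T u \<and>
     (\<forall>i. Lp_loc_time 1 \<Omega> T (Du i)) \<and>
     (\<forall>i. AE t in lebesgue. t \<in> {-T<..<T} \<longrightarrow>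
        has_weak_partial i \<Omega> (\<lambda>x. u (x, t)) (\<lambda>x. Du i (x, t))) \<and>
     (\<forall>i. Lp_loc_time (p i) \<Omega> T (Du i))"


section \<open>Local weak super- and sub-solutions\<close>

definition admissible_test ::
  "(real^'n::finite) set \<Rightarrow> real \<Rightarrow> (real^'n) set \<Rightarrow> ((real^'n) \<times> real \<Rightarrow> real) \<Rightarrow> bool" where
  "admissible_test \<Omega> T K \<phi> \<longleftrightarrow> smooth_on (spacetime \<Omega> T) \<phi> \<and>
     (\<forall>z\<in>spacetime \<Omega> T. 0 \<le> \<phi> z) \<and>
     (\<forall>t\<in>{-T<..<T}. closure {x\<in>\<Omega>. \<phi> (x, t) \<noteq> 0} \<subseteq> K)"

definition weak_form ::
  "('n::finite \<Rightarrow> real) \<Rightarrow> ((real^'n) \<times> real \<Rightarrow> real) \<Rightarrow> ('n \<Rightarrow> (real^'n) \<times> real \<Rightarrow> real) \<Rightarrow>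
   (real^'n) set \<Rightarrow> real \<Rightarrow> real \<Rightarrow> ((real^'n) \<times> real \<Rightarrow> real) \<Rightarrow> real" where
  "weak_form p u Du K t1 t2 \<phi> =
     (LINT x:K|lebesgue. u (x, t2) * \<phi> (x, t2)) - (LINT x:K|lebesgue. u (x, t1) * \<phi> (x, t1)) +
     (LINT z:K \<times> {t1..t2}|lebesgue.
        - u z * ddir (0, 1) \<phi> z +
        (\<Sum>i\<in>UNIV. \<bar>Du i z\<bar> powr (p i - 2) * Du i z * ddir (axis i 1, 0) \<phi> z))"

definition local_weak_supersolution ::
  "('n::finite \<Rightarrow> real) \<Rightarrow> (real^'n) set \<Rightarrow> real \<Rightarrow> ((real^'n) \<times> real \<Rightarrow> real) \<Rightarrow> bool" where
  "local_weak_supersolution p \<Omega> T u \<longleftrightarrow> C0_L2_loc \<Omega> T u \<and>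
     (\<exists>Du. spatial_gradient p \<Omega> T u Du \<and>
       (\<forall>t1 t2 K \<phi>. -T < t1 \<longrightarrow> t1 < t2 \<longrightarrow> t2 < T \<longrightarrow> compact K \<longrightarrow> K \<subseteq> \<Omega> \<longrightarrow>
          admissible_test \<Omega> T K \<phi> \<longrightarrow> 0 \<le> weak_form p u Du K t1 t2 \<phi>))"

definition local_weak_subsolution ::
  "('n::finite \<Rightarrow> real) \<Rightarrow> (real^'n) set \<Rightarrow> real \<Rightarrow> ((real^'n) \<times> real \<Rightarrow> real) \<Rightarrow> bool" where
  "local_weak_subsolution p \<Omega> T u \<longleftrightarrow> C0_L2_loc \<Omega> T u \<and>
     (\<exists>Du. spatial_gradient p \<Omega> T u Du \<and>
       (\<forall>t1 t2 K \<phi>. -T < t1 \<longrightarrow> t1 < t2 \<longrightarrow> t2 < T \<longrightarrow> compact K \<longrightarrow> K \<subseteq> \<Omega> \<longrightarrow>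
          admissible_test \<Omega> T K \<phi> \<longrightarrow> weak_form p u Du K t1 t2 \<phi> \<le> 0))"

end

theory Submission
  imports Defs "HOL-Computational_Algebra.Polynomial"
begin

text \<open>
  This is De Giorgi's critical mass lemma. Part (ii) is part (i) for \<open>- u\<close>, so let \<open>u\<close> be a
  super-solution with \<open>u \<ge> m\<close>, and put \<open>K = \<xi> \<omega>\<close>. Write \<open>L\<^sub>i\<close> for the half-widths and \<open>\<tau>\<close> for the height of
  the inner cylinder. They satisfy \<open>L\<^sub>i powr p\<^sub>i = \<theta> powr (p\<^sub>i - 2) * \<tau>\<close>, so a cut-off \<open>\<zeta>\<close> adapted to the
  cylinder has \<open>\<bar>\<partial>\<^sub>i \<zeta>\<bar> powr p\<^sub>i\<close> and \<open>\<partial>\<^sub>t \<zeta>\<close> both of order \<open>1 / \<tau>\<close>. This common scaling is the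
  reason why the final constant does not see the radius.

  Energy (\<open>caccioppoli\<close>). Testing with \<open>(k - u)\<^sub>+\<^sup>2 \<zeta>\<close> bounds the integrals of \<open>(k - u)\<^sub>+\<^sup>3 \<zeta>\<close> over the
  time slices and the space-time integrals of \<open>(k - u)\<^sub>+ \<bar>\<partial>\<^sub>i u\<bar> powr p\<^sub>i \<zeta>\<close> by a multiple of the measure of
  \<open>{u < k}\<close> in the support of \<open>\<zeta>\<close>, divided by \<open>\<tau>\<close>. The square of the truncation makes the test
  function continuously differentiable, and it pairs the two quantities: since
  \<open>L\<^sub>i \<bar>\<partial>\<^sub>i u\<bar> \<le> 1 + (L\<^sub>i \<bar>\<partial>\<^sub>i u\<bar>) powr p\<^sub>i\<close>, they control both the mass of \<open>f = (k - u)\<^sub>+\<^sup>3 \<zeta> / 3\<close> at each time and the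
  integral of \<open>L\<^sub>i \<bar>\<partial>\<^sub>i f\<bar>\<close>.

  Gain (\<open>weak_type_gain\<close>). A nonnegative function on the space of dimension \<open>N\<close> is compared with its mean
  over a box with half-widths \<open>r L\<^sub>i\<close>. If \<open>r\<close> is so large that the mean is at most \<open>l\<close>, then the
  set \<open>{f \<ge> 2 l}\<close> has measure at most \<open>r / l\<close> times the sum of the integrals of \<open>L\<^sub>i \<bar>\<partial>\<^sub>i f\<bar>\<close>. The least such \<open>r\<close> is
  of order (mass of \<open>f\<close>)\<open>powr (1 / N)\<close>, and with the energy bound the measure of a smaller sublevel
  set on a smaller cylinder is at most a constant times the power \<open>1 + 1 / N\<close> of the previous one
  (\<open>one_step\<close>). Along geometrically shrinking cylinders and levels these measures tend to zero as soon
  as the first one is small (\<open>fast_geometric_convergence\<close>, \<open>de_giorgi_iteration\<close>), which is the claim.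

  Regularisation. A weak super-solution cannot be tested with a function of itself. The weak
  formulation with a translated mollifier as test function says that the mollified function \<open>v\<close>
  satisfies \<open>\<partial>\<^sub>t v \<ge> \<Sum>\<^sub>i \<partial>\<^sub>i B\<^sub>i\<close> pointwise, where \<open>B\<^sub>i\<close> is the mollified flux
  (\<open>mollified_supersolution_exists\<close>). Now \<open>B\<^sub>i\<close> is not the flux of \<open>v\<close>, but the difference, weighted with
  \<open>1 + \<bar>\<partial>\<^sub>i v\<bar>\<close>, tends to zero in the mean (\<open>commutator_tendsto_zero\<close>). Hence energy and gain are proved for
  smooth functions with an error term, and only measures of sublevel sets are passed to the limit.
\<close>

section \<open>Functions with a continuous gradient\<close>

text \<open>The gradient is carried along as a vector field, so that every partial derivative, in space or in
  time, is an inner product with a fixed vector.\<close>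

definition cont_grad :: "('a::euclidean_space \<Rightarrow> real) \<Rightarrow> ('a \<Rightarrow> 'a) \<Rightarrow> bool" where
  "cont_grad f g \<longleftrightarrow> (\<forall>z. (f has_derivative (\<lambda>h. g z \<bullet> h)) (at z)) \<and> continuous_on UNIV g"

lemma cont_grad_derivative: "cont_grad f g \<Longrightarrow> (f has_derivative (\<lambda>h. g z \<bullet> h)) (at z)"
  by (simp add: cont_grad_def)

lemma cont_grad_continuous_grad: "cont_grad f g \<Longrightarrow> continuous_on A g"
  by (auto simp: cont_grad_def intro: continuous_on_subset)

lemma cont_grad_continuous: "cont_grad f g \<Longrightarrow> continuous_on A f"
  by (meson UNIV_I cont_grad_derivative continuous_at_imp_continuous_on has_derivative_continuous)

lemma cont_grad_mult:
  assumes "cont_grad f g" "cont_grad f' g'"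
  shows "cont_grad (\<lambda>z. f z * f' z) (\<lambda>z. f z *\<^sub>R g' z + f' z *\<^sub>R g z)"
  unfolding cont_grad_def
proof (intro conjI allI)
  fix z
  show "((\<lambda>z. f z * f' z) has_derivative (\<lambda>h. (f z *\<^sub>R g' z + f' z *\<^sub>R g z) \<bullet> h)) (at z)"
    by (rule has_derivative_eq_rhs[OF has_derivative_mult
          [OF cont_grad_derivative[OF assms(1)] cont_grad_derivative[OF assms(2)]]])
      (auto simp: fun_eq_iff inner_add_left mult.commute)
  show "continuous_on UNIV (\<lambda>z. f z *\<^sub>R g' z + f' z *\<^sub>R g z)"
    using assms by (intro continuous_intros cont_grad_continuous cont_grad_continuous_grad)
qed

lemma cont_grad_compose:
  assumes "\<And>x. (\<phi> has_real_derivative \<phi>' x) (at x)" "continuous_on UNIV \<phi>'" "cont_grad f g"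
  shows "cont_grad (\<lambda>z. \<phi> (f z)) (\<lambda>z. \<phi>' (f z) *\<^sub>R g z)"
  unfolding cont_grad_def
proof (intro conjI allI)
  fix z
  have "((\<lambda>z. \<phi> (f z)) has_derivative (\<lambda>h. \<phi>' (f z) * (g z \<bullet> h))) (at z)"
    using has_derivative_compose[OF cont_grad_derivative[OF assms(3)]
        assms(1)[unfolded has_field_derivative_def]] by simp
  then show "((\<lambda>z. \<phi> (f z)) has_derivative (\<lambda>h. (\<phi>' (f z) *\<^sub>R g z) \<bullet> h)) (at z)"
    by simp
  have "continuous_on UNIV (\<lambda>z. \<phi>' (f z))"
    by (rule continuous_on_compose2[OF assms(2) cont_grad_continuous[OF assms(3)]]) auto
  then show "continuous_on UNIV (\<lambda>z. \<phi>' (f z) *\<^sub>R g z)"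
    using assms by (intro continuous_intros cont_grad_continuous_grad)
qed

lemma cont_grad_slice:
  fixes f :: "'a::euclidean_space \<times> real \<Rightarrow> real"
  assumes "cont_grad f g"
  shows "cont_grad (\<lambda>x. f (x, t)) (\<lambda>x. fst (g (x, t)))"
  unfolding cont_grad_def
proof (intro conjI allI)
  fix x
  have "((\<lambda>x. f (x, t)) has_derivative (\<lambda>h. g (x, t) \<bullet> (h, 0))) (at x)"
    by (rule has_derivative_compose[OF _ cont_grad_derivative[OF assms], of "\<lambda>x. (x,t)"])
      (auto intro!: derivative_eq_intros)
  then show "((\<lambda>x. f (x, t)) has_derivative (\<lambda>h. fst (g (x, t)) \<bullet> h)) (at x)"
    by (simp add: inner_prod_def)
  have "continuous_on UNIV (\<lambda>x. g (x,t))"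
    by (rule continuous_on_compose2[OF cont_grad_continuous_grad[OF assms], of UNIV])
      (auto intro!: continuous_intros)
  then show "continuous_on UNIV (\<lambda>x. fst (g (x, t)))"
    by (intro continuous_intros)
qed

lemma cont_grad_line:
  assumes "cont_grad f g"
  shows "((\<lambda>s. f (z + s *\<^sub>R v)) has_real_derivative g (z + s *\<^sub>R v) \<bullet> v) (at s)"
proof -
  have "((\<lambda>s. f (z + s *\<^sub>R v)) has_derivative (\<lambda>h. g (z + s *\<^sub>R v) \<bullet> (h *\<^sub>R v))) (at s)"
    by (rule has_derivative_compose[OF _ cont_grad_derivative[OF assms]])
      (auto intro!: derivative_eq_intros)
  then show ?thesis
    by (simp add: has_field_derivative_def mult.commute[of _ "g (z + s *\<^sub>R v) \<bullet> v"])
qed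

lemma cont_grad_zero_outside:
  assumes "cont_grad f g" "closed S" "\<And>z. z \<notin> S \<Longrightarrow> f z = 0" "z \<notin> S"
  shows "g z = 0"
proof -
  have "((\<lambda>_. 0) has_derivative (\<lambda>h. g z \<bullet> h)) (at z)"
    by (rule has_derivative_transform_within_open[OF cont_grad_derivative[OF assms(1)], of "- S"])
      (use assms in auto)
  then have "(\<lambda>h. g z \<bullet> h) = (\<lambda>_. 0)"
    by (rule has_derivative_unique) simp
  then show ?thesis
    by (metis inner_eq_zero_iff)
qed

lemma integrable_compact_support:
  fixes f :: "'a::euclidean_space \<Rightarrow> real"
  assumes "continuous_on UNIV f" "compact S" "\<And>z. z \<notin> S \<Longrightarrow> f z = 0"
  shows "integrable lborel f"
proof -
  have "integrable lborel (\<lambda>x. indicator S x *\<^sub>R f x)"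
    using assms by (intro borel_integrable_compact) (auto intro: continuous_on_subset)
  also have "(\<lambda>x. indicator S x *\<^sub>R f x) = f"
    using assms(3) by (auto simp: fun_eq_iff indicator_def)
  finally show ?thesis .
qed

lemma borel_measurable_continuous_UNIV:
  "continuous_on UNIV f \<Longrightarrow> f \<in> borel_measurable borel"
  by (rule borel_measurable_continuous_onI)

lemma nn_integral_lborel_shift:
  fixes f :: "'a::euclidean_space \<Rightarrow> ennreal"
  assumes [measurable]: "f \<in> borel_measurable borel"
  shows "(\<integral>\<^sup>+x. f (x + c) \<partial>lborel) = (\<integral>\<^sup>+x. f x \<partial>lborel)"
proof -
  have "(\<integral>\<^sup>+x. f x \<partial>lborel) = (\<integral>\<^sup>+x. f x \<partial>distr lborel borel ((+) c))"
    by (simp add: lborel_distr_plus)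
  also have "\<dots> = (\<integral>\<^sup>+x. f (c + x) \<partial>lborel)"
    by (rule nn_integral_distr) auto
  finally show ?thesis by (simp add: add.commute)
qed

lemma integral_lborel_shift:
  fixes f :: "'a::euclidean_space \<Rightarrow> real"
  assumes [measurable]: "f \<in> borel_measurable borel"
  shows "(LBINT x. f (x + c)) = (LBINT x. f x)"
proof -
  have "(LBINT x. f x) = (\<integral>x. f x \<partial>distr lborel borel ((+) c))"
    by (simp add: lborel_distr_plus)
  also have "\<dots> = (LBINT x. f (c + x))"
    by (rule integral_distr) auto
  finally show ?thesis by (simp add: add.commute)
qed

lemma cont_grad_line_integral:
  assumes "cont_grad f g"
  shows "f (x + v) - f x = (LBINT s. indicator {0..1::real} s * (g (x + s *\<^sub>R v) \<bullet> v))"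
proof -
  have "(LBINT s. (g (x + s *\<^sub>R v) \<bullet> v) * indicator {0..1::real} s)
      = f (x + 1 *\<^sub>R v) - f (x + 0 *\<^sub>R v)"
  proof (rule integral_FTC_Icc_real)
    fix s :: real
    show "((\<lambda>s. f (x + s *\<^sub>R v)) has_real_derivative g (x + s *\<^sub>R v) \<bullet> v) (at s)"
      by (rule cont_grad_line[OF assms])
    have "continuous_on UNIV (\<lambda>s. g (x + s *\<^sub>R v) \<bullet> v)"
      by (intro continuous_intros continuous_on_compose2[OF cont_grad_continuous_grad[OF assms, of UNIV]])
         auto
    then show "isCont (\<lambda>s. g (x + s *\<^sub>R v) \<bullet> v) s"
      by (simp add: continuous_on_eq_continuous_at)
  qed simp
  then show ?thesis by (simp add: mult.commute)
qed

text \<open>The increment is the integral of the derivative along the segment from \<open>x\<close> to \<open>x + v\<close>. After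
  exchanging the integrals, translation invariance makes the inner one independent of the point of
  the segment.\<close>

lemma translation_L1_bound:
  assumes "cont_grad f g"
  shows "(\<integral>\<^sup>+x. ennreal \<bar>f (x + v) - f x\<bar> \<partial>lborel) \<le> (\<integral>\<^sup>+x. ennreal \<bar>g x \<bullet> v\<bar> \<partial>lborel)"
proof -
  have cg: "continuous_on UNIV g" by (rule cont_grad_continuous_grad[OF assms])
  have [measurable]: "g \<in> borel_measurable borel"
    by (rule borel_measurable_continuous_UNIV[OF cg])
  have [measurable]: "(\<lambda>z. g (fst z + snd z *\<^sub>R v)) \<in> borel_measurable (borel \<Otimes>\<^sub>M borel)"
    by measurable
  have "(\<integral>\<^sup>+x. ennreal \<bar>f (x + v) - f x\<bar> \<partial>lborel)
      \<le> (\<integral>\<^sup>+x. (\<integral>\<^sup>+s. ennreal (indicator {0..1::real} s * \<bar>g (x + s *\<^sub>R v) \<bullet> v\<bar>) \<partial>lborel) \<partial>lborel)"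
  proof (rule nn_integral_mono)
    fix x
    have c: "continuous_on {0..1} (\<lambda>s. g (x + s *\<^sub>R v) \<bullet> v)"
      by (intro continuous_intros continuous_on_compose2[OF cg]) auto
    have "integrable lborel (\<lambda>s. indicator {0..1::real} s *\<^sub>R (g (x + s *\<^sub>R v) \<bullet> v))"
      by (rule borel_integrable_compact[OF _ c]) auto
    then have i: "integrable lborel (\<lambda>s. indicator {0..1::real} s * (g (x + s *\<^sub>R v) \<bullet> v))"
      by simp
    have "ennreal \<bar>f (x + v) - f x\<bar>
       \<le> (\<integral>\<^sup>+s. ennreal \<bar>indicator {0..1::real} s * (g (x + s *\<^sub>R v) \<bullet> v)\<bar> \<partial>lborel)"
      unfolding cont_grad_line_integral[OF assms, of x v]
      using integral_norm_bound_ennreal[OF i] by simp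
    then show "ennreal \<bar>f (x + v) - f x\<bar>
       \<le> (\<integral>\<^sup>+s. ennreal (indicator {0..1::real} s * \<bar>g (x + s *\<^sub>R v) \<bullet> v\<bar>) \<partial>lborel)"
      by (simp add: abs_mult)
  qed
  also have "\<dots> = (\<integral>\<^sup>+s. (\<integral>\<^sup>+x. ennreal (indicator {0..1::real} s * \<bar>g (x + s *\<^sub>R v) \<bullet> v\<bar>) \<partial>lborel) \<partial>lborel)"
    by (rule lborel_pair.Fubini'[symmetric]) measurable
  also have "\<dots> = (\<integral>\<^sup>+s. indicator {0..1::real} s * (\<integral>\<^sup>+x. ennreal \<bar>g x \<bullet> v\<bar> \<partial>lborel) \<partial>lborel)"
  proof (rule nn_integral_cong)
    fix s :: real
    have "(\<integral>\<^sup>+x. ennreal (indicator {0..1::real} s * \<bar>g (x + s *\<^sub>R v) \<bullet> v\<bar>) \<partial>lborel)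
       = (\<integral>\<^sup>+x. ennreal (indicator {0..1::real} s * \<bar>g x \<bullet> v\<bar>) \<partial>lborel)"
      by (rule nn_integral_lborel_shift) measurable
    also have "\<dots> = (\<integral>\<^sup>+x. indicator {0..1::real} s * ennreal \<bar>g x \<bullet> v\<bar> \<partial>lborel)"
      by (intro nn_integral_cong) (auto simp: indicator_def)
    also have "\<dots> = indicator {0..1::real} s * (\<integral>\<^sup>+x. ennreal \<bar>g x \<bullet> v\<bar> \<partial>lborel)"
      by (rule nn_integral_cmult) measurable
    finally show "(\<integral>\<^sup>+x. ennreal (indicator {0..1::real} s * \<bar>g (x + s *\<^sub>R v) \<bullet> v\<bar>) \<partial>lborel) = \<dots>" .
  qed
  also have "\<dots> = (\<integral>\<^sup>+x. ennreal \<bar>g x \<bullet> v\<bar> \<partial>lborel)"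
    by (subst nn_integral_multc) auto
  finally show ?thesis .
qed

text \<open>Integration by parts without boundary term. The integral of \<open>f (x + v) - f x\<close> vanishes by
  translation invariance, and by the fundamental theorem along the segment it is the mean over the
  segment of translates of the integral in question.\<close>

lemma integral_directional_derivative_zero:
  fixes f :: "'a::euclidean_space \<Rightarrow> real"
  assumes cgf: "cont_grad f g" and S: "compact S" and zero: "\<And>z. z \<notin> S \<Longrightarrow> f z = 0"
  shows "(LBINT x. g x \<bullet> v) = 0"
proof -
  have cg: "continuous_on UNIV g" by (rule cont_grad_continuous_grad[OF cgf])
  have [measurable]: "g \<in> borel_measurable borel" "f \<in> borel_measurable borel"
    using borel_measurable_continuous_UNIV[OF cg]
      borel_measurable_continuous_UNIV[OF cont_grad_continuous[OF cgf]] by auto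
  have gz: "g z = 0" if "z \<notin> S" for z
    by (rule cont_grad_zero_outside[OF cgf compact_imp_closed[OF S] zero that])
  obtain R where R: "\<And>z. z \<in> S \<Longrightarrow> norm z \<le> R"
    using compact_imp_bounded[OF S] unfolding bounded_iff by auto
  let ?S = "cball (0::'a) (R + norm v) \<times> {0..1::real}"
  let ?F = "\<lambda>(x, s). g (x + s *\<^sub>R v) \<bullet> v"
  have "integrable lborel (\<lambda>z. indicator ?S z *\<^sub>R ?F z)"
  proof (rule borel_integrable_compact)
    show "compact ?S" by (intro compact_Times compact_cball compact_Icc)
    show "continuous_on ?S ?F"
      unfolding case_prod_beta
      by (intro continuous_intros continuous_on_compose2[OF cg]) auto
  qed
  also have "(\<lambda>z. indicator ?S z *\<^sub>R ?F z)
    = (\<lambda>(x, s). indicator {0..1} s * (g (x + s *\<^sub>R v) \<bullet> v))"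
  proof (rule ext, clarify)
    fix x and s :: real
    have "g (x + s *\<^sub>R v) = 0" if "s \<in> {0..1}" "x \<notin> cball 0 (R + norm v)"
    proof (rule gz, rule notI)
      assume "x + s *\<^sub>R v \<in> S"
      then have "norm (x + s *\<^sub>R v) \<le> R" by (rule R)
      moreover have "norm (s *\<^sub>R v) \<le> norm v" using that by (simp add: mult_left_le_one_le)
      ultimately have "norm x \<le> R + norm v"
        using norm_triangle_ineq4[of "x + s *\<^sub>R v" "s *\<^sub>R v"] by simp
      then show False using that by simp
    qed
    then show "indicator ?S (x, s) *\<^sub>R (g (x + s *\<^sub>R v) \<bullet> v) = indicator {0..1} s * (g (x + s *\<^sub>R v) \<bullet> v)"
      by (auto simp: indicator_def)
  qed
  finally have int: "integrable (lborel \<Otimes>\<^sub>M lborel) (\<lambda>(x, s). indicator {0..1} s * (g (x + s *\<^sub>R v) \<bullet> v))"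
    by (simp add: lborel_prod)
  have fi: "integrable lborel f"
    by (rule integrable_compact_support[OF cont_grad_continuous[OF cgf] S zero])
  have "integrable lborel (\<lambda>x. f (x + v))"
  proof (rule integrable_compact_support)
    show "continuous_on UNIV (\<lambda>x. f (x + v))"
      by (intro continuous_intros continuous_on_compose2[OF cont_grad_continuous[OF cgf], of UNIV]) auto
    show "compact ((\<lambda>x. - v + x) ` S)" by (rule compact_translation[OF S])
    show "f (z + v) = 0" if "z \<notin> (\<lambda>x. - v + x) ` S" for z
    proof (rule zero, rule notI)
      assume "z + v \<in> S"
      then have "- v + (z + v) \<in> (\<lambda>x. - v + x) ` S" by (rule imageI)
      then show False using that by simp
    qed
  qed
  then have "0 = (LBINT x. f (x + v) - f x)"
    using fi by (simp add: integral_lborel_shift)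
  also have "\<dots> = (LBINT x. (LBINT s. indicator {0..1::real} s * (g (x + s *\<^sub>R v) \<bullet> v)))"
    by (simp add: cont_grad_line_integral[OF cgf])
  also have "\<dots> = (LBINT s. (LBINT x. indicator {0..1::real} s * (g (x + s *\<^sub>R v) \<bullet> v)))"
    using lborel_pair.Fubini_integral[OF int] by simp
  also have "\<dots> = (LBINT s. indicator {0..1::real} s * (LBINT x. g x \<bullet> v))"
    by (simp add: integral_lborel_shift[of "\<lambda>x. g x \<bullet> v"])
  also have "\<dots> = (LBINT x. g x \<bullet> v)"
    by simp
  finally show ?thesis by simp
qed

section \<open>A weak-type Gagliardo--Nirenberg inequality\<close>

text \<open>A substitute for the Sobolev inequality with an elementary proof. The condition on the mass says
  that the mean of \<open>f\<close> over any translate of the box with half-widths \<open>r * L i\<close> is at most \<open>lam\<close>. Where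
  \<open>f \<ge> 2 * lam\<close>, the function therefore differs from its mean by at least \<open>lam\<close>, and the integral of
  that difference is controlled by the derivatives.\<close>

lemma weak_type_gain:
  fixes f :: "real^'n \<Rightarrow> real"
  assumes cgf: "cont_grad f g" and S: "compact S" and zero: "\<And>z. z \<notin> S \<Longrightarrow> f z = 0"
    and nonneg: "\<And>x. 0 \<le> f x" and L: "\<And>i. 0 < L i" and r: "0 < r" and lam: "0 < lam"
    and mass: "(LBINT x. f x) \<le> lam * (\<Prod>i\<in>UNIV. 2 * r * L i)"
  shows "ennreal lam * emeasure lborel {x. 2 * lam \<le> f x}
     \<le> (\<Sum>i\<in>UNIV. ennreal (r * L i) * (\<integral>\<^sup>+x. ennreal \<bar>g x $ i\<bar> \<partial>lborel))"
proof -
  define B where "B = cbox (\<chi> i. - (r * L i)) (\<chi> i. r * L i)"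
  define b where "b = (\<Prod>i\<in>UNIV. 2 * r * L i)"
  define D where "D = (\<Sum>i\<in>UNIV. ennreal (r * L i) * (\<integral>\<^sup>+x. ennreal \<bar>g x $ i\<bar> \<partial>lborel))"
  define E where "E = {x. 2 * lam \<le> f x}"
  have b: "b > 0" unfolding b_def using L r by (intro prod_pos) auto
  have [measurable]: "B \<in> sets borel" by (simp add: B_def)
  have fc: "continuous_on UNIV f" by (rule cont_grad_continuous[OF cgf])
  have [measurable]: "f \<in> borel_measurable borel" "g \<in> borel_measurable borel"
    using borel_measurable_continuous_UNIV cont_grad_continuous[OF cgf] cont_grad_continuous_grad[OF cgf]
    by blast+
  have "continuous_on UNIV (\<lambda>x. g x $ i)" for i
    by (intro continuous_intros cont_grad_continuous_grad[OF cgf])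
  then have [measurable]: "(\<lambda>x. g x $ i) \<in> borel_measurable borel" for i
    by (rule borel_measurable_continuous_UNIV)
  have [measurable]: "E \<in> sets borel" unfolding E_def by measurable
  have ne: "cbox (\<chi> i. - (r * L i)) (\<chi> i. r * L i) \<noteq> {}"
    using r L by (auto simp: interval_ne_empty_cart less_imp_le intro: order_trans[of _ 0])
  have "measure lborel B = b"
    unfolding B_def b_def by (simp add: content_cbox_cart[OF ne] mult.assoc)
  then have eB: "emeasure lborel B = ennreal b"
    using emeasure_lborel_cbox_finite[of "\<chi> i. - (r * L i)" "\<chi> i. r * L i"]
    by (simp add: emeasure_eq_ennreal_measure B_def)
  have hB: "\<bar>h $ i\<bar> \<le> r * L i" if "h \<in> B" for h i
  proof -
    have "- (r * L i) \<le> h $ i \<and> h $ i \<le> r * L i"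
      using that by (simp add: B_def mem_box_cart)
    then show ?thesis by linarith
  qed
  have fi: "integrable lborel f" by (rule integrable_compact_support[OF fc S zero])
  have mass': "(\<integral>\<^sup>+h. ennreal (f (x + h)) \<partial>lborel) \<le> ennreal (lam * b)" for x
  proof -
    have "(\<integral>\<^sup>+h. ennreal (f (h + x)) \<partial>lborel) = (\<integral>\<^sup>+h. ennreal (f h) \<partial>lborel)"
      by (rule nn_integral_lborel_shift) measurable
    also have "\<dots> = ennreal (LBINT x. f x)"
      by (rule nn_integral_eq_integral[OF fi]) (simp add: nonneg)
    also have "\<dots> \<le> ennreal (lam * b)"
      using mass by (intro ennreal_leI) (simp add: b_def)
    finally show ?thesis by (simp add: add.commute)
  qed
  have low: "ennreal (lam * b) * indicator E x
      \<le> (\<integral>\<^sup>+h. ennreal \<bar>f (x + h) - f x\<bar> * indicator B h \<partial>lborel)" (is "_ \<le> ?X") for x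
  proof (cases "x \<in> E")
    case True
    then have fx: "2 * lam \<le> f x" by (simp add: E_def)
    have "ennreal (lam * b) + ennreal (lam * b) = (\<integral>\<^sup>+h. ennreal (2 * lam) * indicator B h \<partial>lborel)"
      using b lam by (simp add: nn_integral_cmult eB flip: ennreal_plus ennreal_mult)
    also have "\<dots> \<le> (\<integral>\<^sup>+h. ennreal \<bar>f (x + h) - f x\<bar> * indicator B h + ennreal (f (x + h)) \<partial>lborel)"
    proof (rule nn_integral_mono)
      fix h
      have "2 * lam \<le> \<bar>f (x + h) - f x\<bar> + f (x + h)" using fx by linarith
      then have "ennreal (2 * lam) \<le> ennreal \<bar>f (x + h) - f x\<bar> + ennreal (f (x + h))"
        by (metis abs_ge_zero ennreal_leI ennreal_plus nonneg)
      then show "ennreal (2 * lam) * indicator B h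
        \<le> ennreal \<bar>f (x + h) - f x\<bar> * indicator B h + ennreal (f (x + h))"
        by (auto simp: indicator_def)
    qed
    also have "\<dots> = ?X + (\<integral>\<^sup>+h. ennreal (f (x + h)) \<partial>lborel)"
      by (rule nn_integral_add) measurable
    also have "\<dots> \<le> ?X + ennreal (lam * b)"
      by (intro add_left_mono mass')
    finally have "ennreal (lam * b) + ennreal (lam * b) \<le> ennreal (lam * b) + ?X"
      by (simp add: add.commute)
    then have "ennreal (lam * b) \<le> ?X"
      unfolding ennreal_add_left_cancel_le by simp
    then show ?thesis using True by simp
  qed simp
  have "ennreal (lam * b) * emeasure lborel E = (\<integral>\<^sup>+x. ennreal (lam * b) * indicator E x \<partial>lborel)"
    by (simp add: nn_integral_cmult)
  also have "\<dots> \<le> (\<integral>\<^sup>+x. (\<integral>\<^sup>+h. ennreal \<bar>f (x + h) - f x\<bar> * indicator B h \<partial>lborel) \<partial>lborel)"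
    by (intro nn_integral_mono low)
  also have "\<dots> = (\<integral>\<^sup>+h. (\<integral>\<^sup>+x. ennreal \<bar>f (x + h) - f x\<bar> * indicator B h \<partial>lborel) \<partial>lborel)"
    by (rule lborel_pair.Fubini'[symmetric]) measurable
  also have "\<dots> \<le> (\<integral>\<^sup>+h. D * indicator B h \<partial>lborel)"
  proof (rule nn_integral_mono)
    fix h
    show "(\<integral>\<^sup>+x. ennreal \<bar>f (x + h) - f x\<bar> * indicator B h \<partial>lborel) \<le> D * indicator B h"
    proof (cases "h \<in> B")
      case True
      have "(\<integral>\<^sup>+x. ennreal \<bar>f (x + h) - f x\<bar> \<partial>lborel) \<le> (\<integral>\<^sup>+x. ennreal \<bar>g x \<bullet> h\<bar> \<partial>lborel)"
        by (rule translation_L1_bound[OF cgf])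
      also have "\<dots> \<le> (\<integral>\<^sup>+x. (\<Sum>i\<in>UNIV. ennreal (r * L i) * ennreal \<bar>g x $ i\<bar>) \<partial>lborel)"
      proof (rule nn_integral_mono)
        fix x
        have "\<bar>g x \<bullet> h\<bar> \<le> (\<Sum>i\<in>UNIV. \<bar>g x $ i * h $ i\<bar>)"
          unfolding inner_vec_def by simp
        also have "\<dots> \<le> (\<Sum>i\<in>UNIV. (r * L i) * \<bar>g x $ i\<bar>)"
          by (intro sum_mono)
            (auto simp: abs_mult mult.commute[of "\<bar>g x $ _\<bar>"] intro!: mult_right_mono hB[OF True])
        finally have "ennreal \<bar>g x \<bullet> h\<bar> \<le> ennreal (\<Sum>i\<in>UNIV. (r * L i) * \<bar>g x $ i\<bar>)"
          by (rule ennreal_leI)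
        also have "\<dots> = (\<Sum>i\<in>UNIV. ennreal ((r * L i) * \<bar>g x $ i\<bar>))"
          using r L by (intro sum_ennreal[symmetric]) (simp add: less_imp_le)
        also have "\<dots> = (\<Sum>i\<in>UNIV. ennreal (r * L i) * ennreal \<bar>g x $ i\<bar>)"
          using r L by (intro sum.cong refl ennreal_mult) (auto simp: less_imp_le)
        finally show "ennreal \<bar>g x \<bullet> h\<bar> \<le> \<dots>" .
      qed
      also have "\<dots> = D"
        unfolding D_def by (simp add: nn_integral_sum nn_integral_cmult)
      finally show ?thesis using True by simp
    qed simp
  qed
  also have "\<dots> = ennreal b * D"
    by (simp add: nn_integral_cmult eB mult.commute)
  finally have "ennreal b * (ennreal lam * emeasure lborel E) \<le> ennreal b * D"
    using b lam by (simp add: ennreal_mult mult_ac)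
  then have "ennreal lam * emeasure lborel E \<le> D"
    using b by (simp add: ennreal_mult_le_mult_iff)
  then show ?thesis by (simp add: D_def E_def)
qed

text \<open>Integration over the time slices. A single \<open>r\<close> serves all of them, because the mass is bounded
  uniformly in time; this is where the supremum over time in the energy estimate enters.\<close>

lemma weak_type_gain_spacetime:
  fixes f :: "(real^'n) \<times> real \<Rightarrow> real"
  assumes cgf: "cont_grad f g" and S: "compact S" and zero: "\<And>x t. t \<in> J \<Longrightarrow> x \<notin> S \<Longrightarrow> f (x, t) = 0"
    and nonneg: "\<And>z. 0 \<le> f z" and L: "\<And>i. 0 < L i" and r: "0 < r" and lam: "0 < lam"
    and [measurable]: "J \<in> sets borel"
    and mass: "\<And>t. t \<in> J \<Longrightarrow> (LBINT x. f (x, t)) \<le> lam * (\<Prod>i\<in>UNIV. 2 * r * L i)"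
  shows "ennreal lam * emeasure lborel {z. snd z \<in> J \<and> 2 * lam \<le> f z}
     \<le> (\<Sum>i\<in>UNIV. ennreal (r * L i) *
          (\<integral>\<^sup>+z. ennreal \<bar>fst (g z) $ i\<bar> * indicator (UNIV \<times> J) z \<partial>lborel))"
proof -
  let ?E = "{z. snd z \<in> J \<and> 2 * lam \<le> f z}"
  have [measurable]: "f \<in> borel_measurable borel" "g \<in> borel_measurable borel"
    using borel_measurable_continuous_UNIV cont_grad_continuous[OF cgf] cont_grad_continuous_grad[OF cgf]
    by blast+
  have [measurable]: "f \<in> borel_measurable (borel \<Otimes>\<^sub>M borel)" "g \<in> borel_measurable (borel \<Otimes>\<^sub>M borel)"
    unfolding borel_prod by measurable
  have "{z \<in> space (borel \<Otimes>\<^sub>M borel). snd z \<in> J \<and> 2 * lam \<le> f z} \<in> sets (borel \<Otimes>\<^sub>M borel)"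
    by measurable
  then have [measurable]: "?E \<in> sets (borel \<Otimes>\<^sub>M borel)"
    by (simp add: space_pair_measure)
  have E: "?E \<in> sets (lborel \<Otimes>\<^sub>M lborel)"
    unfolding lborel_prod by (simp flip: borel_prod)
  have "continuous_on UNIV (\<lambda>z. fst (g z) $ i)" for i
    by (intro continuous_intros cont_grad_continuous_grad[OF cgf])
  then have [measurable]: "(\<lambda>z. fst (g z) $ i) \<in> borel_measurable (borel \<Otimes>\<^sub>M borel)" for i
    unfolding borel_prod by (rule borel_measurable_continuous_UNIV)
  have [measurable]: "UNIV \<times> J \<in> sets (borel \<Otimes>\<^sub>M borel)"
    by (intro pair_measureI) auto
  have m: "(\<lambda>z. ennreal \<bar>fst (g z) $ i\<bar> * indicator (UNIV \<times> J) z) \<in> borel_measurable (lborel \<Otimes>\<^sub>M lborel)" for i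
    by measurable
  have "ennreal lam * emeasure lborel ?E = ennreal lam * emeasure (lborel \<Otimes>\<^sub>M lborel) ?E"
    by (simp add: lborel_prod)
  also have "\<dots> = (\<integral>\<^sup>+t. ennreal lam * emeasure lborel ((\<lambda>x. (x, t)) -` ?E) \<partial>lborel)"
    unfolding lborel_pair.emeasure_pair_measure_alt2[OF E]
    by (rule nn_integral_cmult[symmetric]) (rule lborel_pair.measurable_emeasure_Pair2[OF E])
  also have "\<dots> \<le> (\<integral>\<^sup>+t. (\<Sum>i\<in>UNIV. ennreal (r * L i) *
      (\<integral>\<^sup>+x. ennreal \<bar>fst (g (x, t)) $ i\<bar> * indicator (UNIV \<times> J) (x, t) \<partial>lborel)) \<partial>lborel)"
  proof (rule nn_integral_mono)
    fix t
    show "ennreal lam * emeasure lborel ((\<lambda>x. (x, t)) -` ?E) \<le> (\<Sum>i\<in>UNIV. ennreal (r * L i) *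
      (\<integral>\<^sup>+x. ennreal \<bar>fst (g (x, t)) $ i\<bar> * indicator (UNIV \<times> J) (x, t) \<partial>lborel))"
    proof (cases "t \<in> J")
      case True
      have "ennreal lam * emeasure lborel {x. 2 * lam \<le> f (x, t)}
         \<le> (\<Sum>i\<in>UNIV. ennreal (r * L i) * (\<integral>\<^sup>+x. ennreal \<bar>fst (g (x, t)) $ i\<bar> \<partial>lborel))"
        using zero[OF True] nonneg L r lam mass[OF True]
        by (intro weak_type_gain[OF cont_grad_slice[OF cgf] S]) auto
      then show ?thesis using True by (simp add: vimage_def)
    qed (simp add: vimage_def)
  qed
  also have "\<dots> = (\<Sum>i\<in>UNIV. (\<integral>\<^sup>+t. ennreal (r * L i) *
      (\<integral>\<^sup>+x. ennreal \<bar>fst (g (x, t)) $ i\<bar> * indicator (UNIV \<times> J) (x, t) \<partial>lborel) \<partial>lborel))"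
    by (rule nn_integral_sum) (use m in measurable)
  also have "\<dots> = (\<Sum>i\<in>UNIV. ennreal (r * L i) * (\<integral>\<^sup>+t.
      (\<integral>\<^sup>+x. ennreal \<bar>fst (g (x, t)) $ i\<bar> * indicator (UNIV \<times> J) (x, t) \<partial>lborel) \<partial>lborel))"
    by (intro sum.cong refl nn_integral_cmult) measurable
  also have "\<dots> = (\<Sum>i\<in>UNIV. ennreal (r * L i) *
      (\<integral>\<^sup>+z. ennreal \<bar>fst (g z) $ i\<bar> * indicator (UNIV \<times> J) z \<partial>(lborel \<Otimes>\<^sub>M lborel)))"
    by (intro sum.cong refl arg_cong2[where f="(*)"] lborel_pair.nn_integral_snd m)
  finally show ?thesis by (simp add: lborel_prod)
qed

section \<open>The energy inequality for smooth super-solutions\<close>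

lemma pos_power_derivative:
  "((\<lambda>x::real. (max 0 x) ^ Suc (Suc m)) has_real_derivative real (Suc (Suc m)) * (max 0 x) ^ Suc m) (at x)"
proof -
  consider "x < 0" | "x > 0" | "x = 0" by linarith
  then show ?thesis
  proof cases
    case 1
    have "((\<lambda>x::real. 0::real) has_real_derivative 0) (at x)" by simp
    then have "((\<lambda>x::real. (max 0 x) ^ Suc (Suc m)) has_real_derivative 0) (at x)"
      by (rule has_field_derivative_transform_within_open[of _ _ _ "{..<0}"]) (use 1 in auto)
    then show ?thesis using 1 by simp
  next
    case 2
    have "((\<lambda>x::real. x ^ Suc (Suc m)) has_real_derivative real (Suc (Suc m)) * x ^ Suc m) (at x)"
      using DERIV_pow[of "Suc (Suc m)" x] by simp
    then have "((\<lambda>x::real. (max 0 x) ^ Suc (Suc m)) has_real_derivative real (Suc (Suc m)) * x ^ Suc m) (at x)"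
      by (rule has_field_derivative_transform_within_open[of _ _ _ "{0<..}"]) (use 2 in \<open>auto simp: max_def\<close>)
    then show ?thesis using 2 by simp
  next
    case 3
    have "isCont (\<lambda>x::real. (max 0 x) ^ Suc m) 0" by (intro continuous_intros)
    moreover have "\<forall>z::real. (max 0 z) ^ Suc (Suc m) - (max 0 0) ^ Suc (Suc m) = (max 0 z) ^ Suc m * (z - 0)"
      by (auto simp: max_def)
    ultimately have "((\<lambda>x::real. (max 0 x) ^ Suc (Suc m)) has_real_derivative 0) (at 0)"
      unfolding CARAT_DERIV by (intro exI[of _ "\<lambda>x. (max 0 x) ^ Suc m"]) auto
    then show ?thesis using 3 by simp
  qed
qed

lemma pos_part_derivatives:
  "((\<lambda>x::real. (max 0 (k - x))\<^sup>2) has_real_derivative - 2 * max 0 (k - x)) (at x)"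
  "((\<lambda>x::real. (max 0 (k - x)) ^ 3 / 3) has_real_derivative - (max 0 (k - x))\<^sup>2) (at x)"
proof -
  have d: "((\<lambda>x::real. k - x) has_real_derivative - 1) (at x)" for x
    by (auto intro!: derivative_eq_intros)
  show "((\<lambda>x::real. (max 0 (k - x))\<^sup>2) has_real_derivative - 2 * max 0 (k - x)) (at x)"
    using DERIV_chain2[OF pos_power_derivative[of 0 "k - x"] d] by (simp add: numeral_2_eq_2)
  have "((\<lambda>x::real. (max 0 (k - x)) ^ 3) has_real_derivative - 3 * (max 0 (k - x))\<^sup>2) (at x)"
    using DERIV_chain2[OF pos_power_derivative[of 1 "k - x"] d]
    by (simp add: numeral_2_eq_2 numeral_3_eq_3)
  then show "((\<lambda>x::real. (max 0 (k - x)) ^ 3 / 3) has_real_derivative - (max 0 (k - x))\<^sup>2) (at x)"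
    using DERIV_cdivide[of _ "- 3 * (max 0 (k - x))\<^sup>2" x UNIV 3] by simp
qed

lemma integrable_slab:
  fixes F :: "'a::euclidean_space \<times> real \<Rightarrow> real"
  assumes "compact S" "continuous_on UNIV F"
  shows "integrable lborel (\<lambda>z. indicator (S \<times> {t0..\<tau>}) z * F z)"
  using borel_integrable_compact[of "S \<times> {t0..\<tau>}" F] assms
  by (auto intro: compact_Times continuous_on_subset)

lemma slab_integral_time_derivative:
  fixes P :: "'a::euclidean_space \<times> real \<Rightarrow> real"
  assumes cgP: "cont_grad P gP" and S: "compact S" and zero: "\<And>x t. x \<notin> S \<Longrightarrow> P (x, t) = 0"
    and t: "t0 \<le> \<tau>"
  shows "(LBINT z. indicator (S \<times> {t0..\<tau>}) z * snd (gP z)) = (LBINT x. P (x, \<tau>) - P (x, t0))"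
proof -
  have c: "continuous_on UNIV (\<lambda>z. snd (gP z))"
    by (intro continuous_intros cont_grad_continuous_grad[OF cgP])
  have i: "integrable (lborel \<Otimes>\<^sub>M lborel) (\<lambda>z. indicator (S \<times> {t0..\<tau>}) z * snd (gP z))"
    unfolding lborel_prod by (rule integrable_slab[OF S c])
  have "(LBINT z. indicator (S \<times> {t0..\<tau>}) z * snd (gP z))
    = (LBINT x. (LBINT t. indicator (S \<times> {t0..\<tau>}) (x, t) * snd (gP (x, t))))"
    using lborel_pair.integral_fst'[OF i] by (simp add: lborel_prod)
  also have "\<dots> = (LBINT x. P (x, \<tau>) - P (x, t0))"
  proof (rule Bochner_Integration.integral_cong[OF refl])
    fix x
    have "(LBINT t. snd (gP (x, t)) * indicator {t0..\<tau>} t) = P (x, \<tau>) - P (x, t0)"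
    proof (rule integral_FTC_Icc_real[OF t])
      fix t
      show "((\<lambda>t. P (x, t)) has_real_derivative snd (gP (x, t))) (at t)"
        using cont_grad_line[OF cgP, of "(x, 0)" "(0, 1)" t] by (simp add: inner_prod_def)
      have "continuous_on UNIV (\<lambda>t. snd (gP (x, t)))"
        by (rule continuous_on_compose2[OF c]) (auto intro!: continuous_intros)
      then show "isCont (\<lambda>t. snd (gP (x, t))) t"
        by (simp add: continuous_on_eq_continuous_at)
    qed
    then show "(LBINT t. indicator (S \<times> {t0..\<tau>}) (x, t) * snd (gP (x, t))) = P (x, \<tau>) - P (x, t0)"
      by (cases "x \<in> S") (auto simp: zero indicator_times mult.commute)
  qed
  finally show ?thesis .
qed

lemma slab_integral_space_derivative:
  fixes P :: "'a::euclidean_space \<times> real \<Rightarrow> real"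
  assumes cgP: "cont_grad P gP" and S: "compact S" and zero: "\<And>x t. x \<notin> S \<Longrightarrow> P (x, t) = 0"
  shows "(LBINT z. indicator (S \<times> {t0..\<tau>}) z * (fst (gP z) \<bullet> e)) = 0"
proof -
  have c: "continuous_on UNIV (\<lambda>z. fst (gP z) \<bullet> e)"
    by (intro continuous_intros cont_grad_continuous_grad[OF cgP])
  define F where "F z = indicator (S \<times> {t0..\<tau>}) z * (fst (gP z) \<bullet> e)" for z
  have "integrable (lborel \<Otimes>\<^sub>M lborel) F"
    using integrable_slab[OF S c, of t0 \<tau>] by (simp only: lborel_prod F_def[abs_def])
  then have i: "integrable (lborel \<Otimes>\<^sub>M lborel) (\<lambda>(x, t). F (x, t))"
    by simp
  have "(LBINT z. indicator (S \<times> {t0..\<tau>}) z * (fst (gP z) \<bullet> e))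
    = (LBINT t. (LBINT x. indicator (S \<times> {t0..\<tau>}) (x, t) * (fst (gP (x, t)) \<bullet> e)))"
    using lborel_pair.integral_snd[OF i] by (simp add: lborel_prod flip: F_def)
  also have "\<dots> = (\<integral>t. 0 \<partial>(lborel :: real measure))"
  proof (rule Bochner_Integration.integral_cong[OF refl])
    fix t
    have "fst (gP (x, t)) = 0" if "x \<notin> S" for x
      by (rule cont_grad_zero_outside[OF cont_grad_slice[OF cgP] compact_imp_closed[OF S]])
        (use zero that in auto)
    then have "(LBINT x. indicator (S \<times> {t0..\<tau>}) (x, t) * (fst (gP (x, t)) \<bullet> e))
      = (LBINT x. indicator {t0..\<tau>} t * (fst (gP (x, t)) \<bullet> e))"
      by (intro Bochner_Integration.integral_cong[OF refl]) (auto simp: indicator_def)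
    also have "\<dots> = 0"
      using integral_directional_derivative_zero[OF cont_grad_slice[OF cgP] S, of t e] zero by simp
    finally show "(LBINT x. indicator (S \<times> {t0..\<tau>}) (x, t) * (fst (gP (x, t)) \<bullet> e)) = 0" .
  qed
  finally show ?thesis by simp
qed

text \<open>The differential inequality is multiplied by the test function \<open>(k - v)\<^sub>+\<^sup>2 * \<zeta>\<close>. The time derivative
  becomes that of \<open>(k - v)\<^sub>+\<^sup>3 / 3\<close>, up to sign, and the divergences are integrated by parts in space.\<close>

lemma truncation_energy_inequality:
  fixes v \<zeta> :: "(real^'n) \<times> real \<Rightarrow> real" and B :: "'n \<Rightarrow> (real^'n) \<times> real \<Rightarrow> real"
  assumes cv: "cont_grad v gv" and cB: "\<And>i. cont_grad (B i) (gB i)" and cz: "cont_grad \<zeta> g\<zeta>"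
    and S: "compact S" and zero: "\<And>x t. x \<notin> S \<Longrightarrow> \<zeta> (x, t) = 0"
    and nonneg: "\<And>z. 0 \<le> \<zeta> z" and initial: "\<And>x. \<zeta> (x, t0) = 0" and t: "t0 \<le> \<tau>"
    and super: "\<And>z. t0 \<le> snd z \<Longrightarrow> snd z \<le> \<tau> \<Longrightarrow> 0 < \<zeta> z \<Longrightarrow>
      (\<Sum>i\<in>UNIV. fst (gB i z) $ i) \<le> snd (gv z)"
  shows "(LBINT x. (max 0 (k - v (x, \<tau>))) ^ 3 / 3 * \<zeta> (x, \<tau>))
    \<le> (LBINT z. indicator (S \<times> {t0..\<tau>}) z * ((max 0 (k - v z)) ^ 3 / 3 * snd (g\<zeta> z)
        + (\<Sum>i\<in>UNIV. B i z * ((max 0 (k - v z))\<^sup>2 * fst (g\<zeta> z) $ i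
             - 2 * max 0 (k - v z) * fst (gv z) $ i * \<zeta> z))))"
proof -
  define w where "w z = max 0 (k - v z)" for z
  define gH where "gH z = (w z ^ 3 / 3) *\<^sub>R g\<zeta> z + \<zeta> z *\<^sub>R (- (w z)\<^sup>2) *\<^sub>R gv z" for z
  define gh where "gh z = (w z)\<^sup>2 *\<^sub>R g\<zeta> z + \<zeta> z *\<^sub>R (- 2 * w z) *\<^sub>R gv z" for z
  define gQ where "gQ i z = B i z *\<^sub>R gh z + ((w z)\<^sup>2 * \<zeta> z) *\<^sub>R gB i z" for i z
  define R where "R z = w z ^ 3 / 3 * snd (g\<zeta> z) + (\<Sum>i\<in>UNIV. B i z * (fst (gh z) $ i))" for z
  have H: "cont_grad (\<lambda>z. w z ^ 3 / 3 * \<zeta> z) gH"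
    unfolding w_def gH_def
    by (intro cont_grad_mult cz cont_grad_compose[where \<phi>="\<lambda>x. (max 0 (k - x)) ^ 3 / 3"
          and \<phi>'="\<lambda>x. - (max 0 (k - x))\<^sup>2"] pos_part_derivatives cv continuous_intros)
  have h: "cont_grad (\<lambda>z. (w z)\<^sup>2 * \<zeta> z) gh"
    unfolding w_def gh_def
    by (intro cont_grad_mult cz cont_grad_compose[where \<phi>="\<lambda>x. (max 0 (k - x))\<^sup>2"
          and \<phi>'="\<lambda>x. - 2 * max 0 (k - x)"] pos_part_derivatives cv continuous_intros)
  have Q: "cont_grad (\<lambda>z. B i z * ((w z)\<^sup>2 * \<zeta> z)) (gQ i)" for i
    unfolding gQ_def by (intro cont_grad_mult h cB)
  have cont: "continuous_on UNIV v" "continuous_on UNIV \<zeta>" "continuous_on UNIV (B i)"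
    "continuous_on UNIV gv" "continuous_on UNIV g\<zeta>" "continuous_on UNIV (gB i)" for i
    by (rule cont_grad_continuous cont_grad_continuous_grad, rule cv cz cB)+
  have cw: "continuous_on UNIV w"
    unfolding w_def by (intro continuous_intros cont)
  have ch: "continuous_on UNIV gh" by (rule cont_grad_continuous_grad[OF h])
  have cR: "continuous_on UNIV R"
    unfolding R_def by (intro continuous_intros cont cw ch) auto
  have cQ: "continuous_on UNIV (\<lambda>z. fst (gQ i z) \<bullet> axis i 1)" for i
    by (intro continuous_intros cont_grad_continuous_grad[OF Q])
  have cH: "continuous_on UNIV (\<lambda>z. snd (gH z))"
    by (intro continuous_intros cont_grad_continuous_grad[OF H])
  let ?I = "\<lambda>z. indicator (S \<times> {t0..\<tau>}) z :: real"
  have "(LBINT x. w (x, \<tau>) ^ 3 / 3 * \<zeta> (x, \<tau>)) = (LBINT z. ?I z * snd (gH z))"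
    using slab_integral_time_derivative[OF H S _ t] by (simp add: zero initial)
  also have "\<dots> \<le> (LBINT z. ?I z * R z - (\<Sum>i\<in>UNIV. ?I z * (fst (gQ i z) \<bullet> axis i 1)))"
  proof (rule integral_mono)
    show "integrable lborel (\<lambda>z. ?I z * snd (gH z))" by (rule integrable_slab[OF S cH])
    show "integrable lborel (\<lambda>z. ?I z * R z - (\<Sum>i\<in>UNIV. ?I z * (fst (gQ i z) \<bullet> axis i 1)))"
      by (intro Bochner_Integration.integrable_diff Bochner_Integration.integrable_sum
          integrable_slab[OF S cR] integrable_slab[OF S cQ])
    fix z
    have "snd (gH z) \<le> R z - (\<Sum>i\<in>UNIV. fst (gQ i z) \<bullet> axis i 1)" if "z \<in> S \<times> {t0..\<tau>}"
    proof -
      have eq: "R z - (\<Sum>i\<in>UNIV. fst (gQ i z) \<bullet> axis i 1)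
        = w z ^ 3 / 3 * snd (g\<zeta> z) - (w z)\<^sup>2 * \<zeta> z * (\<Sum>i\<in>UNIV. fst (gB i z) $ i)"
        by (simp add: R_def gQ_def inner_axis sum.distrib sum_distrib_left algebra_simps)
      have "(w z)\<^sup>2 * \<zeta> z * (\<Sum>i\<in>UNIV. fst (gB i z) $ i) \<le> (w z)\<^sup>2 * \<zeta> z * snd (gv z)"
      proof (cases "\<zeta> z = 0")
        case False
        then have "0 < \<zeta> z" using nonneg[of z] by simp
        then show ?thesis using super[of z] that nonneg[of z]
          by (intro mult_left_mono) auto
      qed simp
      then show ?thesis unfolding eq by (simp add: gH_def algebra_simps)
    qed
    then show "?I z * snd (gH z) \<le> ?I z * R z - (\<Sum>i\<in>UNIV. ?I z * (fst (gQ i z) \<bullet> axis i 1))"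
      by (cases "z \<in> S \<times> {t0..\<tau>}") auto
  qed
  also have "\<dots> = (LBINT z. ?I z * R z) - (\<Sum>i\<in>UNIV. (LBINT z. ?I z * (fst (gQ i z) \<bullet> axis i 1)))"
    by (simp only: Bochner_Integration.integral_diff[OF integrable_slab[OF S cR]
          Bochner_Integration.integrable_sum[OF integrable_slab[OF S cQ]]]
        Bochner_Integration.integral_sum[OF integrable_slab[OF S cQ]])
  also have "\<dots> = (LBINT z. ?I z * R z)"
    using slab_integral_space_derivative[OF Q S] by (simp add: zero)
  finally show ?thesis
    by (simp add: w_def R_def gh_def algebra_simps)
qed

section \<open>Caccioppoli estimate and gain of integrability for approximate super-solutions\<close>

definition flux :: "real \<Rightarrow> real \<Rightarrow> real" where
  "flux q s = \<bar>s\<bar> powr (q - 2) * s"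

lemma powr_minus_one_mult: "0 \<le> x \<Longrightarrow> x powr (q - 1) * x = x powr q" for x q :: real
proof (cases "x = 0")
  case False
  assume "0 \<le> x"
  have "x powr (q - 1) * x powr 1 = x powr (q - 1 + 1)" by (rule powr_add[symmetric])
  then show ?thesis using \<open>0 \<le> x\<close> by simp
qed simp

lemma flux_mult: "flux q s * s = \<bar>s\<bar> powr q"
proof -
  have "flux q s * s = \<bar>s\<bar> powr (q - 1 - 1) * \<bar>s\<bar> * \<bar>s\<bar>"
    by (simp add: flux_def mult.assoc)
  then show ?thesis by (simp only: powr_minus_one_mult abs_ge_zero)
qed

lemma abs_flux: "\<bar>flux q s\<bar> = \<bar>s\<bar> powr (q - 1)"
  using powr_minus_one_mult[of "\<bar>s\<bar>" "q - 1"] by (simp add: flux_def abs_mult)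

text \<open>The power of the larger one of \<open>x\<close> and \<open>y\<close> dominates the product.\<close>

lemma young_without_constants:
  assumes "0 \<le> x" "0 \<le> y" "1 \<le> (q::real)"
  shows "x powr (q - 1) * y \<le> x powr q + y powr q"
proof (cases "y \<le> x")
  case True
  have "x powr (q - 1) * y \<le> x powr (q - 1) * x" using True by (intro mult_left_mono) auto
  also have "\<dots> = x powr q" using assms by (simp add: powr_minus_one_mult)
  finally show ?thesis by (simp add: add_increasing2)
next
  case False
  have "x powr (q - 1) * y \<le> y powr (q - 1) * y"
    using False assms by (intro mult_right_mono powr_mono2) auto
  also have "\<dots> = y powr q" using assms by (simp add: powr_minus_one_mult)
  finally show ?thesis by (simp add: add_increasing)
qed

text \<open>The integrand of the energy inequality at a point where the truncation has the value \<open>w\<close>, the cut-off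
  the value \<open>z\<close> and the derivative \<open>d\<close>, and the solution the derivative \<open>s\<close>; the number \<open>b\<close> stands for a flux that
  only approximates \<open>flux q s\<close>. The slope condition on the cut-off is what Young's inequality needs:
  it lets \<open>\<bar>s\<bar> powr (q - 1) * \<bar>d\<bar>\<close> be absorbed into \<open>\<bar>s\<bar> powr q * z\<close>.\<close>

lemma flux_pointwise_bound:
  fixes b s w d z c K q :: real
  assumes w: "0 \<le> w" "w \<le> K" and z: "0 \<le> z" "z \<le> 1" and c: "0 \<le> c"
    and d: "\<bar>d\<bar> \<le> c * z powr (1 - 1 / q)" and q: "2 \<le> q"
  shows "b * (w\<^sup>2 * d - 2 * w * s * z)
    \<le> - (w * \<bar>s\<bar> powr q * z) + w * (K * c) powr q
       + (2 * K + K\<^sup>2 * c) * (\<bar>b - flux q s\<bar> * (1 + \<bar>s\<bar>))"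
proof -
  define e where "e = b - flux q s"
  have K: "0 \<le> K" using w by linarith
  have z1: "z powr (1 - 1 / q) \<le> 1" using z q by (intro powr_le1) auto
  have dc: "\<bar>d\<bar> \<le> c" using d mult_left_mono[OF z1 c] by simp
  have "w\<^sup>2 \<le> K\<^sup>2" using w by (intro power_mono) auto
  have "\<bar>w\<^sup>2 * d - 2 * w * s * z\<bar> \<le> w\<^sup>2 * \<bar>d\<bar> + 2 * w * z * \<bar>s\<bar>"
    using w z by (intro order_trans[OF abs_triangle_ineq4]) (simp add: abs_mult)
  also have "\<dots> \<le> K\<^sup>2 * c + 2 * K * 1 * \<bar>s\<bar>"
    using w z K c dc \<open>w\<^sup>2 \<le> K\<^sup>2\<close> by (intro add_mono mult_mono) auto
  also have "\<dots> \<le> (2 * K + K\<^sup>2 * c) * (1 + \<bar>s\<bar>)"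
    using K c by (simp add: algebra_simps)
  finally have A: "\<bar>w\<^sup>2 * d - 2 * w * s * z\<bar> \<le> (2 * K + K\<^sup>2 * c) * (1 + \<bar>s\<bar>)" .
  have "e * (w\<^sup>2 * d - 2 * w * s * z) \<le> \<bar>e\<bar> * \<bar>w\<^sup>2 * d - 2 * w * s * z\<bar>"
    by (metis abs_ge_self abs_mult)
  also have "\<dots> \<le> \<bar>e\<bar> * ((2 * K + K\<^sup>2 * c) * (1 + \<bar>s\<bar>))"
    by (intro mult_left_mono A) auto
  finally have E: "e * (w\<^sup>2 * d - 2 * w * s * z) \<le> (2 * K + K\<^sup>2 * c) * (\<bar>e\<bar> * (1 + \<bar>s\<bar>))"
    by (simp add: mult_ac)
  \<comment> \<open>distribute the power of the cut-off so that Young's inequality returns exactly \<open>z\<close>\<close>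
  have zq: "(z powr (1 / q)) powr q = z" "(z powr (1 / q)) powr (q - 1) = z powr (1 - 1 / q)"
    using z q by (auto simp: powr_powr diff_divide_distrib algebra_simps)
  have "flux q s * d \<le> \<bar>s\<bar> powr (q - 1) * \<bar>d\<bar>"
    by (metis abs_flux abs_ge_self abs_mult)
  also have "\<dots> \<le> \<bar>s\<bar> powr (q - 1) * (c * z powr (1 - 1 / q))"
    using d by (intro mult_left_mono) auto
  also have "\<dots> = (\<bar>s\<bar> * z powr (1 / q)) powr (q - 1) * c"
    using z by (simp add: powr_mult zq)
  finally have "flux q s * d \<le> (\<bar>s\<bar> * z powr (1 / q)) powr (q - 1) * c" .
  from mult_left_mono[OF this w(1)]
  have "w * (flux q s * d) \<le> (\<bar>s\<bar> * z powr (1 / q)) powr (q - 1) * (w * c)"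
    by (simp add: mult_ac)
  also have "\<dots> \<le> (\<bar>s\<bar> * z powr (1 / q)) powr q + (w * c) powr q"
    using w z c q by (intro young_without_constants) auto
  also have "\<dots> \<le> \<bar>s\<bar> powr q * z + (K * c) powr q"
    using w z c q by (intro add_mono powr_mono2 mult_right_mono) (auto simp: powr_mult zq)
  finally have "w * (w * (flux q s * d)) \<le> w * (\<bar>s\<bar> powr q * z + (K * c) powr q)"
    using w(1) by (rule mult_left_mono)
  moreover have "flux q s * (w\<^sup>2 * d - 2 * w * s * z) = w * (w * (flux q s * d)) - 2 * w * z * (flux q s * s)"
    by (simp add: algebra_simps power2_eq_square)
  ultimately have F: "flux q s * (w\<^sup>2 * d - 2 * w * s * z) \<le> - (w * \<bar>s\<bar> powr q * z) + w * (K * c) powr q"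
    unfolding flux_mult by (simp add: algebra_simps)
  have "b * (w\<^sup>2 * d - 2 * w * s * z)
    = flux q s * (w\<^sup>2 * d - 2 * w * s * z) + e * (w\<^sup>2 * d - 2 * w * s * z)"
    by (simp add: e_def algebra_simps)
  then show ?thesis using E F by (simp add: e_def)
qed

text \<open>A smooth function that satisfies the differential inequality for fluxes \<open>B i\<close> which differ from the
  fluxes of its own gradient by an error of small integral. The inequality, the lower bound and the
  error bound are only asked for on the support of the cut-off, since a mollified function has these
  properties only at some distance from the boundary of the domain.\<close>

locale approx_supersolution =
  fixes p :: "'n::finite \<Rightarrow> real" and v :: "(real^'n) \<times> real \<Rightarrow> real" and gv
    and B :: "'n \<Rightarrow> (real^'n) \<times> real \<Rightarrow> real" and gB and \<zeta> g\<zeta>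
    and S :: "(real^'n) set" and t0 t1 k K c0 :: real and c :: "'n \<Rightarrow> real"
    and Er :: "'n \<Rightarrow> (real^'n) \<times> real \<Rightarrow> real"
  assumes p: "\<And>i. 2 \<le> p i"
    and cv: "cont_grad v gv" and cB: "\<And>i. cont_grad (B i) (gB i)" and cz: "cont_grad \<zeta> g\<zeta>"
    and S: "compact S" and zero: "\<And>x t. x \<notin> S \<Longrightarrow> \<zeta> (x, t) = 0"
    and nonneg: "\<And>z. 0 \<le> \<zeta> z" and le1: "\<And>z. \<zeta> z \<le> 1"
    and initial: "\<And>x. \<zeta> (x, t0) = 0" and t: "t0 \<le> t1"
    and c0: "0 \<le> c0" and c: "\<And>i. 0 \<le> c i"
    and time_slope: "\<And>z. \<bar>snd (g\<zeta> z)\<bar> \<le> c0 * \<zeta> z powr (1 / 2)"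
    and space_slope: "\<And>z i. \<bar>fst (g\<zeta> z) $ i\<bar> \<le> c i * \<zeta> z powr (1 - 1 / p i)"
    and super: "\<And>z. t0 \<le> snd z \<Longrightarrow> snd z \<le> t1 \<Longrightarrow> 0 < \<zeta> z \<Longrightarrow>
      (\<Sum>i\<in>UNIV. fst (gB i z) $ i) \<le> snd (gv z)"
    and lower: "\<And>z. t0 \<le> snd z \<Longrightarrow> snd z \<le> t1 \<Longrightarrow> 0 < \<zeta> z \<Longrightarrow> k - K \<le> v z"
    and K: "0 \<le> K"
    and Er: "\<And>i. integrable lborel (Er i)" "\<And>i z. 0 \<le> Er i z"
    and err: "\<And>i z. t0 \<le> snd z \<Longrightarrow> snd z \<le> t1 \<Longrightarrow> 0 < \<zeta> z \<Longrightarrow>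
      \<bar>B i z - flux (p i) (fst (gv z) $ i)\<bar> * (1 + \<bar>fst (gv z) $ i\<bar>) \<le> Er i z"
begin

definition w :: "(real^'n) \<times> real \<Rightarrow> real" where "w z = max 0 (k - v z)"

definition Z :: "((real^'n) \<times> real) set" where
  "Z = {z. t0 \<le> snd z \<and> snd z \<le> t1 \<and> 0 < \<zeta> z \<and> v z < k}"

definition \<Lambda> :: real where "\<Lambda> = K ^ 3 / 3 * c0 + (\<Sum>i\<in>UNIV. K * (K * c i) powr p i)"

definition bound :: real where
  "bound = \<Lambda> * measure lborel Z + (\<Sum>i\<in>UNIV. (2 * K + K\<^sup>2 * c i) * (LBINT z. Er i z))"

lemma continuity: "continuous_on UNIV v" "continuous_on UNIV \<zeta>" "continuous_on UNIV (B i)"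
    "continuous_on UNIV gv" "continuous_on UNIV g\<zeta>" "continuous_on UNIV w"
  unfolding w_def
  by (intro continuous_intros cont_grad_continuous[OF cv] cont_grad_continuous[OF cz] cont_grad_continuous[OF cB]
      cont_grad_continuous_grad[OF cv] cont_grad_continuous_grad[OF cz])+

lemma Z_measurable: "Z \<in> sets borel"
proof -
  have [measurable]: "v \<in> borel_measurable borel" "\<zeta> \<in> borel_measurable borel"
    using continuity by (auto intro: borel_measurable_continuous_UNIV)
  have [measurable]: "(snd :: (real^'n) \<times> real \<Rightarrow> real) \<in> borel_measurable borel"
    by (intro borel_measurable_continuous_UNIV continuous_intros)
  show ?thesis unfolding Z_def by measurable
qed

lemma Z_subset: "Z \<subseteq> S \<times> {t0..t1}"
  unfolding Z_def using zero by fastforce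

lemma Z_finite: "emeasure lborel Z < \<infinity>"
proof -
  have "emeasure lborel Z \<le> emeasure lborel (S \<times> {t0..t1})"
    using Z_subset compact_Times[OF S compact_Icc] by (intro emeasure_mono) (auto intro: borel_compact)
  also have "\<dots> < \<infinity>" by (intro emeasure_compact_finite compact_Times S) auto
  finally show ?thesis .
qed

lemma integrable_Z: "integrable lborel (indicator Z :: _ \<Rightarrow> real)"
  using Z_measurable Z_finite by simp

lemma w_bounds: "0 \<le> w z" "t0 \<le> snd z \<Longrightarrow> snd z \<le> t1 \<Longrightarrow> 0 < \<zeta> z \<Longrightarrow> w z \<le> K"
  using lower[of z] K by (auto simp: w_def)

lemma integrable_density: "integrable lborel (\<lambda>z. indicator (S \<times> {t0..\<tau>}) z * (w z * \<bar>fst (gv z) $ i\<bar> powr p i * \<zeta> z))"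
  using p[of i] by (intro integrable_slab S continuous_intros continuity continuous_on_powr') auto

text \<open>The pointwise bound is integrated over the set \<open>Z\<close> of points in the support of the cut-off with \<open>v < k\<close>.
  Outside of \<open>Z\<close> the integrand vanishes, because the slope conditions force the gradient of the cut-off
  to vanish wherever the cut-off does.\<close>

lemma caccioppoli:
  assumes \<tau>: "t0 \<le> \<tau>" "\<tau> \<le> t1"
  shows "(LBINT x. w (x, \<tau>) ^ 3 / 3 * \<zeta> (x, \<tau>))
    + (\<Sum>i\<in>UNIV. \<integral>z. indicator (S \<times> {t0..\<tau>}) z * (w z * \<bar>fst (gv z) $ i\<bar> powr p i * \<zeta> z) \<partial>lborel) \<le> bound"
proof -
  let ?I = "\<lambda>z. indicator (S \<times> {t0..\<tau>}) z :: real"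
  let ?F = "\<lambda>z. w z ^ 3 / 3 * snd (g\<zeta> z)
        + (\<Sum>i\<in>UNIV. B i z * ((w z)\<^sup>2 * fst (g\<zeta> z) $ i - 2 * w z * fst (gv z) $ i * \<zeta> z))"
  let ?D = "\<lambda>i z. w z * \<bar>fst (gv z) $ i\<bar> powr p i * \<zeta> z"
  let ?R = "\<lambda>z. \<Lambda> * indicator Z z + (\<Sum>i\<in>UNIV. (2 * K + K\<^sup>2 * c i) * Er i z)"
  have iD: "integrable lborel (\<lambda>z. ?I z * ?D i z)" for i by (rule integrable_density)
  have iF: "integrable lborel (\<lambda>z. ?I z * ?F z)"
    by (intro integrable_slab S continuous_intros continuity) auto
  have iR: "integrable lborel ?R"
    using integrable_Z Er by (intro Bochner_Integration.integrable_add Bochner_Integration.integrable_sum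
        integrable_mult_right) auto
  have "(LBINT x. w (x, \<tau>) ^ 3 / 3 * \<zeta> (x, \<tau>)) \<le> (LBINT z. ?I z * ?F z)"
    using truncation_energy_inequality[OF cv cB cz S zero nonneg initial \<tau>(1), where k=k] super \<tau>
    unfolding w_def by force
  also have "\<dots> \<le> (LBINT z. ?R z - (\<Sum>i\<in>UNIV. ?I z * ?D i z))"
  proof (rule integral_mono[OF iF])
    show "integrable lborel (\<lambda>z. ?R z - (\<Sum>i\<in>UNIV. ?I z * ?D i z))"
      by (rule Bochner_Integration.integrable_diff[OF iR Bochner_Integration.integrable_sum[OF iD]])
    fix z
    have L0: "0 \<le> \<Lambda>" unfolding \<Lambda>_def using K c0 c by (intro add_nonneg_nonneg sum_nonneg) auto
    have R0: "0 \<le> ?R z" using L0 K c Er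
      by (intro add_nonneg_nonneg sum_nonneg mult_nonneg_nonneg) auto
    show "?I z * ?F z \<le> ?R z - (\<Sum>i\<in>UNIV. ?I z * ?D i z)"
    proof (cases "z \<in> S \<times> {t0..\<tau>}")
      case False
      then show ?thesis using R0 by (simp add: indicator_def)
    next
      case True
      then have tz: "t0 \<le> snd z" "snd z \<le> t1" using \<tau> by (auto simp: mem_Times_iff)
      have "?F z \<le> ?R z - (\<Sum>i\<in>UNIV. ?D i z)"
      proof (cases "0 < \<zeta> z \<and> 0 < w z")
        case False
        then have "\<zeta> z = 0 \<or> w z = 0" using nonneg[of z] w_bounds(1)[of z] by linarith
        moreover have "snd (g\<zeta> z) = 0" "fst (g\<zeta> z) $ i = 0" if "\<zeta> z = 0" for i
          using time_slope[of z] space_slope[of z i] that by auto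
        ultimately have "?F z = 0" "(\<Sum>i\<in>UNIV. ?D i z) = 0" by auto
        then show ?thesis using R0 by linarith
      next
        case wz: True
        then have zZ: "z \<in> Z" using tz by (auto simp: Z_def w_def)
        have wK: "w z \<le> K" using w_bounds(2)[OF tz] wz by simp
        have "w z ^ 3 / 3 * snd (g\<zeta> z) \<le> w z ^ 3 / 3 * c0"
        proof (intro mult_left_mono)
          have "\<zeta> z powr (1 / 2) \<le> 1" using nonneg[of z] le1[of z] by (intro powr_le1) auto
          then have "c0 * \<zeta> z powr (1 / 2) \<le> c0 * 1" using c0 by (intro mult_left_mono)
          then show "snd (g\<zeta> z) \<le> c0" using time_slope[of z] by linarith
        qed (use wz in auto)
        also have "\<dots> \<le> K ^ 3 / 3 * c0"
          using wK wz c0 by (intro mult_right_mono divide_right_mono power_mono) auto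
        finally have 1: "w z ^ 3 / 3 * snd (g\<zeta> z) \<le> K ^ 3 / 3 * c0" .
        have 2: "B i z * ((w z)\<^sup>2 * fst (g\<zeta> z) $ i - 2 * w z * fst (gv z) $ i * \<zeta> z)
            \<le> - ?D i z + K * (K * c i) powr p i + (2 * K + K\<^sup>2 * c i) * Er i z" for i
        proof -
          have "B i z * ((w z)\<^sup>2 * fst (g\<zeta> z) $ i - 2 * w z * fst (gv z) $ i * \<zeta> z)
            \<le> - ?D i z + w z * (K * c i) powr p i
              + (2 * K + K\<^sup>2 * c i) * (\<bar>B i z - flux (p i) (fst (gv z) $ i)\<bar> * (1 + \<bar>fst (gv z) $ i\<bar>))"
            by (rule flux_pointwise_bound[OF w_bounds(1) wK nonneg le1 c space_slope p])
          also have "\<dots> \<le> - ?D i z + K * (K * c i) powr p i + (2 * K + K\<^sup>2 * c i) * Er i z"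
            using wK K c err[OF tz] wz
            by (intro add_mono mult_right_mono mult_left_mono order_refl) auto
          finally show ?thesis .
        qed
        have "?F z \<le> K ^ 3 / 3 * c0
          + (\<Sum>i\<in>UNIV. - ?D i z + K * (K * c i) powr p i + (2 * K + K\<^sup>2 * c i) * Er i z)"
          by (intro add_mono 1 sum_mono 2)
        also have "\<dots> = ?R z - (\<Sum>i\<in>UNIV. ?D i z)"
          using zZ by (simp add: \<Lambda>_def sum.distrib sum_negf sum_subtractf)
        finally show ?thesis .
      qed
      then show ?thesis using True by simp
    qed
  qed
  also have "\<dots> = bound - (\<Sum>i\<in>UNIV. \<integral>z. ?I z * ?D i z \<partial>lborel)"
  proof -
    have "(LBINT z. ?R z) = bound"
      using integrable_Z Er by (simp add: bound_def)
    then show ?thesis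
      by (simp only: Bochner_Integration.integral_diff[OF iR Bochner_Integration.integrable_sum[OF iD]]
        Bochner_Integration.integral_sum[OF iD])
  qed
  finally show ?thesis by linarith
qed

text \<open>The weak-type inequality for \<open>w ^ 3 / 3 * \<zeta>\<close>. Its mass at each time and the integral of its gradient
  are bounded by the two terms of the energy estimate at the same level, because the factor \<open>w\<^sup>2\<close> in
  the gradient is at most \<open>K\<close> times the weight \<open>w\<close> of the energy.\<close>

lemma gain:
  assumes L: "\<And>i. 0 < L i" and r: "0 < r" and lam: "0 < lam"
    and M: "bound \<le> M" "M \<le> lam * (\<Prod>i\<in>UNIV. 2 * r * L i)"
  shows "lam * measure lborel {z. t0 \<le> snd z \<and> snd z \<le> t1 \<and> 2 * lam \<le> w z ^ 3 / 3 * \<zeta> z}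
    \<le> r * (\<Sum>i\<in>UNIV. (L i * c i * K ^ 3 / 3 + K\<^sup>2) * measure lborel Z + K * L i powr p i * M)"
proof -
  define f where "f z = w z ^ 3 / 3 * \<zeta> z" for z
  define gf where "gf z = (w z ^ 3 / 3) *\<^sub>R g\<zeta> z + \<zeta> z *\<^sub>R (- (w z)\<^sup>2) *\<^sub>R gv z" for z
  define D where "D i z = w z * \<bar>fst (gv z) $ i\<bar> powr p i * \<zeta> z" for i z
  let ?I = "\<lambda>z. indicator (S \<times> {t0..t1}) z :: real"
  let ?E = "{z. snd z \<in> {t0..t1} \<and> 2 * lam \<le> f z}"
  have cf: "cont_grad f gf"
    unfolding f_def w_def gf_def
    by (intro cont_grad_mult cz cont_grad_compose[where \<phi>="\<lambda>x. (max 0 (k - x)) ^ 3 / 3"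
          and \<phi>'="\<lambda>x. - (max 0 (k - x))\<^sup>2"] pos_part_derivatives cv continuous_intros)
  have D0: "0 \<le> ?I z * D i z" for i z using w_bounds(1) nonneg by (simp add: D_def)
  have iD: "integrable lborel (\<lambda>z. ?I z * D i z)" for i unfolding D_def by (rule integrable_density)
  have f0: "0 \<le> f z" for z using w_bounds(1) nonneg by (simp add: f_def)
  have ID: "(LBINT z. ?I z * D i z) \<le> M" for i
  proof -
    have "(LBINT z. ?I z * D i z) \<le> (\<Sum>i\<in>UNIV. \<integral>z. ?I z * D i z \<partial>lborel)"
      using D0 by (intro member_le_sum) auto
    moreover have "0 \<le> (LBINT x. f (x, t1))" using f0 by simp
    ultimately show ?thesis using caccioppoli[OF t order_refl] M(1) by (simp add: f_def D_def)
  qed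
  have M0: "0 \<le> M" using ID[of undefined] D0 by (intro order_trans[OF _ ID]) simp
  have mass: "(LBINT x. f (x, \<tau>)) \<le> lam * (\<Prod>i\<in>UNIV. 2 * r * L i)" if "\<tau> \<in> {t0..t1}" for \<tau>
  proof -
    have "0 \<le> (\<Sum>i\<in>UNIV. \<integral>z. indicator (S \<times> {t0..\<tau>}) z * D i z \<partial>lborel)"
      using w_bounds(1) nonneg by (intro sum_nonneg integral_nonneg_AE AE_I2) (simp add: D_def)
    then show ?thesis using caccioppoli[of \<tau>] M that by (simp add: f_def D_def)
  qed
  have r0: "0 \<le> (L i * c i * K ^ 3 / 3 + K\<^sup>2) * indicator Z z + K * L i powr p i * (?I z * D i z)" for i z
  proof -
    have "0 \<le> (L i * c i * K ^ 3 / 3 + K\<^sup>2) * indicator Z z"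
      using L[of i] c[of i] K by (intro add_nonneg_nonneg mult_nonneg_nonneg) auto
    moreover have "0 \<le> K * L i powr p i * (?I z * D i z)"
      using K by (intro mult_nonneg_nonneg[OF _ D0]) auto
    ultimately show ?thesis by linarith
  qed
  have pt: "L i * \<bar>fst (gf z) $ i\<bar> * indicator (UNIV \<times> {t0..t1}) z
     \<le> (L i * c i * K ^ 3 / 3 + K\<^sup>2) * indicator Z z + K * L i powr p i * (?I z * D i z)" (is "?l \<le> ?r") for i z
  proof (cases "z \<in> Z")
    case True
    then have tz: "t0 \<le> snd z" "snd z \<le> t1" "0 < \<zeta> z" by (auto simp: Z_def)
    have zI: "z \<in> S \<times> {t0..t1}" using True Z_subset by auto
    have wK: "0 \<le> w z" "w z \<le> K" using w_bounds tz by auto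
    have sl: "\<bar>fst (g\<zeta> z) $ i\<bar> \<le> c i"
    proof -
      have "\<zeta> z powr (1 - 1 / p i) \<le> 1" using nonneg[of z] le1[of z] p[of i] by (intro powr_le1) auto
      then have "c i * \<zeta> z powr (1 - 1 / p i) \<le> c i * 1" using c by (intro mult_left_mono)
      then show ?thesis using space_slope[of z i] by linarith
    qed
    let ?s = "\<bar>fst (gv z) $ i\<bar>"
    \<comment> \<open>the gradient of the energy appears with the power \<open>p i\<close>, that of the gain with the power one\<close>
    have Ls: "L i * ?s \<le> 1 + L i powr p i * ?s powr p i"
    proof (cases "L i * ?s \<le> 1")
      case False
      then have "(L i * ?s) powr 1 \<le> (L i * ?s) powr p i"
        using p[of i] by (intro powr_mono) auto
      then show ?thesis using False L[of i] by (simp add: powr_mult)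
    qed (simp add: add_increasing2)
    have "L i * \<bar>fst (gf z) $ i\<bar> \<le> L i * (w z ^ 3 / 3 * \<bar>fst (g\<zeta> z) $ i\<bar> + \<zeta> z * (w z)\<^sup>2 * ?s)"
      using L[of i] wK tz
      by (intro mult_left_mono) (auto simp: gf_def abs_mult intro!: order_trans[OF abs_triangle_ineq4])
    also have "\<dots> = L i * \<bar>fst (g\<zeta> z) $ i\<bar> * (w z ^ 3 / 3) + (w z)\<^sup>2 * \<zeta> z * (L i * ?s)"
      by (simp add: algebra_simps)
    also have "\<dots> \<le> L i * c i * (K ^ 3 / 3) + (w z)\<^sup>2 * \<zeta> z * (1 + L i powr p i * ?s powr p i)"
      using L[of i] wK tz sl c[of i] Ls
      by (intro add_mono mult_mono divide_right_mono power_mono order_refl mult_nonneg_nonneg) auto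
    also have "\<dots> = L i * c i * K ^ 3 / 3 + (w z)\<^sup>2 * \<zeta> z + w z * (L i powr p i * D i z)"
      by (simp add: D_def power2_eq_square algebra_simps)
    also have "\<dots> \<le> L i * c i * K ^ 3 / 3 + K\<^sup>2 * 1 + K * (L i powr p i * D i z)"
      using wK tz le1[of z] K by (intro add_mono mult_mono power_mono order_refl) (auto simp: D_def)
    finally show ?thesis using True zI by (simp add: indicator_def mem_Times_iff algebra_simps)
  next
    case False
    have "?l = 0"
    proof (cases "snd z \<in> {t0..t1}")
      case True
      then have "\<zeta> z = 0 \<or> w z = 0" using False nonneg[of z] by (force simp: Z_def w_def)
      moreover have "fst (g\<zeta> z) $ i = 0" if "\<zeta> z = 0" using space_slope[of z i] that by simp
      ultimately show ?thesis by (auto simp: gf_def)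
    qed (auto simp: indicator_def mem_Times_iff)
    then show ?thesis using r0[of i z] by linarith
  qed
  let ?b = "\<lambda>i. (L i * c i * K ^ 3 / 3 + K\<^sup>2) * measure lborel Z + K * L i powr p i * M"
  have b0: "0 \<le> ?b i" for i using L[of i] c[of i] K M0 by (intro add_nonneg_nonneg mult_nonneg_nonneg) auto
  have part: "ennreal (L i) * (\<integral>\<^sup>+z. ennreal \<bar>fst (gf z) $ i\<bar> * indicator (UNIV \<times> {t0..t1}) z \<partial>lborel) \<le> ennreal (?b i)" for i
  proof -
    have "continuous_on UNIV (\<lambda>z. fst (gf z) $ i)"
      by (intro continuous_intros cont_grad_continuous_grad[OF cf])
    then have [measurable]: "(\<lambda>z. fst (gf z) $ i) \<in> borel_measurable borel"
      by (rule borel_measurable_continuous_UNIV)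
    have [measurable]: "UNIV \<times> {t0..t1} \<in> sets (borel :: ((real^'n) \<times> real) measure)"
      by (intro borel_closed closed_Times) auto
    have "ennreal (L i) * (\<integral>\<^sup>+z. ennreal \<bar>fst (gf z) $ i\<bar> * indicator (UNIV \<times> {t0..t1}) z \<partial>lborel)
      = (\<integral>\<^sup>+z. ennreal (L i * \<bar>fst (gf z) $ i\<bar> * indicator (UNIV \<times> {t0..t1}) z) \<partial>lborel)"
      using L[of i] by (subst nn_integral_cmult[symmetric])
        (auto intro!: nn_integral_cong simp: ennreal_mult indicator_def mult.assoc)
    also have "\<dots> \<le> (\<integral>\<^sup>+z. ennreal ((L i * c i * K ^ 3 / 3 + K\<^sup>2) * indicator Z z + K * L i powr p i * (?I z * D i z)) \<partial>lborel)"
      by (intro nn_integral_mono ennreal_leI pt)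
    also have "\<dots> = ennreal (LBINT z. (L i * c i * K ^ 3 / 3 + K\<^sup>2) * indicator Z z + K * L i powr p i * (?I z * D i z))"
    proof (rule nn_integral_eq_integral)
      show "integrable lborel (\<lambda>z. (L i * c i * K ^ 3 / 3 + K\<^sup>2) * indicator Z z + K * L i powr p i * (?I z * D i z))"
        using integrable_Z iD[of i] by (intro Bochner_Integration.integrable_add integrable_mult_right) auto
      show "AE z in lborel. 0 \<le> (L i * c i * K ^ 3 / 3 + K\<^sup>2) * indicator Z z + K * L i powr p i * (?I z * D i z)"
        by (intro AE_I2 r0)
    qed
    also have "\<dots> \<le> ennreal (?b i)"
    proof (rule ennreal_leI)
      have "(LBINT z. (L i * c i * K ^ 3 / 3 + K\<^sup>2) * indicator Z z + K * L i powr p i * (?I z * D i z))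
        = (L i * c i * K ^ 3 / 3 + K\<^sup>2) * measure lborel Z + K * L i powr p i * (LBINT z. ?I z * D i z)"
        using integrable_Z iD[of i] by (subst Bochner_Integration.integral_add) (auto intro!: integrable_mult_right)
      also have "\<dots> \<le> ?b i" using ID[of i] K by (intro add_left_mono mult_left_mono) auto
      finally show "(LBINT z. (L i * c i * K ^ 3 / 3 + K\<^sup>2) * indicator Z z + K * L i powr p i * (?I z * D i z)) \<le> ?b i" .
    qed
    finally show ?thesis .
  qed
  have "ennreal lam * emeasure lborel ?E
    \<le> (\<Sum>i\<in>UNIV. ennreal (r * L i) * (\<integral>\<^sup>+z. ennreal \<bar>fst (gf z) $ i\<bar> * indicator (UNIV \<times> {t0..t1}) z \<partial>lborel))"
    using zero by (intro weak_type_gain_spacetime[OF cf S _ f0 L r lam _ mass]) (auto simp: f_def)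
  also have "\<dots> = (\<Sum>i\<in>UNIV. ennreal r * (ennreal (L i) * (\<integral>\<^sup>+z. ennreal \<bar>fst (gf z) $ i\<bar> * indicator (UNIV \<times> {t0..t1}) z \<partial>lborel)))"
    using r L by (intro sum.cong refl) (simp add: ennreal_mult less_imp_le mult.assoc)
  also have "\<dots> \<le> (\<Sum>i\<in>UNIV. ennreal r * ennreal (?b i))"
    by (intro sum_mono mult_left_mono part) auto
  also have "\<dots> = ennreal (r * (\<Sum>i\<in>UNIV. ?b i))"
    using r b0 by (simp add: sum_distrib_left ennreal_mult[symmetric] sum_ennreal)
  finally have main: "ennreal lam * emeasure lborel ?E \<le> ennreal (r * (\<Sum>i\<in>UNIV. ?b i))" .
  have fin: "emeasure lborel ?E \<noteq> \<infinity>"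
  proof
    assume "emeasure lborel ?E = \<infinity>"
    then show False using main lam by (simp add: ennreal_mult_top top_unique)
  qed
  then have "ennreal (lam * measure lborel ?E) \<le> ennreal (r * (\<Sum>i\<in>UNIV. ?b i))"
    using main lam by (simp add: emeasure_eq_ennreal_measure ennreal_mult)
  then have "lam * measure lborel ?E \<le> r * (\<Sum>i\<in>UNIV. ?b i)"
    using r b0 by (subst (asm) ennreal_le_iff) (auto intro!: mult_nonneg_nonneg sum_nonneg)
  then show ?thesis by (simp add: f_def)
qed

end

section \<open>Mollification\<close>

definition conv :: "('a::euclidean_space \<Rightarrow> real) \<Rightarrow> ('a \<Rightarrow> real) \<Rightarrow> 'a \<Rightarrow> real" where
  "conv F \<phi> z = (LBINT w. F w * \<phi> (z - w))"

definition mollifier :: "real \<Rightarrow> ('a::euclidean_space \<Rightarrow> real) \<Rightarrow> ('a \<Rightarrow> 'a) \<Rightarrow> bool" where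
  "mollifier e \<phi> g \<longleftrightarrow> cont_grad \<phi> g \<and> (\<forall>z. 0 \<le> \<phi> z) \<and> (\<forall>z. e \<le> norm z \<longrightarrow> \<phi> z = 0) \<and>
     (LBINT z. \<phi> z) = 1"

lemma mollifier_cont_grad: "mollifier e \<phi> g \<Longrightarrow> cont_grad \<phi> g"
  and mollifier_nonneg: "mollifier e \<phi> g \<Longrightarrow> 0 \<le> \<phi> z"
  and mollifier_zero: "mollifier e \<phi> g \<Longrightarrow> e \<le> norm z \<Longrightarrow> \<phi> z = 0"
  and mollifier_integral: "mollifier e \<phi> g \<Longrightarrow> (LBINT z. \<phi> z) = 1"
  by (auto simp: mollifier_def)

lemma bounded_of_compact_support:
  fixes f :: "'a::euclidean_space \<Rightarrow> 'b::real_normed_vector"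
  assumes "continuous_on UNIV f" "\<And>z. e \<le> norm z \<Longrightarrow> f z = 0"
  shows "\<exists>M. \<forall>z. norm (f z) \<le> M"
proof -
  have "compact (f ` cball 0 e)"
    by (intro compact_continuous_image continuous_on_subset[OF assms(1)]) auto
  then have "bounded (f ` cball 0 e)" by (rule compact_imp_bounded)
  then obtain M where M: "\<And>y. y \<in> f ` cball 0 e \<Longrightarrow> norm y \<le> M"
    unfolding bounded_iff by auto
  have "norm (f z) \<le> max M 0" for z
    using M[of "f z"] assms(2)[of z] by (cases "z \<in> cball 0 e") (auto simp: le_max_iff_disj)
  then show ?thesis by blast
qed

lemma mollifier_continuous: "mollifier e \<phi> g \<Longrightarrow> continuous_on UNIV \<phi>"
  by (rule cont_grad_continuous[OF mollifier_cont_grad])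

lemma mollifier_measurable: "mollifier e \<phi> g \<Longrightarrow> \<phi> \<in> borel_measurable borel"
  by (rule borel_measurable_continuous_UNIV[OF mollifier_continuous])

lemma mollifier_integrable: "mollifier e \<phi> g \<Longrightarrow> integrable lborel \<phi>"
  by (rule integrable_compact_support[OF mollifier_continuous, of e \<phi> g "cball 0 e"])
    (auto simp: mollifier_zero)

lemma mollifier_gradient_zero:
  assumes "mollifier e \<phi> g" "e \<le> norm z"
  shows "g z = 0"
proof -
  have "\<forall>w\<in>UNIV. \<phi> z \<le> \<phi> w"
    using mollifier_zero[OF assms] mollifier_nonneg[OF assms(1)] by simp
  then have "(\<lambda>h. g z \<bullet> h) = (\<lambda>_. 0)"
    using differential_zero_maxmin[of z UNIV \<phi>] cont_grad_derivative[OF mollifier_cont_grad[OF assms(1)]]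
    by auto
  then show ?thesis by (metis inner_eq_zero_iff)
qed

lemma integrable_mult_bounded:
  fixes F G :: "'a::euclidean_space \<Rightarrow> real"
  assumes "integrable lborel F" "G \<in> borel_measurable borel" "\<And>w. \<bar>G w\<bar> \<le> M"
  shows "integrable lborel (\<lambda>w. F w * G w)"
proof (rule Bochner_Integration.integrable_bound)
  show "integrable lborel (\<lambda>w. M * \<bar>F w\<bar>)" using assms(1) by auto
  show "(\<lambda>w. F w * G w) \<in> borel_measurable lborel"
    using borel_measurable_integrable[OF assms(1)] assms(2) by measurable
  have "\<bar>F w\<bar> * \<bar>G w\<bar> \<le> \<bar>M * \<bar>F w\<bar>\<bar>" for w
    using mult_left_mono[OF assms(3)[of w], of "\<bar>F w\<bar>"] by (simp add: mult.commute)
  then show "AE w in lborel. norm (F w * G w) \<le> norm (M * \<bar>F w\<bar>)"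
    by (simp add: abs_mult)
qed

lemma integrable_conv_integrand:
  fixes F \<phi> :: "'a::euclidean_space \<Rightarrow> real"
  assumes F: "integrable lborel F" and \<phi>: "continuous_on UNIV \<phi>" "\<And>z. e \<le> norm z \<Longrightarrow> \<phi> z = 0"
  shows "integrable lborel (\<lambda>w. F w * \<phi> (z - w))"
proof -
  obtain M where M: "\<And>z. norm (\<phi> z) \<le> M" 
    using bounded_of_compact_support[OF \<phi>] by auto
  have [measurable]: "\<phi> \<in> borel_measurable borel" by (rule borel_measurable_continuous_UNIV[OF \<phi>(1)])
  show ?thesis
  proof (rule integrable_mult_bounded[OF F, where G="\<lambda>w. \<phi> (z - w)" and M=M])
    show "(\<lambda>w. \<phi> (z - w)) \<in> borel_measurable borel" by measurable
    show "\<bar>\<phi> (z - w)\<bar> \<le> M" for w using M[of "z - w"] by simp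
  qed
qed

lemma conv_continuous:
  fixes F \<phi> :: "'a::euclidean_space \<Rightarrow> real"
  assumes F: "integrable lborel F" and \<phi>: "continuous_on UNIV \<phi>" "\<And>z. e \<le> norm z \<Longrightarrow> \<phi> z = 0"
  shows "continuous_on UNIV (conv F \<phi>)"
proof -
  obtain M where M: "\<And>z. norm (\<phi> z) \<le> M" 
    using bounded_of_compact_support[OF \<phi>] by auto
  have [measurable]: "\<phi> \<in> borel_measurable borel" by (rule borel_measurable_continuous_UNIV[OF \<phi>(1)])
  have [measurable]: "F \<in> borel_measurable borel" using borel_measurable_integrable[OF F] by simp
  show ?thesis
    unfolding continuous_on_sequentially
  proof (intro allI ballI impI, elim conjE)
    fix x :: "nat \<Rightarrow> 'a" and a assume x: "x \<longlonglongrightarrow> a"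
    show "(conv F \<phi> \<circ> x) \<longlonglongrightarrow> conv F \<phi> a"
      unfolding conv_def comp_def
    proof (rule integral_dominated_convergence[where w="\<lambda>w. M * \<bar>F w\<bar>"])
      show "integrable lborel (\<lambda>w. M * \<bar>F w\<bar>)" using F by auto
      show "AE w in lborel. (\<lambda>i. F w * \<phi> (x i - w)) \<longlonglongrightarrow> F w * \<phi> (a - w)"
      proof (rule AE_I2)
        fix w
        have c: "isCont \<phi> (a - w)" using \<phi>(1) by (simp add: continuous_on_eq_continuous_at)
        have "(\<lambda>i. x i - w) \<longlonglongrightarrow> a - w" by (intro tendsto_diff x tendsto_const)
        from isCont_tendsto_compose[OF c this]
        show "(\<lambda>i. F w * \<phi> (x i - w)) \<longlonglongrightarrow> F w * \<phi> (a - w)"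
          by (intro tendsto_mult tendsto_const)
      qed
      show "AE w in lborel. norm (F w * \<phi> (x i - w)) \<le> M * \<bar>F w\<bar>" for i
        
      proof (rule AE_I2)
        fix w
        have "\<bar>F w\<bar> * \<bar>\<phi> (x i - w)\<bar> \<le> \<bar>F w\<bar> * M"
          using M[of "x i - w"] by (intro mult_left_mono) auto
        then show "norm (F w * \<phi> (x i - w)) \<le> M * \<bar>F w\<bar>"
          by (simp only: real_norm_def abs_mult mult.commute[of M])
      qed
    qed measurable
  qed
qed

lemma compact_support_uniformly_continuous:
  fixes f :: "'a::euclidean_space \<Rightarrow> 'b::real_normed_vector"
  assumes c: "continuous_on UNIV f" and z: "\<And>z. r \<le> norm z \<Longrightarrow> f z = 0" and e: "0 < e"
  obtains d where "0 < d" "\<And>x y. norm (x - y) < d \<Longrightarrow> norm (f x - f y) < e"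
proof -
  have "uniformly_continuous_on (cball 0 (r + 1)) f"
    by (intro compact_uniformly_continuous continuous_on_subset[OF c]) auto
  then obtain d where d: "0 < d"
    "\<And>x y. x \<in> cball 0 (r + 1) \<Longrightarrow> y \<in> cball 0 (r + 1) \<Longrightarrow> dist y x < d \<Longrightarrow> dist (f y) (f x) < e"
    unfolding uniformly_continuous_on_def using e by metis
  have "norm (f x - f y) < e" if "norm (x - y) < min d 1" for x y
  proof (cases "norm x \<le> r + 1 \<and> norm y \<le> r + 1")
    case True
    then show ?thesis using d(2)[of y x] that by (simp add: dist_norm)
  next
    case False
    then have "r \<le> norm x" "r \<le> norm y"
      using that norm_triangle_ineq2[of x y] norm_triangle_ineq2[of y x] by (auto simp: norm_minus_commute)
    then show ?thesis using z e by simp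
  qed
  then show ?thesis using d(1) by (intro that[of "min d 1"]) auto
qed

text \<open>The gradient \<open>g\<close> is uniformly continuous, so the mollifier is approximated by its linear part
  uniformly in the base point; integration against \<open>F\<close> preserves this. The resulting gradient is
  written in coordinates because convolution is defined for scalar kernels.\<close>

lemma cont_grad_conv:
  fixes F \<phi> :: "'a::euclidean_space \<Rightarrow> real"
  assumes F: "integrable lborel F" and m: "mollifier r \<phi> g"
  shows "cont_grad (conv F \<phi>) (\<lambda>z. \<Sum>b\<in>Basis. conv F (\<lambda>w. g w \<bullet> b) z *\<^sub>R b)"
  unfolding cont_grad_def
proof (intro conjI allI)
  note cg = mollifier_cont_grad[OF m]
  have gc: "continuous_on UNIV (\<lambda>w. g w \<bullet> b)" for b
    by (intro continuous_intros cont_grad_continuous_grad[OF cg])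
  have g0: "g z \<bullet> b = 0" if "r \<le> norm z" for z b
    using mollifier_gradient_zero[OF m that] by simp
  have ig: "integrable lborel (\<lambda>w. F w * (g (z - w) \<bullet> b))" for z b
    by (rule integrable_conv_integrand[OF F gc g0])
  have i\<phi>: "integrable lborel (\<lambda>w. F w * \<phi> (z - w))" for z
    by (rule integrable_conv_integrand[OF F mollifier_continuous[OF m] mollifier_zero[OF m]])
  show "continuous_on UNIV (\<lambda>z. \<Sum>b\<in>Basis. conv F (\<lambda>w. g w \<bullet> b) z *\<^sub>R b)"
    by (intro continuous_intros conv_continuous[OF F gc g0])
  fix z
  have lin: "(\<Sum>b\<in>Basis. conv F (\<lambda>w. g w \<bullet> b) z *\<^sub>R b) \<bullet> h = (LBINT w. F w * (g (z - w) \<bullet> h))" for h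
  proof -
    have "(LBINT w. F w * (g (z - w) \<bullet> h))
      = (LBINT w. (\<Sum>b\<in>Basis. (h \<bullet> b) * (F w * (g (z - w) \<bullet> b))))"
      by (subst (1) euclidean_inner) (simp add: sum_distrib_left mult_ac)
    also have "\<dots> = (\<Sum>b\<in>Basis. (h \<bullet> b) * (LBINT w. F w * (g (z - w) \<bullet> b)))"
      using ig by simp
    finally show ?thesis unfolding conv_def inner_sum_left by (simp add: inner_commute mult.commute)
  qed
  show "(conv F \<phi> has_derivative (\<lambda>h. (\<Sum>b\<in>Basis. conv F (\<lambda>w. g w \<bullet> b) z *\<^sub>R b) \<bullet> h)) (at z)"
    unfolding has_derivative_at_alt
  proof (intro conjI allI impI)
    show "bounded_linear (\<lambda>h. (\<Sum>b\<in>Basis. conv F (\<lambda>w. g w \<bullet> b) z *\<^sub>R b) \<bullet> h)"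
      by (rule bounded_linear_inner_right)
    fix e :: real assume e: "0 < e"
    define I where "I = (LBINT w. \<bar>F w\<bar>)"
    have I: "0 \<le> I" by (simp add: I_def)
    have e': "0 < e / (I + 1)" using e I by simp
    obtain d where d: "0 < d" "\<And>x y. norm (x - y) < d \<Longrightarrow> norm (g x - g y) < e / (I + 1)"
      using compact_support_uniformly_continuous[OF cont_grad_continuous_grad[OF cg]
            mollifier_gradient_zero[OF m] e'] by blast
    have T: "\<bar>\<phi> (x + h) - \<phi> x - g x \<bullet> h\<bar> \<le> e / (I + 1) * norm h" if h: "norm h < d" for x h
    proof -
      obtain s where s: "0 < s" "s < 1"
        and eq: "\<phi> (x + 1 *\<^sub>R h) - \<phi> (x + 0 *\<^sub>R h) = (1 - 0) * (g (x + s *\<^sub>R h) \<bullet> h)"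
        using MVT2[of 0 1 "\<lambda>s. \<phi> (x + s *\<^sub>R h)" "\<lambda>s. g (x + s *\<^sub>R h) \<bullet> h", OF zero_less_one
            cont_grad_line[OF cg]] by blast
      have "\<bar>\<phi> (x + h) - \<phi> x - g x \<bullet> h\<bar> = \<bar>(g (x + s *\<^sub>R h) - g x) \<bullet> h\<bar>"
        using eq by (simp add: inner_diff_left)
      also have "\<dots> \<le> norm (g (x + s *\<^sub>R h) - g x) * norm h" by (rule Cauchy_Schwarz_ineq2)
      also have "\<dots> \<le> e / (I + 1) * norm h"
      proof (rule mult_right_mono[OF less_imp_le[OF d(2)]])
        have "s * norm h \<le> 1 * norm h" using s by (intro mult_right_mono) auto
        moreover have "norm (x + s *\<^sub>R h - x) = s * norm h" using s by simp
        ultimately show "norm (x + s *\<^sub>R h - x) < d" using h by linarith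
      qed simp
      finally show ?thesis .
    qed
    show "\<exists>d>0. \<forall>y. norm (y - z) < d \<longrightarrow>
      norm (conv F \<phi> y - conv F \<phi> z - (\<Sum>b\<in>Basis. conv F (\<lambda>w. g w \<bullet> b) z *\<^sub>R b) \<bullet> (y - z)) \<le> e * norm (y - z)"
    proof (intro exI[of _ d] conjI allI impI d(1))
      fix y assume y: "norm (y - z) < d"
      let ?h = "y - z"
      have ig': "integrable lborel (\<lambda>w. F w * (g (z - w) \<bullet> ?h))"
      proof (rule integrable_conv_integrand[OF F])
        show "continuous_on UNIV (\<lambda>z. g z \<bullet> ?h)" by (rule gc)
        show "g z \<bullet> ?h = 0" if "r \<le> norm z" for z by (rule g0[OF that])
      qed
      have "norm (conv F \<phi> y - conv F \<phi> z - (\<Sum>b\<in>Basis. conv F (\<lambda>w. g w \<bullet> b) z *\<^sub>R b) \<bullet> ?h)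
        = norm (LBINT w. F w * \<phi> (y - w) - F w * \<phi> (z - w) - F w * (g (z - w) \<bullet> ?h))"
        unfolding lin unfolding conv_def using i\<phi> ig' by simp
      also have "\<dots> \<le> (LBINT w. \<bar>F w\<bar> * (e / (I + 1) * norm ?h))"
      proof (rule order_trans[OF integral_norm_bound], rule integral_mono)
        show "integrable lborel (\<lambda>w. norm (F w * \<phi> (y - w) - F w * \<phi> (z - w) - F w * (g (z - w) \<bullet> ?h)))"
          using i\<phi> ig' by (intro integrable_norm Bochner_Integration.integrable_diff)
        show "integrable lborel (\<lambda>w. \<bar>F w\<bar> * (e / (I + 1) * norm ?h))" using F by auto
        fix w
        have "F w * \<phi> (y - w) - F w * \<phi> (z - w) - F w * (g (z - w) \<bullet> ?h)
          = F w * (\<phi> ((z - w) + ?h) - \<phi> (z - w) - g (z - w) \<bullet> ?h)"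
          by (simp add: algebra_simps)
        then show "norm (F w * \<phi> (y - w) - F w * \<phi> (z - w) - F w * (g (z - w) \<bullet> ?h))
          \<le> \<bar>F w\<bar> * (e / (I + 1) * norm ?h)"
          by (simp only: real_norm_def abs_mult) (intro mult_left_mono T[OF y] abs_ge_zero)
      qed
      also have "\<dots> = I / (I + 1) * (e * norm ?h)"
        by (simp add: I_def)
      also have "\<dots> \<le> 1 * (e * norm ?h)"
        using I e by (intro mult_right_mono) auto
      finally show "norm (conv F \<phi> y - conv F \<phi> z - (\<Sum>b\<in>Basis. conv F (\<lambda>w. g w \<bullet> b) z *\<^sub>R b) \<bullet> ?h)
        \<le> e * norm ?h" by simp
    qed
  qed
qed

lemma conv_gradient_component:
  assumes "b \<in> Basis"
  shows "(\<Sum>b\<in>Basis. conv F (\<lambda>w. g w \<bullet> b) z *\<^sub>R b) \<bullet> b = conv F (\<lambda>w. g w \<bullet> b) z"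
  using assms by (simp add: inner_sum_left inner_Basis if_distrib[of "\<lambda>x. _ * x"] cong: if_cong)

section \<open>Mollification in the mean\<close>

lemma integrable_lborel_reflect:
  fixes \<phi> :: "'a::euclidean_space \<Rightarrow> real"
  assumes "integrable lborel \<phi>"
  shows "integrable lborel (\<lambda>w. \<phi> (z - w))" "(LBINT w. \<phi> (z - w)) = (LBINT w. \<phi> w)"
proof -
  have [measurable]: "\<phi> \<in> borel_measurable borel" using borel_measurable_integrable[OF assms] by simp
  have d: "lborel = distr lborel borel (\<lambda>w::'a. z - w)"
    using lborel_affine[of "-1" z] by (simp add: density_1)
  have "integrable (distr lborel borel (\<lambda>w. z - w)) \<phi>" using assms d by simp
  then show "integrable lborel (\<lambda>w. \<phi> (z - w))" by (subst (asm) integrable_distr_eq) auto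
  have "(LBINT w. \<phi> w) = (\<integral>w. \<phi> w \<partial>distr lborel borel (\<lambda>w. z - w))" using d by simp
  also have "\<dots> = (LBINT w. \<phi> (z - w))" by (rule integral_distr) auto
  finally show "(LBINT w. \<phi> (z - w)) = (LBINT w. \<phi> w)" by simp
qed

lemma integrable_lborel_shift:
  fixes \<phi> :: "'a::euclidean_space \<Rightarrow> real"
  assumes "integrable lborel \<phi>"
  shows "integrable lborel (\<lambda>z. \<phi> (z - w))" "(LBINT z. \<phi> (z - w)) = (LBINT z. \<phi> z)"
proof -
  have [measurable]: "\<phi> \<in> borel_measurable borel" using borel_measurable_integrable[OF assms] by simp
  have d: "lborel = distr lborel borel ((+) (- w))" by (simp add: lborel_distr_plus)
  have "integrable (distr lborel borel ((+) (- w))) \<phi>" using assms d by simp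
  then show "integrable lborel (\<lambda>z. \<phi> (z - w))" by (subst (asm) integrable_distr_eq) auto
  show "(LBINT z. \<phi> (z - w)) = (LBINT z. \<phi> z)"
    using integral_lborel_shift[of \<phi> "- w"] by simp
qed

lemma conv_scale: "conv (\<lambda>w. F w * c) \<phi> z = conv F \<phi> z * c"
  unfolding conv_def by (simp add: mult_ac flip: integral_mult_right_zero)

context
  fixes e :: real and \<phi> :: "'a::euclidean_space \<Rightarrow> real" and g
  assumes m: "mollifier e \<phi> g"
begin

lemma integrable_conv_section: "integrable lborel F \<Longrightarrow> integrable lborel (\<lambda>w. F w * \<phi> (z - w))"
  by (rule integrable_conv_integrand[OF _ mollifier_continuous[OF m] mollifier_zero[OF m]])

lemma conv_const: "(LBINT w. c * \<phi> (z - w)) = c"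
  using integrable_lborel_reflect[OF mollifier_integrable[OF m], of z] mollifier_integral[OF m] by simp

lemma conv_mono:
  assumes "integrable lborel F" "integrable lborel G" "AE w in lborel. F w \<le> G w"
  shows "conv F \<phi> z \<le> conv G \<phi> z"
  unfolding conv_def
  by (rule integral_mono_AE[OF integrable_conv_section[OF assms(1)] integrable_conv_section[OF assms(2)]])
    (use assms(3) mollifier_nonneg[OF m] in \<open>auto intro: mult_right_mono\<close>)

lemma conv_abs_le:
  assumes "integrable lborel F"
  shows "\<bar>conv F \<phi> z\<bar> \<le> conv (\<lambda>w. \<bar>F w\<bar>) \<phi> z"
  using integral_norm_bound[of lborel "\<lambda>w. F w * \<phi> (z - w)"] mollifier_nonneg[OF m]
  by (simp add: conv_def abs_mult)

lemma conv_pair_integrable: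
  assumes F: "integrable lborel F"
  shows "integrable (lborel \<Otimes>\<^sub>M lborel) (\<lambda>(w, z). F w * \<phi> (z - w))"
proof (rule lborel_pair.Fubini_integrable)
  have [measurable]: "F \<in> borel_measurable borel" "\<phi> \<in> borel_measurable borel"
    using borel_measurable_integrable[OF F] mollifier_measurable[OF m] by auto
  show "(\<lambda>(w, z). F w * \<phi> (z - w)) \<in> borel_measurable (lborel \<Otimes>\<^sub>M lborel)" by measurable
  note i = integrable_lborel_shift[OF mollifier_integrable[OF m]]
  have "(LBINT z. norm (case (w, z) of (w, z) \<Rightarrow> F w * \<phi> (z - w))) = \<bar>F w\<bar>" for w
    using i(2)[of w] mollifier_integral[OF m] mollifier_nonneg[OF m] by (simp add: abs_mult)
  then show "integrable lborel (\<lambda>w. \<integral>z. norm (case (w, z) of (w, z) \<Rightarrow> F w * \<phi> (z - w)) \<partial>lborel)"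
    using F by simp
  show "AE w in lborel. integrable lborel (\<lambda>z. case (w, z) of (w, z) \<Rightarrow> F w * \<phi> (z - w))"
    using i(1) by simp
qed

lemma integrable_conv: "integrable lborel F \<Longrightarrow> integrable lborel (conv F \<phi>)"
  using lborel_pair.integrable_snd[OF conv_pair_integrable] by (simp add: conv_def[abs_def])

lemma integral_conv:
  assumes F: "integrable lborel F"
  shows "(LBINT z. conv F \<phi> z) = (LBINT z. F z)"
proof -
  have "(LBINT z. conv F \<phi> z) = (LBINT w. (LBINT z. F w * \<phi> (z - w)))"
    unfolding conv_def by (rule lborel_pair.Fubini_integral[OF conv_pair_integrable[OF F]])
  also have "\<dots> = (LBINT w. F w)"
    using integrable_lborel_shift(2)[OF mollifier_integrable[OF m]] mollifier_integral[OF m] by simp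
  finally show ?thesis .
qed

lemma conv_L1_contraction:
  assumes F: "integrable lborel F"
  shows "(LBINT z. \<bar>conv F \<phi> z\<bar>) \<le> (LBINT z. \<bar>F z\<bar>)"
proof -
  have "(LBINT z. \<bar>conv F \<phi> z\<bar>) \<le> (LBINT z. conv (\<lambda>w. \<bar>F w\<bar>) \<phi> z)"
    using F by (intro integral_mono integrable_abs integrable_conv conv_abs_le) auto
  also have "\<dots> = (LBINT z. \<bar>F z\<bar>)" using F by (intro integral_conv) auto
  finally show ?thesis .
qed

lemma conv_diff:
  assumes "integrable lborel F" "integrable lborel G"
  shows "conv (\<lambda>w. F w - G w) \<phi> z = conv F \<phi> z - conv G \<phi> z"
  unfolding conv_def using integrable_conv_section[OF assms(1)] integrable_conv_section[OF assms(2)]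
  by (simp add: left_diff_distrib)

lemma conv_add:
  assumes "integrable lborel F" "integrable lborel G"
  shows "conv (\<lambda>w. F w + G w) \<phi> z = conv F \<phi> z + conv G \<phi> z"
  unfolding conv_def using integrable_conv_section[OF assms(1)] integrable_conv_section[OF assms(2)]
  by (simp add: distrib_right)

end

definition mollifies :: "(nat \<Rightarrow> 'a::euclidean_space \<Rightarrow> real) \<Rightarrow> ('a \<Rightarrow> real) \<Rightarrow> bool" where
  "mollifies \<phi> F \<longleftrightarrow> (\<lambda>n. \<integral>z. \<bar>conv F (\<phi> n) z - F z\<bar> \<partial>lborel) \<longlonglongrightarrow> 0"

context
  fixes r :: "nat \<Rightarrow> real" and \<phi> :: "nat \<Rightarrow> 'a::euclidean_space \<Rightarrow> real" and g
  assumes m: "\<And>n. mollifier (r n) (\<phi> n) (g n)" and r: "r \<longlonglongrightarrow> 0"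
begin

text \<open>Convolution is a contraction in the mean, so convergence passes to limits in the mean.\<close>

lemma mollifies_approx:
  assumes F: "integrable lborel F"
    and G: "\<And>\<epsilon>. 0 < \<epsilon> \<Longrightarrow> \<exists>G. integrable lborel G \<and> mollifies \<phi> G \<and> (LBINT z. \<bar>F z - G z\<bar>) < \<epsilon>"
  shows "mollifies \<phi> F"
  unfolding mollifies_def
proof (rule LIMSEQ_I)
  fix \<epsilon> :: real assume "0 < \<epsilon>"
  then obtain G where G: "integrable lborel G" "mollifies \<phi> G" "(LBINT z. \<bar>F z - G z\<bar>) < \<epsilon> / 3"
    using G[of "\<epsilon> / 3"] by auto
  then obtain N where N: "\<And>n. n \<ge> N \<Longrightarrow> \<bar>\<integral>z. \<bar>conv G (\<phi> n) z - G z\<bar> \<partial>lborel\<bar> < \<epsilon> / 3"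
    unfolding mollifies_def using LIMSEQ_D[of _ 0 "\<epsilon> / 3"] \<open>0 < \<epsilon>\<close> by force
  show "\<exists>N. \<forall>n\<ge>N. norm ((LBINT z. \<bar>conv F (\<phi> n) z - F z\<bar>) - 0) < \<epsilon>"
  proof (intro exI[of _ N] allI impI)
    fix n assume n: "N \<le> n"
    note ic = integrable_conv[OF m]
    have FG: "integrable lborel (\<lambda>z. F z - G z)" using F G by auto
    have "(LBINT z. \<bar>conv F (\<phi> n) z - F z\<bar>)
      \<le> (LBINT z. \<bar>conv (\<lambda>z. F z - G z) (\<phi> n) z\<bar> + \<bar>conv G (\<phi> n) z - G z\<bar> + \<bar>F z - G z\<bar>)"
      using F G FG by (intro integral_mono integrable_abs Bochner_Integration.integrable_add
          Bochner_Integration.integrable_diff ic) (auto simp: conv_diff[OF m])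
    also have "\<dots> = (LBINT z. \<bar>conv (\<lambda>z. F z - G z) (\<phi> n) z\<bar>)
      + (LBINT z. \<bar>conv G (\<phi> n) z - G z\<bar>) + (LBINT z. \<bar>F z - G z\<bar>)"
      using F G FG by (simp add: ic)
    also have "\<dots> < \<epsilon>"
      using conv_L1_contraction[OF m FG, of n] N[OF n] G(3) by linarith
    finally show "norm ((LBINT z. \<bar>conv F (\<phi> n) z - F z\<bar>) - 0) < \<epsilon>" by simp
  qed
qed

text \<open>The convolution has the same integral as the indicator, so it suffices that the positive part of
  their difference tends to zero in the mean. That part lives on \<open>U\<close>, where the convolution is
  eventually equal to one at each point. In this way no pointwise convergence is claimed on the
  boundary of \<open>U\<close>, which may have positive measure.\<close>

lemma mollifies_open_indicator:
  assumes U: "open U" "emeasure lborel U < \<infinity>"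
  shows "mollifies \<phi> (indicator U)"
proof -
  let ?F = "indicator U :: 'a \<Rightarrow> real"
  have iF: "integrable lborel ?F" using U by simp
  have [measurable]: "U \<in> sets borel" using U by simp
  have [measurable]: "conv ?F (\<phi> n) \<in> borel_measurable borel" for n
    using borel_measurable_integrable[OF integrable_conv[OF m iF, of n]] by simp
  have eq: "(LBINT z. \<bar>conv ?F (\<phi> n) z - ?F z\<bar>) = 2 * (LBINT z. max 0 (?F z - conv ?F (\<phi> n) z))" for n
  proof -
    note ic = integrable_conv[OF m iF]
    have "(LBINT z. \<bar>conv ?F (\<phi> n) z - ?F z\<bar>)
      = (LBINT z. conv ?F (\<phi> n) z - ?F z + 2 * max 0 (?F z - conv ?F (\<phi> n) z))"
      by (intro Bochner_Integration.integral_cong) (auto simp: max_def)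
    also have "\<dots> = (LBINT z. conv ?F (\<phi> n) z) - (LBINT z. ?F z)
      + 2 * (LBINT z. max 0 (?F z - conv ?F (\<phi> n) z))"
      using ic iF by simp
    finally show ?thesis using integral_conv[OF m iF] by simp
  qed
  have "(\<lambda>n. \<integral>z. max 0 (?F z - conv ?F (\<phi> n) z) \<partial>lborel) \<longlonglongrightarrow> (\<integral>z. 0 \<partial>(lborel :: 'a measure))"
  proof (rule integral_dominated_convergence[where w="?F"])
    show "(\<lambda>z. max 0 (?F z - conv ?F (\<phi> n) z)) \<in> borel_measurable lborel" for n
      by measurable
    have "0 \<le> conv ?F (\<phi> n) z" for n z
      unfolding conv_def by (intro integral_nonneg_AE AE_I2) (auto intro!: mult_nonneg_nonneg mollifier_nonneg[OF m])
    then show "AE z in lborel. norm (max 0 (?F z - conv ?F (\<phi> n) z)) \<le> ?F z" for n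
      by (intro AE_I2) (auto simp: max_def)
    show "AE z in lborel. (\<lambda>n. max 0 (?F z - conv ?F (\<phi> n) z)) \<longlonglongrightarrow> 0"
    proof (rule AE_I2)
      fix z
      show "(\<lambda>n. max 0 (?F z - conv ?F (\<phi> n) z)) \<longlonglongrightarrow> 0"
      proof (cases "z \<in> U")
        case True
        then obtain d where d: "0 < d" "ball z d \<subseteq> U" using U(1) open_contains_ball by blast
        have "eventually (\<lambda>n. r n < d) sequentially"
          using order_tendstoD(2)[OF r d(1)] .
        then have "eventually (\<lambda>n. max 0 (?F z - conv ?F (\<phi> n) z) = 0) sequentially"
        proof eventually_elim
          case (elim n)
          have "?F w * \<phi> n (z - w) = 1 * \<phi> n (z - w)" for w
          proof (cases "w \<in> U")
            case False
            then have "d \<le> norm (z - w)" using d(2) by (auto simp: subset_eq dist_norm)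
            then show ?thesis using mollifier_zero[OF m, of n "z - w"] elim by simp
          qed simp
          then have "conv ?F (\<phi> n) z = (LBINT w. 1 * \<phi> n (z - w))"
            unfolding conv_def by (intro Bochner_Integration.integral_cong) simp_all
          then have "conv ?F (\<phi> n) z = 1" using conv_const[OF m, of 1 n z] by simp
          then show ?case using True by simp
        qed
        then show ?thesis by (rule tendsto_eventually)
      next
        case False
        then have "?F z - conv ?F (\<phi> n) z \<le> 0" for n
          using \<open>\<And>n z. 0 \<le> conv ?F (\<phi> n) z\<close>[of n z] by simp
        then show ?thesis by (simp add: max_absorb1)
      qed
    qed
  qed (use iF in auto)
  then show ?thesis
    unfolding mollifies_def eq using tendsto_mult_right[of _ 0 sequentially 2] by simp
qed

lemma mollifies_scale:
  assumes "mollifies \<phi> F"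
  shows "mollifies \<phi> (\<lambda>z. F z * c)"
proof -
  have "(LBINT z. \<bar>conv (\<lambda>z. F z * c) (\<phi> n) z - F z * c\<bar>)
    = \<bar>c\<bar> * (LBINT z. \<bar>conv F (\<phi> n) z - F z\<bar>)" for n
  proof -
    have "\<bar>conv (\<lambda>z. F z * c) (\<phi> n) z - F z * c\<bar> = \<bar>c\<bar> * \<bar>conv F (\<phi> n) z - F z\<bar>" for z
      unfolding conv_scale left_diff_distrib[symmetric] abs_mult by simp
    then show ?thesis by simp
  qed
  then show ?thesis
    using tendsto_mult_left[OF assms[unfolded mollifies_def], of "\<bar>c\<bar>"] by (simp add: mollifies_def)
qed

text \<open>Convergence for indicators of open sets extends to sets of finite measure by outer regularity and
  then to all integrable functions.\<close>

theorem mollifies_integrable: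
  assumes "integrable lborel F"
  shows "mollifies \<phi> F"
  using assms
proof (induction F)
  case (base A c)
  have "mollifies \<phi> (indicator A)"
  proof (rule mollifies_approx)
    show iA: "integrable lborel (indicator A :: 'a \<Rightarrow> real)" using base by simp
    fix \<epsilon> :: real assume \<epsilon>: "0 < \<epsilon>"
    have "A \<in> sets borel" using base by simp
    then obtain U where U: "open U" "A \<subseteq> U" "emeasure lborel (U - A) < ennreal \<epsilon>"
      using outer_regular_lborel[of A \<epsilon>] \<epsilon> by blast
    have "emeasure lborel U \<le> emeasure lborel A + emeasure lborel (U - A)"
      using emeasure_subadditive[of A lborel "U - A"] base U by (simp add: Un_absorb1)
    also have "\<dots> < \<infinity>" using base U(3) by (auto simp: less_top[symmetric])
    finally have fU: "emeasure lborel U < \<infinity>" .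
    have "(LBINT z. \<bar>indicator A z - indicator U z\<bar>) = (\<integral>z. (indicator (U - A) z :: real) \<partial>(lborel::'a measure))"
      using U(2) by (intro Bochner_Integration.integral_cong) (auto simp: indicator_def)
    also have "\<dots> = measure lborel (U - A)" by simp
    also have "\<dots> < \<epsilon>"
    proof -
      have "emeasure lborel (U - A) \<noteq> \<infinity>" using U(3) by auto
      then have "ennreal (measure lborel (U - A)) < ennreal \<epsilon>"
        using U(3) by (simp add: emeasure_eq_ennreal_measure)
      then show ?thesis by (simp add: ennreal_less_iff)
    qed
    finally have 1: "(LBINT z. \<bar>indicator A z - indicator U z\<bar>) < \<epsilon>" .
    have 2: "integrable lborel (indicator U :: 'a \<Rightarrow> real)" using fU U(1) by simp
    show "\<exists>G. integrable lborel G \<and> mollifies \<phi> G \<and> (LBINT z. \<bar>indicator A z - G z\<bar>) < \<epsilon>"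
      using mollifies_open_indicator[OF U(1) fU] 1 2 by blast
  qed
  from mollifies_scale[OF this] show ?case by simp
next
  case (add F G)
  have lim: "(\<lambda>n. (LBINT z. \<bar>conv F (\<phi> n) z - F z\<bar>) + (LBINT z. \<bar>conv G (\<phi> n) z - G z\<bar>)) \<longlonglongrightarrow> 0"
    using tendsto_add[OF add.IH[unfolded mollifies_def]] by simp
  have le: "(LBINT z. \<bar>conv (\<lambda>z. F z + G z) (\<phi> n) z - (F z + G z)\<bar>)
    \<le> (LBINT z. \<bar>conv F (\<phi> n) z - F z\<bar>) + (LBINT z. \<bar>conv G (\<phi> n) z - G z\<bar>)" for n
  proof -
    note ic = integrable_conv[OF m add.hyps(1)] integrable_conv[OF m add.hyps(2)]
    have "(LBINT z. \<bar>conv (\<lambda>z. F z + G z) (\<phi> n) z - (F z + G z)\<bar>)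
      \<le> (LBINT z. \<bar>conv F (\<phi> n) z - F z\<bar> + \<bar>conv G (\<phi> n) z - G z\<bar>)"
      using ic add.hyps integrable_conv[OF m, of "\<lambda>z. F z + G z" n]
      by (intro integral_mono) (auto simp: conv_add[OF m])
    also have "\<dots> = (LBINT z. \<bar>conv F (\<phi> n) z - F z\<bar>) + (LBINT z. \<bar>conv G (\<phi> n) z - G z\<bar>)"
      using ic add.hyps by simp
    finally show ?thesis .
  qed
  show ?case
    unfolding mollifies_def
    by (rule tendsto_sandwich[OF _ _ tendsto_const lim]) (auto intro!: always_eventually le)
next
  case (lim F s)
  show ?case
  proof (rule mollifies_approx[OF lim.hyps(4)])
    fix \<epsilon> :: real assume \<epsilon>: "0 < \<epsilon>"
    have "(\<lambda>i. \<integral>z. \<bar>F z - s i z\<bar> \<partial>lborel) \<longlonglongrightarrow> (\<integral>z. 0 \<partial>(lborel :: 'a measure))"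
    proof (rule integral_dominated_convergence[where w="\<lambda>z. 3 * \<bar>F z\<bar>"])
      show "(\<lambda>z. \<bar>F z - s i z\<bar>) \<in> borel_measurable lborel" for i
        using borel_measurable_integrable[OF lim.hyps(4)] borel_measurable_integrable[OF lim.hyps(1)[of i]] by measurable
      show "integrable lborel (\<lambda>z. 3 * \<bar>F z\<bar>)" using lim.hyps(4) by auto
      show "AE z in lborel. norm \<bar>F z - s i z\<bar> \<le> 3 * \<bar>F z\<bar>" for i
      proof (rule AE_I2)
        fix z
        have "\<bar>s i z\<bar> \<le> 2 * \<bar>F z\<bar>" using lim.hyps(3)[of z i] by simp
        then show "norm \<bar>F z - s i z\<bar> \<le> 3 * \<bar>F z\<bar>" by (simp add: abs_if split: if_splits)
      qed
      have "(\<lambda>i. \<bar>F z - s i z\<bar>) \<longlonglongrightarrow> \<bar>F z - F z\<bar>" for z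
        using lim.hyps(2)[of z] by (intro tendsto_intros) auto
      then show "AE z in lborel. (\<lambda>i. \<bar>F z - s i z\<bar>) \<longlonglongrightarrow> 0" by simp
    qed simp
    then have "eventually (\<lambda>i. (LBINT z. \<bar>F z - s i z\<bar>) < \<epsilon>) sequentially"
      using \<epsilon> by (intro order_tendstoD(2)[of _ 0]) auto
    then obtain i where "(LBINT z. \<bar>F z - s i z\<bar>) < \<epsilon>"
      using eventually_happens'[OF sequentially_bot] by blast
    then show "\<exists>G. integrable lborel G \<and> mollifies \<phi> G \<and> (LBINT z. \<bar>F z - G z\<bar>) < \<epsilon>"
      using lim.hyps(1) lim.IH by blast
  qed
qed

end

section \<open>Mollified fluxes\<close>

lemma flux_continuous: "2 < q \<Longrightarrow> continuous_on UNIV (flux q)"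
  unfolding flux_def by (intro continuous_intros continuous_on_powr') auto

lemma flux_measurable [measurable]: "flux q \<in> borel_measurable borel"
  unfolding flux_def[abs_def] by measurable

lemma powr_minus_one_le:
  assumes "0 \<le> (x::real)" "2 \<le> q"
  shows "x powr (q - 1) \<le> x + x powr q"
proof (cases "x \<le> 1")
  case True
  then have "x powr (q - 1) \<le> x powr 1"
    using assms by (intro powr_mono') auto
  then show ?thesis using assms by (simp add: add_increasing2)
next
  case False
  then have "x powr (q - 1) \<le> x powr q" using assms by (intro powr_mono) auto
  then show ?thesis using assms by (simp add: add_increasing)
qed

text \<open>The factor \<open>1 / 2\<close> allows \<open>b powr q\<close> to be absorbed when \<open>b\<close> is a mean of values \<open>x\<close>.\<close>

lemma split_powr:
  assumes "0 \<le> (x::real)" "0 \<le> b" "2 \<le> q"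
  shows "x * b powr (q - 1) \<le> b powr q / 2 + 2 powr q * x powr q"
proof (cases "x \<le> b / 2")
  case True
  have "x * b powr (q - 1) \<le> b / 2 * b powr (q - 1)" using True by (intro mult_right_mono) auto
  also have "\<dots> = b powr q / 2" using powr_minus_one_mult[OF assms(2), of q] by (simp add: mult.commute)
  finally show ?thesis by (simp add: add_increasing2)
next
  case False
  have "x * b powr (q - 1) \<le> (2 * x) * (2 * x) powr (q - 1)"
    using False assms by (intro mult_mono powr_mono2) auto
  also have "\<dots> = (2 * x) powr q" using powr_minus_one_mult[of "2 * x" q] assms by (simp add: mult.commute)
  also have "\<dots> = 2 powr q * x powr q" using assms by (simp add: powr_mult)
  finally show ?thesis by (simp add: add_increasing)
qed

context
  fixes e :: real and \<phi> :: "'a::euclidean_space \<Rightarrow> real" and g q and G :: "'a \<Rightarrow> real"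
  assumes m: "mollifier e \<phi> g" and q: "2 < q"
    and G: "integrable lborel G" and Gq: "integrable lborel (\<lambda>z. \<bar>G z\<bar> powr q)"
begin

lemma integrable_abs_powr_minus_one: "integrable lborel (\<lambda>z. \<bar>G z\<bar> powr (q - 1))"
proof (rule Bochner_Integration.integrable_bound)
  show "integrable lborel (\<lambda>z. \<bar>G z\<bar> + \<bar>G z\<bar> powr q)" using G Gq by auto
  have [measurable]: "G \<in> borel_measurable borel" using borel_measurable_integrable[OF G] by simp
  show "(\<lambda>z. \<bar>G z\<bar> powr (q - 1)) \<in> borel_measurable lborel" by measurable
  show "AE z in lborel. norm (\<bar>G z\<bar> powr (q - 1)) \<le> norm (\<bar>G z\<bar> + \<bar>G z\<bar> powr q)"
    using powr_minus_one_le q by (intro AE_I2) (simp add: abs_of_nonneg)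
qed

lemma integrable_flux: "integrable lborel (\<lambda>z. flux q (G z))"
proof (rule Bochner_Integration.integrable_bound[OF integrable_abs_powr_minus_one])
  have [measurable]: "G \<in> borel_measurable borel" using borel_measurable_integrable[OF G] by simp
  show "(\<lambda>z. flux q (G z)) \<in> borel_measurable lborel" unfolding flux_def by measurable
qed (simp add: abs_flux)

text \<open>Jensen's inequality up to a constant: multiply the mean \<open>b\<close> of \<open>\<bar>G\<bar>\<close> by \<open>b powr (q - 1)\<close> and absorb half of
  \<open>b powr q\<close>.\<close>

lemma conv_powr_le: "(conv (\<lambda>w. \<bar>G w\<bar>) \<phi> z) powr q \<le> 2 * 2 powr q * conv (\<lambda>w. \<bar>G w\<bar> powr q) \<phi> z"
proof -
  define b where "b = conv (\<lambda>w. \<bar>G w\<bar>) \<phi> z"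
  have b: "0 \<le> b" unfolding b_def conv_def
    using mollifier_nonneg[OF m] by (intro integral_nonneg_AE AE_I2) auto
  have aG: "integrable lborel (\<lambda>w. \<bar>G w\<bar>)" using G by auto
  note isec = integrable_conv_section[OF m]
  have c: "integrable lborel (\<lambda>w. b powr q / 2 * \<phi> (z - w))"
    using integrable_lborel_reflect(1)[OF mollifier_integrable[OF m], of z] by (intro integrable_mult_right) auto
  have "b powr q = b * b powr (q - 1)" using powr_minus_one_mult[OF b, of q] by (simp add: mult.commute)
  also have "\<dots> = (LBINT w. \<bar>G w\<bar> * \<phi> (z - w) * b powr (q - 1))"
    by (simp add: b_def conv_def)
  also have "\<dots> \<le> (LBINT w. b powr q / 2 * \<phi> (z - w) + 2 powr q * (\<bar>G w\<bar> powr q * \<phi> (z - w)))"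
  proof (rule integral_mono)
    show "integrable lborel (\<lambda>w. \<bar>G w\<bar> * \<phi> (z - w) * b powr (q - 1))"
      by (intro integrable_mult_left isec[OF aG])
    show "integrable lborel (\<lambda>w. b powr q / 2 * \<phi> (z - w) + 2 powr q * (\<bar>G w\<bar> powr q * \<phi> (z - w)))"
      by (intro Bochner_Integration.integrable_add integrable_mult_right isec[OF Gq] c)
    fix w
    have "\<phi> (z - w) * (\<bar>G w\<bar> * b powr (q - 1)) \<le> \<phi> (z - w) * (b powr q / 2 + 2 powr q * \<bar>G w\<bar> powr q)"
      using split_powr[of "\<bar>G w\<bar>" b q] b q by (intro mult_left_mono mollifier_nonneg[OF m]) auto
    then show "\<bar>G w\<bar> * \<phi> (z - w) * b powr (q - 1)
      \<le> b powr q / 2 * \<phi> (z - w) + 2 powr q * (\<bar>G w\<bar> powr q * \<phi> (z - w))"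
      by (simp add: algebra_simps)
  qed
  also have "\<dots> = b powr q / 2 + 2 powr q * conv (\<lambda>w. \<bar>G w\<bar> powr q) \<phi> z"
    unfolding conv_def Bochner_Integration.integral_add[OF c integrable_mult_right[OF isec[OF Gq]]]
      conv_const[OF m] by simp
  finally show ?thesis by (simp add: b_def)
qed

text \<open>The domination that makes the commutator converge: it is at most the convolution of one fixed
  integrable function. The critical product of the mean of \<open>\<bar>G\<bar> powr (q - 1)\<close> with the mean of \<open>\<bar>G\<bar>\<close> is
  estimated by Young's inequality inside the integral.\<close>

lemma commutator_bound:
  "\<bar>conv (\<lambda>w. flux q (G w)) \<phi> z - flux q (conv G \<phi> z)\<bar> * (1 + \<bar>conv G \<phi> z\<bar>)
    \<le> conv (\<lambda>w. 2 * \<bar>G w\<bar> + (2 + 6 * 2 powr q) * \<bar>G w\<bar> powr q) \<phi> z"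
proof -
  define b where "b = conv (\<lambda>w. \<bar>G w\<bar>) \<phi> z"
  define W where "W = conv (\<lambda>w. \<bar>G w\<bar> powr q) \<phi> z"
  define V where "V = conv (\<lambda>w. \<bar>G w\<bar> powr (q - 1)) \<phi> z"
  have aG: "integrable lborel (\<lambda>w. \<bar>G w\<bar>)" using G by auto
  note isec = integrable_conv_section[OF m]
  have b0: "0 \<le> b" and V0: "0 \<le> V" unfolding b_def V_def conv_def
    using mollifier_nonneg[OF m] by (auto intro!: integral_nonneg_AE AE_I2)
  have bq: "b powr q \<le> 2 * 2 powr q * W" unfolding b_def W_def by (rule conv_powr_le)
  have b1: "b powr (q - 1) \<le> b + 2 * 2 powr q * W" using powr_minus_one_le[OF b0, of q] q bq by linarith
  have V1: "V \<le> b + W"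
    unfolding V_def b_def W_def conv_add[OF m aG Gq, symmetric]
    using aG Gq integrable_abs_powr_minus_one q powr_minus_one_le
    by (intro conv_mono[OF m]) auto
  have Vb: "V * b \<le> W + b powr q"
  proof -
    have c: "integrable lborel (\<lambda>w. b powr q * \<phi> (z - w))"
      using integrable_lborel_reflect(1)[OF mollifier_integrable[OF m], of z] by (intro integrable_mult_right) auto
    have "V * b = (LBINT w. \<bar>G w\<bar> powr (q - 1) * \<phi> (z - w) * b)"
      by (simp add: V_def conv_def)
    also have "\<dots> \<le> (LBINT w. \<bar>G w\<bar> powr q * \<phi> (z - w) + b powr q * \<phi> (z - w))"
    proof (rule integral_mono)
      show "integrable lborel (\<lambda>w. \<bar>G w\<bar> powr (q - 1) * \<phi> (z - w) * b)"
        by (intro integrable_mult_left isec[OF integrable_abs_powr_minus_one])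
      show "integrable lborel (\<lambda>w. \<bar>G w\<bar> powr q * \<phi> (z - w) + b powr q * \<phi> (z - w))"
        by (intro Bochner_Integration.integrable_add isec[OF Gq] c)
      fix w
      have "\<phi> (z - w) * (\<bar>G w\<bar> powr (q - 1) * b) \<le> \<phi> (z - w) * (\<bar>G w\<bar> powr q + b powr q)"
        using young_without_constants[of "\<bar>G w\<bar>" b q] b0 q
        by (intro mult_left_mono mollifier_nonneg[OF m]) auto
      then show "\<bar>G w\<bar> powr (q - 1) * \<phi> (z - w) * b \<le> \<bar>G w\<bar> powr q * \<phi> (z - w) + b powr q * \<phi> (z - w)"
        by (simp add: algebra_simps)
    qed
    also have "\<dots> = W + b powr q"
      unfolding W_def conv_def Bochner_Integration.integral_add[OF isec[OF Gq] c] conv_const[OF m] by simp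
    finally show ?thesis .
  qed
  have mG: "\<bar>conv G \<phi> z\<bar> \<le> b" unfolding b_def by (rule conv_abs_le[OF m G])
  have "\<bar>conv (\<lambda>w. flux q (G w)) \<phi> z\<bar> \<le> V"
    using conv_abs_le[OF m integrable_flux, of z] by (simp add: abs_flux V_def)
  moreover have "\<bar>flux q (conv G \<phi> z)\<bar> \<le> b powr (q - 1)"
    unfolding abs_flux using mG q by (intro powr_mono2) auto
  ultimately have "\<bar>conv (\<lambda>w. flux q (G w)) \<phi> z - flux q (conv G \<phi> z)\<bar> * (1 + \<bar>conv G \<phi> z\<bar>)
    \<le> (V + b powr (q - 1)) * (1 + b)"
    using mG V0 by (intro mult_mono) auto
  also have "\<dots> = V + V * b + b powr (q - 1) + b powr (q - 1) * b" by (simp add: algebra_simps)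
  also have "\<dots> \<le> 2 * b + (2 + 6 * 2 powr q) * W"
    using V1 Vb b1 bq powr_minus_one_mult[OF b0, of q] by (simp add: algebra_simps)
  also have "\<dots> = conv (\<lambda>w. 2 * \<bar>G w\<bar> + (2 + 6 * 2 powr q) * \<bar>G w\<bar> powr q) \<phi> z"
  proof -
    have "integrable lborel (\<lambda>w. 2 * \<bar>G w\<bar>)" "integrable lborel (\<lambda>w. (2 + 6 * 2 powr q) * \<bar>G w\<bar> powr q)"
      using aG Gq by auto
    from conv_add[OF m this, of z] show ?thesis
      using conv_scale[of "\<lambda>w. \<bar>G w\<bar>" 2 \<phi> z] conv_scale[of "\<lambda>w. \<bar>G w\<bar> powr q" "2 + 6 * 2 powr q" \<phi> z]
      by (simp add: b_def W_def mult.commute)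
  qed
  finally show ?thesis .
qed

lemma integrable_commutator:
  "integrable lborel (\<lambda>z. \<bar>conv (\<lambda>w. flux q (G w)) \<phi> z - flux q (conv G \<phi> z)\<bar> * (1 + \<bar>conv G \<phi> z\<bar>))"
proof (rule Bochner_Integration.integrable_bound)
  show "integrable lborel (conv (\<lambda>w. 2 * \<bar>G w\<bar> + (2 + 6 * 2 powr q) * \<bar>G w\<bar> powr q) \<phi>)"
    using G Gq by (intro integrable_conv[OF m] Bochner_Integration.integrable_add integrable_mult_right) auto
  have [measurable]: "conv (\<lambda>w. flux q (G w)) \<phi> \<in> borel_measurable borel" "conv G \<phi> \<in> borel_measurable borel"
    using borel_measurable_integrable[OF integrable_conv[OF m integrable_flux]]
      borel_measurable_integrable[OF integrable_conv[OF m G]] by auto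
  show "(\<lambda>z. \<bar>conv (\<lambda>w. flux q (G w)) \<phi> z - flux q (conv G \<phi> z)\<bar> * (1 + \<bar>conv G \<phi> z\<bar>)) \<in> borel_measurable lborel"
    by measurable
  show "AE z in lborel. norm (\<bar>conv (\<lambda>w. flux q (G w)) \<phi> z - flux q (conv G \<phi> z)\<bar> * (1 + \<bar>conv G \<phi> z\<bar>))
    \<le> norm (conv (\<lambda>w. 2 * \<bar>G w\<bar> + (2 + 6 * 2 powr q) * \<bar>G w\<bar> powr q) \<phi> z)"
    using order_trans[OF commutator_bound abs_ge_self] by (intro AE_I2) (simp add: abs_mult)
qed

end

lemma mollifies_AE_subseq:
  fixes \<phi> :: "nat \<Rightarrow> 'a::euclidean_space \<Rightarrow> real"
  assumes m: "\<And>n. mollifier (r n) (\<phi> n) (g n)" and r: "r \<longlonglongrightarrow> 0" and F: "integrable lborel F"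
  shows "\<exists>s. strict_mono s \<and> (AE z in lborel. (\<lambda>n. conv F (\<phi> (s n)) z) \<longlonglongrightarrow> F z)"
proof -
  have "mollifies \<phi> F" by (rule mollifies_integrable[OF m r F])
  then obtain s where s: "strict_mono (s :: nat \<Rightarrow> nat)"
    "AE z in lborel. (\<lambda>n. conv F (\<phi> (s n)) z - F z) \<longlonglongrightarrow> 0"
    using tendsto_L1_AE_subseq[of lborel "\<lambda>n z. conv F (\<phi> n) z - F z"] integrable_conv[OF m F] F
    unfolding mollifies_def by auto
  have "AE z in lborel. (\<lambda>n. conv F (\<phi> (s n)) z) \<longlonglongrightarrow> F z"
    using s(2) by eventually_elim (simp add: LIM_zero_iff)
  then show ?thesis using s(1) by blast
qed

text \<open>Both convolutions converge almost everywhere along a subsequence, hence so does the commutator,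
  to zero. Its bound \<open>conv h (\<phi> n)\<close> varies with \<open>n\<close> but converges to \<open>h\<close> in the mean, so dominated convergence
  applies to the minimum with \<open>h\<close>, and the excess over \<open>h\<close> is controlled by that convergence.\<close>

theorem commutator_tendsto_zero:
  fixes \<phi> :: "nat \<Rightarrow> 'a::euclidean_space \<Rightarrow> real"
  assumes m: "\<And>n. mollifier (r n) (\<phi> n) (g n)" and r: "r \<longlonglongrightarrow> 0" and q: "2 < q"
    and G: "integrable lborel G" and Gq: "integrable lborel (\<lambda>z. \<bar>G z\<bar> powr q)"
  shows "(\<lambda>n. \<integral>z. \<bar>conv (\<lambda>w. flux q (G w)) (\<phi> n) z - flux q (conv G (\<phi> n) z)\<bar> * (1 + \<bar>conv G (\<phi> n) z\<bar>) \<partial>lborel)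
    \<longlonglongrightarrow> 0"
proof (rule ccontr)
  define E where "E n z = \<bar>conv (\<lambda>w. flux q (G w)) (\<phi> n) z - flux q (conv G (\<phi> n) z)\<bar> * (1 + \<bar>conv G (\<phi> n) z\<bar>)"
    for n z
  define h where "h z = 2 * \<bar>G z\<bar> + (2 + 6 * 2 powr q) * \<bar>G z\<bar> powr q" for z
  have hi: "integrable lborel h"
    unfolding h_def using G Gq by (intro Bochner_Integration.integrable_add integrable_mult_right) auto
  have h0: "0 \<le> h z" for z by (simp add: h_def)
  have Ei: "integrable lborel (E n)" for n
    unfolding E_def by (rule integrable_commutator[OF m q G Gq])
  have Eb: "E n z \<le> conv h (\<phi> n) z" for n z
    unfolding E_def h_def by (rule commutator_bound[OF m q G Gq])
  have E0: "0 \<le> E n z" for n z by (simp add: E_def)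
  have fi: "integrable lborel (\<lambda>z. flux q (G z))" by (rule integrable_flux[OF m q G Gq])
  assume "\<not> (\<lambda>n. \<integral>z. E n z \<partial>lborel) \<longlonglongrightarrow> 0"
  then obtain \<epsilon> where \<epsilon>: "0 < \<epsilon>" "\<And>N. \<exists>n\<ge>N. \<epsilon> \<le> \<bar>\<integral>z. E n z \<partial>lborel\<bar>"
    unfolding lim_sequentially dist_real_def by (auto simp: not_less)
  have "infinite {n. \<epsilon> \<le> (LBINT z. E n z)}"
    unfolding infinite_nat_iff_unbounded_le using \<epsilon>(2) E0 by (simp add: abs_of_nonneg)
  then obtain s where s: "strict_mono (s :: nat \<Rightarrow> nat)" "\<And>n. \<epsilon> \<le> (LBINT z. E (s n) z)"
    using infinite_enumerate by blast
  have rs: "(\<lambda>n. r (t n)) \<longlonglongrightarrow> 0" if "strict_mono t" for t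
    using LIMSEQ_subseq_LIMSEQ[OF r that] by (simp add: comp_def)
  obtain s1 where s1: "strict_mono s1" "AE z in lborel. (\<lambda>n. conv G (\<phi> (s (s1 n))) z) \<longlonglongrightarrow> G z"
    using mollifies_AE_subseq[OF m rs[OF s(1)] G] by blast
  have ss1: "strict_mono (\<lambda>n. s (s1 n))" using s(1) s1(1) by (simp add: strict_mono_def)
  obtain s2 where s2: "strict_mono s2"
    "AE z in lborel. (\<lambda>n. conv (\<lambda>w. flux q (G w)) (\<phi> (s (s1 (s2 n)))) z) \<longlonglongrightarrow> flux q (G z)"
    using mollifies_AE_subseq[OF m rs[OF ss1] fi] by blast
  \<comment> \<open>a common subsequence for \<open>G\<close> and for its flux, inside the one that stays away from zero\<close>
  define t where "t n = s (s1 (s2 n))" for n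
  have t: "strict_mono t" using ss1 s2(1) by (simp add: strict_mono_def t_def)
  have "AE z in lborel. (\<lambda>n. E (t n) z) \<longlonglongrightarrow> 0"
    using s1(2) s2(2)
  proof eventually_elim
    case (elim z)
    have 1: "(\<lambda>n. conv G (\<phi> (t n)) z) \<longlonglongrightarrow> G z"
      using LIMSEQ_subseq_LIMSEQ[OF elim(1) s2(1)] by (simp add: t_def comp_def)
    have "isCont (flux q) (G z)" using flux_continuous[OF q] by (simp add: continuous_on_eq_continuous_at)
    from isCont_tendsto_compose[OF this 1]
    have "(\<lambda>n. E (t n) z) \<longlonglongrightarrow> \<bar>flux q (G z) - flux q (G z)\<bar> * (1 + \<bar>G z\<bar>)"
      unfolding E_def using elim(2) 1 by (intro tendsto_intros) (simp_all add: t_def)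
    then show ?case by simp
  qed
  then have min: "(\<lambda>n. \<integral>z. min (E (t n) z) (h z) \<partial>lborel) \<longlonglongrightarrow> (\<integral>z. 0 \<partial>(lborel :: 'a measure))"
  proof (intro integral_dominated_convergence[where w=h] hi)
    show "(\<lambda>z. min (E (t n) z) (h z)) \<in> borel_measurable lborel" for n
      using borel_measurable_integrable[OF integrable_min[OF Ei[of "t n"] hi]] .
    show "AE z in lborel. norm (min (E (t n) z) (h z)) \<le> h z" for n
      using E0 h0 by (intro AE_I2) (simp add: abs_of_nonneg)
    assume "AE z in lborel. (\<lambda>n. E (t n) z) \<longlonglongrightarrow> 0"
    then show "AE z in lborel. (\<lambda>n. min (E (t n) z) (h z)) \<longlonglongrightarrow> 0"
    proof eventually_elim
      case (elim z)
      from tendsto_min[OF elim tendsto_const[of "h z"]] show ?case using h0[of z] by simp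
    qed
  qed auto
  have "mollifies (\<lambda>n. \<phi> (t n)) h" by (rule mollifies_integrable[OF m rs[OF t] hi])
  then have "(\<lambda>n. (LBINT z. min (E (t n) z) (h z)) + (LBINT z. \<bar>conv h (\<phi> (t n)) z - h z\<bar>)) \<longlonglongrightarrow> 0 + 0"
    using min unfolding mollifies_def by (intro tendsto_add) auto
  then have "eventually (\<lambda>n. (LBINT z. min (E (t n) z) (h z)) + (LBINT z. \<bar>conv h (\<phi> (t n)) z - h z\<bar>) < \<epsilon>) sequentially"
    using \<epsilon>(1) by (intro order_tendstoD(2)[of _ 0]) auto
  then obtain n where n: "(LBINT z. min (E (t n) z) (h z)) + (LBINT z. \<bar>conv h (\<phi> (t n)) z - h z\<bar>) < \<epsilon>"
    using eventually_happens'[OF sequentially_bot] by blast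
  have im: "integrable lborel (\<lambda>z. min (E (t n) z) (h z))" by (rule integrable_min[OF Ei hi])
  have ic: "integrable lborel (\<lambda>z. \<bar>conv h (\<phi> (t n)) z - h z\<bar>)"
    by (intro integrable_abs Bochner_Integration.integrable_diff integrable_conv[OF m] hi)
  have "(LBINT z. E (t n) z) \<le> (LBINT z. min (E (t n) z) (h z) + \<bar>conv h (\<phi> (t n)) z - h z\<bar>)"
  proof (rule integral_mono[OF Ei Bochner_Integration.integrable_add[OF im ic]])
    show "E (t n) z \<le> min (E (t n) z) (h z) + \<bar>conv h (\<phi> (t n)) z - h z\<bar>" for z
      using Eb[of "t n" z] by (auto simp: min_def)
  qed
  then show False
    using n s(2)[of "s1 (s2 n)"] Bochner_Integration.integral_add[OF im ic] by (simp add: t_def)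
qed

section \<open>Smooth mollifiers\<close>

text \<open>The functions \<open>q (1 / x) * exp (- 1 / x)\<close> with a polynomial \<open>q\<close>, extended by zero: a class that is closed
  under differentiation, so that smoothness needs only one induction.\<close>

definition flat_exp :: "real poly \<Rightarrow> real \<Rightarrow> real" where
  "flat_exp q x = (if 0 < x then poly q (1 / x) * exp (- (1 / x)) else 0)"

text \<open>Hence every function of the class is continuous at zero. Its differentiability there reduces to
  this as well, since \<open>flat_exp q x = x * flat_exp (pCons 0 q) x\<close>.\<close>

lemma poly_times_exp_tendsto_0: "((\<lambda>y::real. poly q y * exp (- y)) \<longlongrightarrow> 0) at_top"
proof -
  have "((\<lambda>y. \<Sum>i\<le>degree q. coeff q i * (y ^ i / exp y)) \<longlongrightarrow> (\<Sum>i\<le>degree q. coeff q i * 0)) at_top"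
    by (intro tendsto_sum tendsto_mult_left tendsto_power_div_exp_0)
  then show ?thesis
    by (simp add: poly_altdef sum_distrib_right exp_minus divide_inverse mult.assoc)
qed

lemma flat_exp_isCont_0: "isCont (flat_exp q) 0"
proof -
  have "((\<lambda>x::real. poly q (1 / x) * exp (- (1 / x))) \<longlongrightarrow> 0) (at_right 0)"
    using filterlim_compose[OF poly_times_exp_tendsto_0 filterlim_inverse_at_top_right]
    by (simp add: inverse_eq_divide)
  moreover have "eventually (\<lambda>x. flat_exp q x = poly q (1 / x) * exp (- (1 / x))) (at_right 0)"
    by (auto simp: flat_exp_def eventually_at_right_less intro: eventually_mono[OF eventually_at_right_less])
  ultimately have "(flat_exp q \<longlongrightarrow> 0) (at_right 0)"
    by (simp add: filterlim_cong)
  moreover have "(flat_exp q \<longlongrightarrow> 0) (at_left 0)"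
    by (rule tendsto_eventually) (auto simp: flat_exp_def eventually_at_left_field intro!: exI[of _ "-1"])
  ultimately show ?thesis
    by (simp add: isCont_def filterlim_at_split flat_exp_def)
qed

lemma flat_exp_derivative:
  "(flat_exp q has_real_derivative flat_exp (monom 1 2 * (q - pderiv q)) x) (at x)"
proof -
  consider "x < 0" | "x > 0" | "x = 0" by linarith
  then show ?thesis
  proof cases
    case 1
    have "((\<lambda>x::real. 0::real) has_real_derivative 0) (at x)" by simp
    then have "(flat_exp q has_real_derivative 0) (at x)"
      by (rule has_field_derivative_transform_within_open[of _ _ _ "{..<0}"])
        (use 1 in \<open>auto simp: flat_exp_def\<close>)
    then show ?thesis using 1 by (simp add: flat_exp_def)
  next
    case 2
    have "((\<lambda>x. poly q (1 / x) * exp (- (1 / x))) has_real_derivative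
       flat_exp (monom 1 2 * (q - pderiv q)) x) (at x)"
      using 2 by (auto intro!: derivative_eq_intros DERIV_chain2[OF poly_DERIV]
          simp: flat_exp_def poly_monom field_simps power2_eq_square)
    then have "(flat_exp q has_real_derivative flat_exp (monom 1 2 * (q - pderiv q)) x) (at x)"
      by (rule has_field_derivative_transform_within_open[of _ _ _ "{0<..}"])
        (use 2 in \<open>auto simp: flat_exp_def\<close>)
    then show ?thesis .
  next
    case 3
    have "\<forall>z. flat_exp q z - flat_exp q 0 = flat_exp (pCons 0 q) z * (z - 0)"
      by (auto simp: flat_exp_def)
    then have "(flat_exp q has_real_derivative 0) (at 0)"
      unfolding CARAT_DERIV
      by (intro exI[of _ "flat_exp (pCons 0 q)"]) (auto simp: flat_exp_isCont_0 flat_exp_def)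
    then show ?thesis using 3 by (simp add: flat_exp_def)
  qed
qed

lemma flat_exp_continuous: "continuous_on UNIV (flat_exp q)"
  using flat_exp_derivative by (meson DERIV_isCont continuous_at_imp_continuous_on)

text \<open>Smoothness is proved on the whole space, where the derivative of a product needs no side conditions,
  and then restricted.\<close>

lemma Ck_on_subset: "Ck_on k UNIV f \<Longrightarrow> Ck_on k U f"
  by (induction k arbitrary: f) (auto intro: continuous_on_subset)

lemma Ck_on_Suc_D: "Ck_on (Suc k) UNIV f \<Longrightarrow> Ck_on k UNIV f"
proof (induction k arbitrary: f)
  case 0
  then show ?case
    by (auto intro!: continuous_at_imp_continuous_on differentiable_imp_continuous_within)
next
  case (Suc k)
  from Suc.prems have "\<forall>x. f differentiable (at x)"
    and "\<And>v. Ck_on (Suc k) UNIV (\<lambda>x. frechet_derivative f (at x) v)" by auto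
  then show ?case using Suc.IH by simp
qed

lemma Ck_on_const: "Ck_on k UNIV (\<lambda>_. c)"
  by (induction k arbitrary: c) auto

lemma Ck_on_SucI:
  assumes "\<And>x. (f has_derivative f' x) (at x)" "\<And>v. Ck_on k UNIV (\<lambda>x. f' x v)"
  shows "Ck_on (Suc k) UNIV f"
  using assms by (auto simp: frechet_derivative_at[OF assms(1), symmetric] differentiable_def)

lemma Ck_on_SucE:
  assumes "Ck_on (Suc k) UNIV f"
  obtains f' where "\<And>x. (f has_derivative f' x) (at x)" "\<And>v. Ck_on k UNIV (\<lambda>x. f' x v)"
  using assms frechet_derivative_works[of f] that[of "\<lambda>x. frechet_derivative f (at x)"] by auto

lemma Ck_on_add: "Ck_on k UNIV f \<Longrightarrow> Ck_on k UNIV g \<Longrightarrow> Ck_on k UNIV (\<lambda>x. f x + g x)"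
proof (induction k arbitrary: f g)
  case (Suc k)
  obtain f' where f': "\<And>x. (f has_derivative f' x) (at x)" "\<And>v. Ck_on k UNIV (\<lambda>x. f' x v)"
    by (rule Ck_on_SucE[OF Suc.prems(1)]) blast
  obtain g' where g': "\<And>x. (g has_derivative g' x) (at x)" "\<And>v. Ck_on k UNIV (\<lambda>x. g' x v)"
    by (rule Ck_on_SucE[OF Suc.prems(2)]) blast
  show ?case
    by (rule Ck_on_SucI[OF has_derivative_add[OF f'(1) g'(1)]]) (rule Suc.IH[OF f'(2) g'(2)])
qed (auto intro: continuous_intros)

lemma Ck_on_mult: "Ck_on k UNIV f \<Longrightarrow> Ck_on k UNIV g \<Longrightarrow> Ck_on k UNIV (\<lambda>x. f x * g x)"
proof (induction k arbitrary: f g)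
  case (Suc k)
  obtain f' where f': "\<And>x. (f has_derivative f' x) (at x)" "\<And>v. Ck_on k UNIV (\<lambda>x. f' x v)"
    by (rule Ck_on_SucE[OF Suc.prems(1)]) blast
  obtain g' where g': "\<And>x. (g has_derivative g' x) (at x)" "\<And>v. Ck_on k UNIV (\<lambda>x. g' x v)"
    by (rule Ck_on_SucE[OF Suc.prems(2)]) blast
  show ?case
    by (rule Ck_on_SucI[OF has_derivative_mult[OF f'(1) g'(1)]])
      (intro Ck_on_add Suc.IH f'(2) g'(2) Ck_on_Suc_D[OF Suc.prems(1)] Ck_on_Suc_D[OF Suc.prems(2)])
qed (auto intro: continuous_intros)

lemma Ck_on_affine: "Ck_on k UNIV (\<lambda>x. (x - a) \<bullet> v)"
proof (cases k)
  case (Suc k')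
  have "((\<lambda>x. (x - a) \<bullet> v) has_derivative (\<lambda>h. h \<bullet> v)) (at x)" for x
    by (auto intro!: derivative_eq_intros)
  then show ?thesis unfolding Suc by (rule Ck_on_SucI) (rule Ck_on_const)
qed (auto intro!: continuous_intros)

lemma radial_derivative:
  "((\<lambda>z. flat_exp q (c - r * ((z - a) \<bullet> (z - a)))) has_derivative
    (\<lambda>h. flat_exp (monom 1 2 * (q - pderiv q)) (c - r * ((z - a) \<bullet> (z - a))) * ((- 2 * r) * ((z - a) \<bullet> h)))) (at z)"
proof -
  have "((\<lambda>z. c - r * ((z - a) \<bullet> (z - a))) has_derivative (\<lambda>h. (- 2 * r) * ((z - a) \<bullet> h))) (at z)"
    by (auto intro!: derivative_eq_intros simp: algebra_simps inner_commute)
  from has_derivative_compose[OF this flat_exp_derivative[unfolded has_field_derivative_def]]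
  show ?thesis by simp
qed

lemma Ck_on_radial: "Ck_on k UNIV (\<lambda>z. flat_exp q (c - r * ((z - a) \<bullet> (z - a))))"
proof (induction k arbitrary: q)
  case 0
  show ?case
    by (auto intro!: continuous_on_compose2[OF flat_exp_continuous] continuous_intros)
next
  case (Suc k)
  show ?case
    by (rule Ck_on_SucI[OF radial_derivative]) (intro Ck_on_mult Suc.IH Ck_on_const Ck_on_affine)
qed

definition bump :: "real \<Rightarrow> 'a::euclidean_space \<Rightarrow> real" where
  "bump e z = flat_exp 1 (1 - 1 / e\<^sup>2 * (z \<bullet> z))"

definition std_mollifier :: "real \<Rightarrow> 'a::euclidean_space \<Rightarrow> real" where
  "std_mollifier e z = bump e z * (1 / (LBINT w. bump e (w :: 'a)))"

definition std_mollifier_grad :: "real \<Rightarrow> 'a::euclidean_space \<Rightarrow> 'a" where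
  "std_mollifier_grad e z = (flat_exp (monom 1 2 * (1 - pderiv 1)) (1 - 1 / e\<^sup>2 * (z \<bullet> z)) *
     (- 2 * (1 / e\<^sup>2)) * (1 / (LBINT w. bump e (w :: 'a)))) *\<^sub>R z"

lemma bump_nonneg: "0 \<le> bump e z"
  by (simp add: bump_def flat_exp_def)

lemma bump_zero:
  assumes "0 < e" "e \<le> norm z"
  shows "bump e z = 0"
proof -
  have "e\<^sup>2 \<le> (norm z)\<^sup>2" using assms by (intro power_mono) auto
  then have "1 \<le> 1 / e\<^sup>2 * (z \<bullet> z)" using assms(1) by (simp add: power2_norm_eq_inner field_simps)
  then show ?thesis by (simp add: bump_def flat_exp_def)
qed

lemma bump_continuous: "continuous_on UNIV (bump e)"
  unfolding bump_def[abs_def]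
  by (intro continuous_on_compose2[OF flat_exp_continuous] continuous_intros) auto

lemma bump_integral_pos:
  assumes "0 < e"
  shows "0 < (LBINT z. bump e (z :: 'a::euclidean_space))"
proof -
  let ?B = "ball (0::'a) (e / 2)"
  have c: "0 < exp (- (4 / 3) :: real)" by simp
  have b: "0 < measure lborel ?B" using assms by (intro content_ball_pos) auto
  have "exp (- (4 / 3)) * measure lborel ?B = (LBINT z. exp (- (4 / 3)) * indicator ?B z)"
    using emeasure_bounded_finite[OF bounded_ball, of "0::'a" "e / 2"] by simp
  also have "\<dots> \<le> (LBINT z. bump e (z::'a))"
  proof (rule integral_mono)
    show "integrable lborel (\<lambda>z. exp (- (4 / 3)) * indicator ?B z :: real)"
      using emeasure_bounded_finite[OF bounded_ball, of "0::'a" "e / 2"] by simp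
    show "integrable lborel (bump e :: 'a \<Rightarrow> real)"
      by (rule integrable_compact_support[OF bump_continuous, of "cball 0 e"]) (auto intro!: bump_zero[OF assms])
    fix z :: 'a
    show "exp (- (4 / 3)) * indicator ?B z \<le> bump e z"
    proof (cases "z \<in> ?B")
      case True
      then have "(norm z)\<^sup>2 \<le> (e / 2)\<^sup>2" by (intro power_mono) auto
      then have "z \<bullet> z \<le> e\<^sup>2 / 4" by (simp add: power2_norm_eq_inner power_divide)
      then have le: "3 / 4 \<le> 1 - 1 / e\<^sup>2 * (z \<bullet> z)"
        using assms by (simp add: field_simps)
      define s where "s = 1 - 1 / e\<^sup>2 * (z \<bullet> z)"
      have s: "3 / 4 \<le> s" using le by (simp add: s_def)
      then have "1 / s \<le> 1 / (3 / 4)"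
        by (intro divide_left_mono) auto
      then have "exp (- (4 / 3)) \<le> exp (- (1 / s))" by simp
      also have "\<dots> = bump e z" using s unfolding bump_def flat_exp_def s_def[symmetric] by simp
      finally show ?thesis using True by simp
    qed (simp add: bump_nonneg)
  qed
  finally show ?thesis using mult_pos_pos[OF c b] by linarith
qed

lemma std_mollifier_mollifier:
  assumes "0 < e"
  shows "mollifier e (std_mollifier e :: 'a::euclidean_space \<Rightarrow> real) (std_mollifier_grad e)"
proof -
  define I where "I = (LBINT w. bump e (w :: 'a))"
  have I: "0 < I" unfolding I_def by (rule bump_integral_pos[OF assms])
  have "(std_mollifier e has_derivative (\<lambda>h. std_mollifier_grad e z \<bullet> h)) (at z)" for z :: 'a
  proof -
    have "((\<lambda>z. flat_exp 1 (1 - 1 / e\<^sup>2 * ((z - 0) \<bullet> (z - 0))) * (1 / I)) has_derivative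
      (\<lambda>h. flat_exp (monom 1 2 * (1 - pderiv 1)) (1 - 1 / e\<^sup>2 * ((z - 0) \<bullet> (z - 0)))
         * ((- 2 * (1 / e\<^sup>2)) * ((z - 0) \<bullet> h)) * (1 / I))) (at z)"
      by (rule has_derivative_mult_left[OF radial_derivative])
    then show ?thesis
      unfolding std_mollifier_def[abs_def] std_mollifier_grad_def bump_def[abs_def] I_def
      by (simp add: mult_ac)
  qed
  moreover have "continuous_on UNIV (std_mollifier_grad e :: 'a \<Rightarrow> 'a)"
    unfolding std_mollifier_grad_def[abs_def]
    by (intro continuous_intros continuous_on_compose2[OF flat_exp_continuous]) auto
  moreover have "(LBINT z. std_mollifier e (z::'a)) = 1"
    using I by (simp add: std_mollifier_def I_def)
  moreover have "0 \<le> std_mollifier e z" for z :: 'a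
    using I by (simp add: std_mollifier_def bump_nonneg flip: I_def)
  moreover have "std_mollifier e z = 0" if "e \<le> norm z" for z :: 'a
    using bump_zero[OF assms that] by (simp add: std_mollifier_def)
  ultimately show ?thesis
    unfolding mollifier_def cont_grad_def by blast
qed

text \<open>
  The reflected mollifier is a test function on space-time, and its time slices are test functions
  on space: in both cases it is a radial function, for a slice with a shifted constant.
\<close>

lemma smooth_std_mollifier: "smooth_on U (\<lambda>z. std_mollifier e (z0 - z))"
proof -
  have eq: "(z0 - z) \<bullet> (z0 - z) = (z - z0) \<bullet> (z - z0)" for z
    by (simp add: inner_diff_left inner_diff_right)
  show ?thesis
    unfolding smooth_on_def std_mollifier_def bump_def
    by (subst eq) (intro allI Ck_on_subset[OF Ck_on_mult[OF Ck_on_radial Ck_on_const]])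
qed

lemma smooth_std_mollifier_slice:
  fixes z0 :: "'a::euclidean_space \<times> real"
  shows "smooth_on U (\<lambda>x. std_mollifier e (z0 - (x, t)))"
proof -
  have eq: "1 - 1 / e\<^sup>2 * ((z0 - (x, t)) \<bullet> (z0 - (x, t)))
    = (1 - 1 / e\<^sup>2 * (snd z0 - t)\<^sup>2) - 1 / e\<^sup>2 * ((x - fst z0) \<bullet> (x - fst z0))" for x
  proof -
    have "(fst z0 - x) \<bullet> (fst z0 - x) = (x - fst z0) \<bullet> (x - fst z0)"
      by (simp add: inner_diff_left inner_diff_right)
    then have "(z0 - (x, t)) \<bullet> (z0 - (x, t)) = (x - fst z0) \<bullet> (x - fst z0) + (snd z0 - t)\<^sup>2"
      by (simp add: inner_prod_def power2_eq_square)
    then show ?thesis by (simp only: distrib_left)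
  qed
  show ?thesis
    unfolding smooth_on_def std_mollifier_def bump_def eq
    by (intro allI Ck_on_subset[OF Ck_on_mult[OF Ck_on_radial Ck_on_const]])
qed

section \<open>From the weak formulation to a pointwise inequality\<close>

text \<open>Null sets have null slices. Fubini's theorem for almost everywhere statements needs a measurable
  exceptional set, so one passes to a Borel null set containing it.\<close>

lemma AE_lborel_slice:
  fixes P :: "'a::euclidean_space \<times> 'b::euclidean_space \<Rightarrow> bool"
  assumes "AE z in lborel. P z"
  shows "AE t in lborel. AE x in lborel. P (x, t)"
proof -
  obtain N where N: "{z. \<not> P z} \<subseteq> N" "emeasure lborel N = 0" "N \<in> sets lborel"
    using AE_E[OF assms] by auto
  have N': "N \<in> null_sets (lborel \<Otimes>\<^sub>M lborel)" using N by (simp add: lborel_prod null_sets_def)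
  then have [measurable]: "N \<in> sets (lborel \<Otimes>\<^sub>M lborel)" by auto
  have "AE z in lborel \<Otimes>\<^sub>M lborel. z \<notin> N" by (rule AE_not_in[OF N'])
  then have "AE x in lborel. AE t in lborel. (x, t) \<notin> N" by (rule lborel_pair.AE_pair)
  moreover have "{z \<in> space (lborel \<Otimes>\<^sub>M lborel). (fst z, snd z) \<notin> N} \<in> sets (lborel \<Otimes>\<^sub>M lborel)"
  proof -
    have "space (lborel \<Otimes>\<^sub>M lborel) - N \<in> sets (lborel \<Otimes>\<^sub>M lborel)" by (rule sets.compl_sets) fact
    moreover have "{z \<in> space (lborel \<Otimes>\<^sub>M lborel). (fst z, snd z) \<notin> N} = space (lborel \<Otimes>\<^sub>M lborel) - N" by auto
    ultimately show ?thesis by (simp only:)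
  qed
  ultimately have "AE t in lborel. AE x in lborel. (x, t) \<notin> N"
    using lborel_pair.AE_commute[of "\<lambda>x t. (x, t) \<notin> N"] by blast
  then show ?thesis
  proof eventually_elim
    case (elim t)
    then show ?case by eventually_elim (use N(1) in auto)
  qed
qed

text \<open>Solutions are Lebesgue measurable, while Fubini's theorem and translation invariance are used for
  the Borel measure \<open>lborel\<close>. This lemma translates integrals once a Borel representative is known.\<close>

lemma lebesgue_integral_eq_lborel:
  fixes F h :: "'a::euclidean_space \<Rightarrow> real"
  assumes F: "F \<in> borel_measurable borel" and eq: "AE x in lborel. h x = F x"
  shows "(\<integral>x. h x \<partial>lebesgue) = (LBINT x. F x)"
proof -
  have F': "F \<in> borel_measurable lebesgue" using F by (intro measurable_completion) simp
  have eq': "AE x in lebesgue. F x = h x" using AE_completion[OF eq] by (auto simp: eq_commute)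
  have "h \<in> borel_measurable lebesgue" by (rule borel_measurable_AE[OF F' eq'])
  then have "(\<integral>x. h x \<partial>lebesgue) = (\<integral>x. F x \<partial>lebesgue)"
    using eq' by (intro integral_cong_AE F') (auto simp: eq_commute)
  also have "\<dots> = (LBINT x. F x)" by (rule integral_completion) (use F in simp)
  finally show ?thesis .
qed

lemma borel_representative:
  fixes f :: "'a::euclidean_space \<Rightarrow> real"
  assumes f: "f \<in> borel_measurable (lebesgue_on S)" and C: "compact C" "C \<subseteq> S"
  shows "\<exists>F \<in> borel_measurable borel. AE z in lborel. (if z \<in> C then f z else 0) = F z"
proof -
  have "f \<in> borel_measurable (lebesgue_on C)" by (rule measurable_restrict_mono[OF f C(2)])
  then have "(\<lambda>z. if z \<in> C then f z else 0) \<in> borel_measurable lebesgue"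
    using C(1) by (intro borel_measurable_if_I) (auto intro: lmeasurable_compact fmeasurableD)
  from completion_ex_borel_measurable_real[OF this] show ?thesis by auto
qed

lemma integrable_representative:
  fixes f :: "'a::euclidean_space \<Rightarrow> real"
  assumes F: "F \<in> borel_measurable borel" and eq: "AE z in lborel. (if z \<in> C then f z else 0) = F z"
    and i: "set_integrable lebesgue C (\<lambda>z. \<bar>f z\<bar> powr q)"
  shows "integrable lborel (\<lambda>z. \<bar>F z\<bar> powr q)"
proof -
  have F': "(\<lambda>z. \<bar>F z\<bar> powr q) \<in> borel_measurable lborel" using F by measurable
  have "AE z in lebesgue. indicator C z *\<^sub>R \<bar>f z\<bar> powr q = \<bar>F z\<bar> powr q"
    using AE_completion[OF eq] by eventually_elim (auto simp: indicator_def split: if_splits)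
  then have "integrable lebesgue (\<lambda>z. \<bar>F z\<bar> powr q)"
    by (rule integrable_cong_AE_imp[OF i[unfolded set_integrable_def] measurable_completion[OF F']])
  then show ?thesis using integrable_completion[OF F'] by simp
qed

lemma mollified_test:
  fixes z0 :: "'a::euclidean_space"
  assumes e: "0 < e"
  shows "ddir v (\<lambda>z. std_mollifier e (z0 - z)) z = - (std_mollifier_grad e (z0 - z) \<bullet> v)"
proof -
  note d = cont_grad_derivative[OF mollifier_cont_grad[OF std_mollifier_mollifier[OF e]]]
  have "((\<lambda>z. z0 - z) has_derivative (\<lambda>h. - h)) (at z)" by (auto intro!: derivative_eq_intros)
  from has_derivative_compose[OF this d]
  have "((\<lambda>z. std_mollifier e (z0 - z)) has_derivative (\<lambda>h. std_mollifier_grad e (z0 - z) \<bullet> - h)) (at z)" .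
  from frechet_derivative_at[OF this, symmetric] show ?thesis by simp
qed

lemma mollified_test_slice:
  fixes z0 :: "'a::euclidean_space \<times> real"
  assumes e: "0 < e"
  shows "ddir v (\<lambda>x. std_mollifier e (z0 - (x, t))) x = - (std_mollifier_grad e (z0 - (x, t)) \<bullet> (v, 0))"
proof -
  note d = cont_grad_derivative[OF mollifier_cont_grad[OF std_mollifier_mollifier[OF e]]]
  have "((\<lambda>x. z0 - (x, t)) has_derivative (\<lambda>h. (- h, 0))) (at x)"
    by (auto intro!: derivative_eq_intros simp: fun_eq_iff)
  from has_derivative_compose[OF this d]
  have "((\<lambda>x. std_mollifier e (z0 - (x, t))) has_derivative (\<lambda>h. std_mollifier_grad e (z0 - (x, t)) \<bullet> (- h, 0))) (at x)" .
  from frechet_derivative_at[OF this, symmetric] show ?thesis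
    by (simp add: inner_prod_def)
qed

lemma outside_cylinder:
  fixes z0 z :: "'a::euclidean_space \<times> real"
  assumes "z \<notin> cball (fst z0) e \<times> {snd z0 - e..snd z0 + e}"
  shows "e \<le> norm (z0 - z)"
proof -
  define w where "w = z0 - z"
  have "e < norm (fst w) \<or> e < norm (snd w)"
    using assms by (auto simp: mem_Times_iff dist_norm w_def)
  moreover have "norm (fst w) \<le> norm w" "norm (snd w) \<le> norm w"
    using norm_fst_le[of "fst w" "snd w"] norm_snd_le[of "snd w" "fst w"] by simp_all
  ultimately show ?thesis by (auto simp: w_def)
qed

text \<open>\<open>U\<close> and \<open>G i\<close> are Borel representatives of \<open>u\<close> and of its spatial derivatives on the compact cylinder,
  extended by zero. At a point whose neighbourhood of size \<open>e\<close> lies in the cylinder, the extension is not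
  seen by the mollifier. There the definition of the weak derivative, applied slice by slice, moves
  the derivative from the mollifier to \<open>u\<close>, and the weak formulation gives the differential
  inequality. The boundary terms at both times vanish because the mollifier does.\<close>

theorem mollified_supersolution_exists:
  fixes p :: "'n::finite \<Rightarrow> real" and u :: "(real^'n) \<times> real \<Rightarrow> real"
  assumes super: "local_weak_supersolution p \<Omega> T u" and p: "\<And>i. 2 < p i"
    and K0: "compact K0" "K0 \<subseteq> \<Omega>" and I0: "compact I0" "I0 \<subseteq> {-T<..<T}"
    and lower: "AE z in lborel. z \<in> K0 \<times> I0 \<longrightarrow> m \<le> u z"
  obtains U G where "integrable lborel U" "AE z in lborel. z \<in> K0 \<times> I0 \<longrightarrow> U z = u z"
    "\<And>i. integrable lborel (G i)" "\<And>i. integrable lborel (\<lambda>z. \<bar>G i z\<bar> powr p i)"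
    "\<And>e z0 i. 0 < e \<Longrightarrow> cball (fst z0) e \<times> {snd z0 - e..snd z0 + e} \<subseteq> K0 \<times> I0 \<Longrightarrow>
       conv U (\<lambda>w. std_mollifier_grad e w \<bullet> (axis i 1, 0)) z0 = conv (G i) (std_mollifier e) z0"
    "\<And>e z0. 0 < e \<Longrightarrow> cball (fst z0) e \<times> {snd z0 - e..snd z0 + e} \<subseteq> K0 \<times> I0 \<Longrightarrow>
       (\<Sum>i\<in>UNIV. conv (\<lambda>w. flux (p i) (G i w)) (\<lambda>w. std_mollifier_grad e w \<bullet> (axis i 1, 0)) z0)
         \<le> conv U (\<lambda>w. std_mollifier_grad e w \<bullet> (0, 1)) z0"
    "\<And>e z0. 0 < e \<Longrightarrow> cball (fst z0) e \<times> {snd z0 - e..snd z0 + e} \<subseteq> K0 \<times> I0 \<Longrightarrow>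
       m \<le> conv U (std_mollifier e) z0"
proof -
  obtain Du where Du: "spatial_gradient p \<Omega> T u Du"
    and weak: "\<And>t1 t2 K \<phi>. -T < t1 \<Longrightarrow> t1 < t2 \<Longrightarrow> t2 < T \<Longrightarrow> compact K \<Longrightarrow> K \<subseteq> \<Omega> \<Longrightarrow>
          admissible_test \<Omega> T K \<phi> \<Longrightarrow> 0 \<le> weak_form p u Du K t1 t2 \<phi>"
    using super unfolding local_weak_supersolution_def by blast
  let ?C = "K0 \<times> I0"
  have C: "compact ?C" "?C \<subseteq> spacetime \<Omega> T"
    using K0 I0 by (auto simp: spacetime_def intro: compact_Times)
  have Lu: "Lp_loc_time 1 \<Omega> T u" "\<And>i. Lp_loc_time 1 \<Omega> T (Du i)" "\<And>i. Lp_loc_time (p i) \<Omega> T (Du i)"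
    and wp: "\<And>i. AE t in lebesgue. t \<in> {-T<..<T} \<longrightarrow> has_weak_partial i \<Omega> (\<lambda>x. u (x, t)) (\<lambda>x. Du i (x, t))"
    using Du unfolding spatial_gradient_def by auto
  have meas: "f \<in> borel_measurable (lebesgue_on (spacetime \<Omega> T))" if "Lp_loc_time q \<Omega> T f" for q f
    using that by (simp add: Lp_loc_time_def)
  have int: "set_integrable lebesgue ?C (\<lambda>z. \<bar>f z\<bar> powr q)" if "Lp_loc_time q \<Omega> T f" for q f
    using that K0 I0 by (auto simp: Lp_loc_time_def)
  obtain U where U: "U \<in> borel_measurable borel" "AE z in lborel. (if z \<in> ?C then u z else 0) = U z"
    using borel_representative[OF meas[OF Lu(1)] C] by blast
  have "\<exists>F \<in> borel_measurable borel. AE z in lborel. (if z \<in> ?C then Du i z else 0) = F z" for i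
    by (rule borel_representative[OF meas[OF Lu(2)] C])
  then have "\<forall>i. \<exists>F. F \<in> borel_measurable borel \<and> (AE z in lborel. (if z \<in> ?C then Du i z else 0) = F z)"
    by blast
  from choice[OF this] obtain G where G: "\<And>i. G i \<in> borel_measurable borel"
      "\<And>i. AE z in lborel. (if z \<in> ?C then Du i z else 0) = G i z"
    by blast
  have [measurable]: "U \<in> borel_measurable borel" "G i \<in> borel_measurable borel" for i
    using U G by auto
  have iU: "integrable lborel U"
    using integrable_representative[OF U int[OF Lu(1)]] U(1)
    by (simp add: integrable_abs_iff)
  have iG: "integrable lborel (G i)" for i
    using integrable_representative[OF G int[OF Lu(2)], of i] G(1)
    by (simp add: integrable_abs_iff)
  have iGp: "integrable lborel (\<lambda>z. \<bar>G i z\<bar> powr p i)" for i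
    by (rule integrable_representative[OF G int[OF Lu(3)]])
  have iA: "integrable lborel (\<lambda>w. flux (p i) (G i w))" for i
    by (rule integrable_flux[OF std_mollifier_mollifier[OF zero_less_one] p iG iGp])
  have Uu: "AE z in lborel. z \<in> ?C \<longrightarrow> U z = u z" using U(2) by eventually_elim auto
  have GD: "AE z in lborel. z \<in> ?C \<longrightarrow> G i z = Du i z" for i using G(2)[of i] by eventually_elim auto
  show ?thesis
  proof (rule that[OF iU Uu iG iGp])
    fix e :: real and z0 :: "(real^'n) \<times> real" and i
    assume e: "0 < e" and sub: "cball (fst z0) e \<times> {snd z0 - e..snd z0 + e} \<subseteq> ?C"
    let ?\<phi> = "std_mollifier e :: (real^'n) \<times> real \<Rightarrow> real"
    let ?g = "std_mollifier_grad e :: (real^'n) \<times> real \<Rightarrow> (real^'n) \<times> real"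
    note m = std_mollifier_mollifier[OF e, where 'a="(real^'n) \<times> real"]
    have cg: "continuous_on UNIV ?g" by (rule cont_grad_continuous_grad[OF mollifier_cont_grad[OF m]])
    have cgv: "continuous_on UNIV (\<lambda>w. ?g w \<bullet> v)" for v by (intro continuous_intros cg)
    have [measurable]: "?\<phi> \<in> borel_measurable borel" "(\<lambda>w. ?g w \<bullet> v) \<in> borel_measurable borel" for v
      using mollifier_measurable[OF m] borel_measurable_continuous_UNIV[OF cgv] by auto
    have g0: "?g z \<bullet> v = 0" if "e \<le> norm z" for z v
      using mollifier_gradient_zero[OF m that] by simp
    have ig: "integrable lborel (\<lambda>w. F w * (?g (z0 - w) \<bullet> v))" if "integrable lborel F" for F v
      by (rule integrable_conv_integrand[OF that cgv g0])
    have out: "?\<phi> (z0 - z) = 0" "?g (z0 - z) \<bullet> v = 0"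
      if "z \<notin> cball (fst z0) e \<times> {snd z0 - e..snd z0 + e}" for z v
      using outside_cylinder[OF that] mollifier_zero[OF m] g0 by auto
    have ball: "cball (fst z0) e \<subseteq> K0" "{snd z0 - e..snd z0 + e} \<subseteq> I0"
      using sub e by (auto simp: times_subset_iff)
    show "m \<le> conv U ?\<phi> z0"
    proof -
      have i1: "integrable lborel (\<lambda>w. m * ?\<phi> (z0 - w))"
        using integrable_lborel_reflect(1)[OF mollifier_integrable[OF m], of z0] by (intro integrable_mult_right)
      have "m = (LBINT w. m * ?\<phi> (z0 - w))" by (rule conv_const[OF m, symmetric])
      also have "\<dots> \<le> conv U ?\<phi> z0"
        unfolding conv_def
      proof (rule integral_mono_AE[OF i1 integrable_conv_section[OF m iU]])
        show "AE w in lborel. m * ?\<phi> (z0 - w) \<le> U w * ?\<phi> (z0 - w)"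
          using Uu lower
        proof eventually_elim
          case (elim w)
          show ?case
          proof (cases "w \<in> cball (fst z0) e \<times> {snd z0 - e..snd z0 + e}")
            case True
            then have "w \<in> ?C" using sub by blast
            then show ?thesis using elim mollifier_nonneg[OF m] by (intro mult_right_mono) auto
          qed (simp add: out)
        qed
      qed
      finally show ?thesis .
    qed
    show "(\<Sum>i\<in>UNIV. conv (\<lambda>w. flux (p i) (G i w)) (\<lambda>w. ?g w \<bullet> (axis i 1, 0)) z0)
         \<le> conv U (\<lambda>w. ?g w \<bullet> (0, 1)) z0"
    proof -
      let ?K = "cball (fst z0) e" and ?t1 = "snd z0 - e" and ?t2 = "snd z0 + e"
      let ?f = "\<lambda>z. ?\<phi> (z0 - z)"
      have "snd z0 - e \<in> I0" "snd z0 + e \<in> I0" using ball(2) e by auto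
      then have t: "-T < ?t1" "?t1 < ?t2" "?t2 < T" using I0(2) e by auto
      have adm: "admissible_test \<Omega> T ?K ?f"
        unfolding admissible_test_def
      proof (intro conjI ballI)
        show "smooth_on (spacetime \<Omega> T) ?f" by (rule smooth_std_mollifier)
        show "0 \<le> ?f z" for z by (rule mollifier_nonneg[OF m])
        show "closure {x \<in> \<Omega>. ?f (x, t) \<noteq> 0} \<subseteq> ?K" for t
        proof (rule closure_minimal)
          show "{x \<in> \<Omega>. ?f (x, t) \<noteq> 0} \<subseteq> ?K" using out(1)[of "(_, t)"] by fastforce
        qed simp
      qed
      have KO: "?K \<subseteq> \<Omega>" using ball(1) K0 by auto
      have "0 \<le> weak_form p u Du ?K ?t1 ?t2 ?f"
        by (rule weak[OF t compact_cball KO adm])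
      also have "weak_form p u Du ?K ?t1 ?t2 ?f =
        (LINT z:?K \<times> {?t1..?t2}|lebesgue. - u z * ddir (0, 1) ?f z
          + (\<Sum>i\<in>UNIV. \<bar>Du i z\<bar> powr (p i - 2) * Du i z * ddir (axis i 1, 0) ?f z))"
      proof -
        have "?f (x, ?t1) = 0" "?f (x, ?t2) = 0" for x
        proof -
          have sn: "norm (snd w) \<le> norm w" for w :: "(real^'n) \<times> real"
            using norm_snd_le[of "snd w" "fst w"] by simp
          have "e \<le> norm (z0 - (x, ?t1))" "e \<le> norm (z0 - (x, ?t2))"
            using sn[of "z0 - (x, ?t1)"] sn[of "z0 - (x, ?t2)"] e by simp_all
          then show "?f (x, ?t1) = 0" "?f (x, ?t2) = 0" by (auto intro: mollifier_zero[OF m])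
        qed
        then show ?thesis by (simp add: weak_form_def)
      qed
      also have "\<dots> = (LBINT z. U z * (?g (z0 - z) \<bullet> (0, 1))
          - (\<Sum>i\<in>UNIV. flux (p i) (G i z) * (?g (z0 - z) \<bullet> (axis i 1, 0))))"
        unfolding set_lebesgue_integral_def
      proof (rule lebesgue_integral_eq_lborel)
        show "(\<lambda>z. U z * (?g (z0 - z) \<bullet> (0, 1))
          - (\<Sum>i\<in>UNIV. flux (p i) (G i z) * (?g (z0 - z) \<bullet> (axis i 1, 0)))) \<in> borel_measurable borel"
          by measurable
        have "AE z in lborel. \<forall>i\<in>UNIV. z \<in> ?C \<longrightarrow> G i z = Du i z" by (rule AE_finite_allI[OF finite_class.finite_UNIV GD])
        with Uu show "AE z in lborel. indicator (?K \<times> {?t1..?t2}) z *\<^sub>R (- u z * ddir (0, 1) ?f z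
          + (\<Sum>i\<in>UNIV. \<bar>Du i z\<bar> powr (p i - 2) * Du i z * ddir (axis i 1, 0) ?f z))
          = U z * (?g (z0 - z) \<bullet> (0, 1)) - (\<Sum>i\<in>UNIV. flux (p i) (G i z) * (?g (z0 - z) \<bullet> (axis i 1, 0)))"
        proof eventually_elim
          case (elim z)
          show ?case
          proof (cases "z \<in> ?K \<times> {?t1..?t2}")
            case True
            then have "z \<in> ?C" using sub by blast
            then show ?thesis using elim True
              by (simp add: mollified_test[OF e] flux_def sum_negf)
          next
            case False
            then show ?thesis by (simp add: out[OF False])
          qed
        qed
      qed
      also have "\<dots> = conv U (\<lambda>w. ?g w \<bullet> (0, 1)) z0
        - (\<Sum>i\<in>UNIV. conv (\<lambda>w. flux (p i) (G i w)) (\<lambda>w. ?g w \<bullet> (axis i 1, 0)) z0)"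
        unfolding conv_def
        by (simp only: Bochner_Integration.integral_diff[OF ig[OF iU] Bochner_Integration.integrable_sum[OF ig[OF iA]]]
            Bochner_Integration.integral_sum[OF ig[OF iA]])
      finally show ?thesis by simp
    qed
    show "conv U (\<lambda>w. ?g w \<bullet> (axis i 1, 0)) z0 = conv (G i) ?\<phi> z0"
    proof -
      let ?e = "(axis i 1, 0) :: (real^'n) \<times> real"
      have fub: "(LBINT z. F z) = (LBINT t. (LBINT x. F (x, t)))"
        if "integrable lborel F" for F :: "(real^'n) \<times> real \<Rightarrow> real"
        using lborel_pair.integral_snd[of "\<lambda>x t. F (x, t)"] that by (simp add: lborel_prod)
      have fubm: "(\<lambda>t. \<integral>x. F (x, t) \<partial>lborel) \<in> borel_measurable lborel"
        if "integrable lborel F" for F :: "(real^'n) \<times> real \<Rightarrow> real"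
        using borel_measurable_integrable[OF lborel_pair.integrable_snd[of "\<lambda>x t. F (x, t)"]] that
        by (simp add: lborel_prod)
      have wp': "AE t in lborel. t \<in> {-T<..<T} \<longrightarrow> has_weak_partial i \<Omega> (\<lambda>x. u (x, t)) (\<lambda>x. Du i (x, t))"
        using wp[of i] by (simp add: AE_completion_iff)
      have "AE t in lborel. (LBINT x. U (x, t) * (?g (z0 - (x, t)) \<bullet> ?e))
        = (LBINT x. G i (x, t) * ?\<phi> (z0 - (x, t)))"
        using wp' AE_lborel_slice[OF Uu] AE_lborel_slice[OF GD[of i]]
      proof eventually_elim
        case (elim t)
        show ?case
        proof (cases "t \<in> {snd z0 - e..snd z0 + e}")
          case False
          then have "(x, t) \<notin> cball (fst z0) e \<times> {snd z0 - e..snd z0 + e}" for x by auto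
          then show ?thesis by (simp add: out)
        next
          case True
          let ?f = "\<lambda>x. ?\<phi> (z0 - (x, t))"
          have tI: "t \<in> I0" using True ball by auto
          have test: "test_function \<Omega> ?f"
            unfolding test_function_def compactly_contained_def
          proof (intro conjI)
            show "smooth_on UNIV ?f" by (rule smooth_std_mollifier_slice)
            have cl: "closure {x. ?f x \<noteq> 0} \<subseteq> cball (fst z0) e"
            proof (rule closure_minimal)
              show "{x. ?f x \<noteq> 0} \<subseteq> cball (fst z0) e" using out(1)[of "(_, t)"] by fastforce
            qed simp
            then show "closure {x. ?f x \<noteq> 0} \<subseteq> \<Omega>" using ball(1) K0 by auto
            have "bounded {x. ?f x \<noteq> 0}"
              by (rule bounded_subset[OF bounded_cball order_trans[OF closure_subset cl]])
            then show "compact (closure {x. ?f x \<noteq> 0})" by (simp add: compact_closure)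
          qed
          have ballO: "cball (fst z0) e \<subseteq> \<Omega>" using ball(1) K0 by auto
          have "t \<in> {-T<..<T}" using tI I0 by auto
          then have "(LINT x:\<Omega>|lebesgue. u (x, t) * ddir (axis i 1) ?f x) = - (LINT x:\<Omega>|lebesgue. Du i (x, t) * ?f x)"
            using elim(1) test unfolding has_weak_partial_def by blast
          moreover have "(LINT x:\<Omega>|lebesgue. u (x, t) * ddir (axis i 1) ?f x)
            = (LBINT x. - (U (x, t) * (?g (z0 - (x, t)) \<bullet> ?e)))"
            unfolding set_lebesgue_integral_def
          proof (rule lebesgue_integral_eq_lborel)
            show "(\<lambda>x. - (U (x, t) * (?g (z0 - (x, t)) \<bullet> ?e))) \<in> borel_measurable borel"
              by measurable
            show "AE x in lborel. indicator \<Omega> x *\<^sub>R (u (x, t) * ddir (axis i 1) ?f x)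
              = - (U (x, t) * (?g (z0 - (x, t)) \<bullet> ?e))"
              using elim(2)
            proof eventually_elim
              case (elim x)
              show ?case
              proof (cases "x \<in> cball (fst z0) e")
                case True
                then have "x \<in> K0" "x \<in> \<Omega>" using ball ballO by auto
                then show ?thesis using elim tI by (simp add: mollified_test_slice[OF e])
              next
                case False
                then have "(x, t) \<notin> cball (fst z0) e \<times> {snd z0 - e..snd z0 + e}" by auto
                then show ?thesis by (simp add: mollified_test_slice[OF e] out)
              qed
            qed
          qed
          moreover have "(LINT x:\<Omega>|lebesgue. Du i (x, t) * ?f x)
            = (LBINT x. G i (x, t) * ?\<phi> (z0 - (x, t)))"
            unfolding set_lebesgue_integral_def
          proof (rule lebesgue_integral_eq_lborel)
            show "(\<lambda>x. G i (x, t) * ?\<phi> (z0 - (x, t))) \<in> borel_measurable borel"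
              by measurable
            show "AE x in lborel. indicator \<Omega> x *\<^sub>R (Du i (x, t) * ?f x) = G i (x, t) * ?\<phi> (z0 - (x, t))"
              using elim(3)
            proof eventually_elim
              case (elim x)
              show ?case
              proof (cases "x \<in> cball (fst z0) e")
                case True
                then have "x \<in> K0" "x \<in> \<Omega>" using ball ballO by auto
                then show ?thesis using elim tI by simp
              next
                case False
                then have "(x, t) \<notin> cball (fst z0) e \<times> {snd z0 - e..snd z0 + e}" by auto
                then show ?thesis by (simp add: out)
              qed
            qed
          qed
          ultimately show ?thesis by simp
        qed
      qed
      then have "(LBINT t. (LBINT x. U (x, t) * (?g (z0 - (x, t)) \<bullet> ?e)))
        = (LBINT t. (LBINT x. G i (x, t) * ?\<phi> (z0 - (x, t))))"
      proof (rule integral_cong_AE[rotated 2])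
        show "(\<lambda>t. \<integral>x. U (x, t) * (?g (z0 - (x, t)) \<bullet> ?e) \<partial>lborel) \<in> borel_measurable lborel"
          by (rule fubm[OF ig[OF iU]])
        show "(\<lambda>t. \<integral>x. G i (x, t) * ?\<phi> (z0 - (x, t)) \<partial>lborel) \<in> borel_measurable lborel"
          by (rule fubm[OF integrable_conv_section[OF m iG]])
      qed
      then show ?thesis
        unfolding conv_def using fub[OF ig[OF iU]] fub[OF integrable_conv_section[OF m iG]] by simp
    qed
  qed
qed

section \<open>Cut-off functions\<close>

definition cutoff :: "nat \<Rightarrow> real \<Rightarrow> real \<Rightarrow> (real \<Rightarrow> real) \<Rightarrow> (real \<Rightarrow> real) \<Rightarrow> bool" where
  "cutoff q r R \<kappa> \<kappa>' \<longleftrightarrow> (\<forall>x. (\<kappa> has_real_derivative \<kappa>' x) (at x)) \<and> continuous_on UNIV \<kappa>' \<and>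
    (\<forall>x. 0 \<le> \<kappa> x \<and> \<kappa> x \<le> 1) \<and> (\<forall>x. \<bar>x\<bar> \<le> r \<longrightarrow> \<kappa> x = 1) \<and> (\<forall>x. R \<le> \<bar>x\<bar> \<longrightarrow> \<kappa> x = 0) \<and>
    (\<forall>x a. 0 \<le> a \<longrightarrow> a \<le> 1 - 1 / real q \<longrightarrow> \<bar>\<kappa>' x\<bar> \<le> 2 * real q / (R - r) * \<kappa> x powr a)"

text \<open>One minus a squared distance, truncated at zero and raised to the power \<open>q\<close>. The power makes the
  slope small where the function is small, as required by the last property of a cut-off.\<close>

lemma interval_cutoff:
  fixes r R :: real and q :: nat
  assumes rR: "0 < r" "r < R" and q: "2 \<le> q"
  shows "\<exists>\<kappa> \<kappa>'. cutoff q r R \<kappa> \<kappa>'"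
proof -
  define d where "d = R - r"
  have d: "0 < d" using rR by (simp add: d_def)
  obtain m where m: "q = Suc (Suc m)" using q by (metis Suc_le_D numeral_2_eq_2 Suc_le_mono)
  define \<eta> where "\<eta> x = 1 - (max 0 ((x - r) / d))\<^sup>2 - (max 0 ((- x - r) / d))\<^sup>2" for x
  define \<eta>' where "\<eta>' x = - (2 * max 0 ((x - r) / d) / d) + 2 * max 0 ((- x - r) / d) / d" for x
  define \<kappa> where "\<kappa> x = (max 0 (\<eta> x)) ^ q" for x
  define \<kappa>' where "\<kappa>' x = real q * (max 0 (\<eta> x)) ^ (q - 1) * \<eta>' x" for x
  have sq: "((\<lambda>x::real. (max 0 x)\<^sup>2) has_real_derivative 2 * max 0 x) (at x)" for x
    using pos_power_derivative[of 0 x] by (simp add: numeral_2_eq_2)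
  have l: "((\<lambda>x. (x - r) / d) has_real_derivative 1 / d) (at x)"
    "((\<lambda>x. (- x - r) / d) has_real_derivative - 1 / d) (at x)" for x
    using d by (auto intro!: derivative_eq_intros)
  have \<eta>_deriv: "(\<eta> has_real_derivative \<eta>' x) (at x)" for x
    unfolding \<eta>_def[abs_def] \<eta>'_def
    using DERIV_diff[OF DERIV_diff[OF DERIV_const DERIV_chain2[OF sq l(1)]] DERIV_chain2[OF sq l(2)], of 1 x]
    by simp
  have \<kappa>_deriv: "(\<kappa> has_real_derivative \<kappa>' x) (at x)" for x
    using DERIV_chain2[OF pos_power_derivative[of m] \<eta>_deriv]
    unfolding \<kappa>_def[abs_def] \<kappa>'_def m by simp
  have \<kappa>'_cont: "continuous_on UNIV \<kappa>'"
    unfolding \<kappa>'_def \<eta>_def \<eta>'_def using d by (intro continuous_intros) auto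
  have \<eta>1: "\<eta> x \<le> 1" for x by (simp add: \<eta>_def)
  have \<kappa>01: "0 \<le> \<kappa> x" "\<kappa> x \<le> 1" for x using \<eta>1[of x] by (auto simp: \<kappa>_def intro: power_le_one)
  have in1: "\<kappa> x = 1" if "\<bar>x\<bar> \<le> r" for x
  proof -
    have "(x - r) / d \<le> 0" "(- x - r) / d \<le> 0" using that d by (auto simp: divide_le_0_iff)
    then show ?thesis by (simp add: \<kappa>_def \<eta>_def)
  qed
  have big: "1 \<le> (max 0 ((y - r) / d))\<^sup>2" if "R \<le> y" for y
  proof -
    have "1 \<le> (y - r) / d" using that d by (simp add: d_def)
    then show ?thesis by (simp add: one_le_power)
  qed
  have out: "\<kappa> x = 0" if "R \<le> \<bar>x\<bar>" for x
  proof -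
    have "R \<le> x \<or> R \<le> - x" using that by linarith
    then have "\<eta> x \<le> 0" using big[of x] big[of "- x"] unfolding \<eta>_def
      by (smt (verit) zero_le_power2)
    then show ?thesis using q by (simp add: \<kappa>_def)
  qed
  have slope: "\<bar>\<kappa>' x\<bar> \<le> 2 * real q / d * \<kappa> x powr a" if a: "0 \<le> a" "a \<le> 1 - 1 / real q" for x a
  proof (cases "\<eta> x \<le> 0")
    case True
    then have "max 0 (\<eta> x) = 0" by simp
    then show ?thesis by (simp add: \<kappa>'_def \<kappa>_def m)
  next
    case False
    define h where "h = \<eta> x"
    have h: "0 < h" "h \<le> 1" using False \<eta>1[of x] by (auto simp: h_def)
    have lt: "\<bar>x\<bar> < R" using False out[of x] q by (force simp: \<kappa>_def)
    have "x \<le> r \<or> - x \<le> r" using rR by linarith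
    then have "(x - r) / d \<le> 0 \<or> (- x - r) / d \<le> 0" using d by (auto simp: divide_le_0_iff)
    then have "max 0 ((x - r) / d) = 0 \<or> max 0 ((- x - r) / d) = 0" by auto
    moreover have "max 0 ((x - r) / d) \<le> 1" "max 0 ((- x - r) / d) \<le> 1"
      using lt d by (auto simp: d_def)
    ultimately have "\<bar>\<eta>' x\<bar> \<le> 2 / d"
      using d by (auto simp: \<eta>'_def field_simps)
    moreover have "\<bar>\<kappa>' x\<bar> = real q * h ^ (q - 1) * \<bar>\<eta>' x\<bar>"
      using h by (simp add: \<kappa>'_def abs_mult h_def[symmetric])
    ultimately have "\<bar>\<kappa>' x\<bar> \<le> real q * h ^ (q - 1) * (2 / d)"
      using h mult_left_mono[of "\<bar>\<eta>' x\<bar>" "2 / d" "real q * h ^ (q - 1)"] by simp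
    also have "\<dots> = 2 * real q / d * h powr (real q - 1)"
      using h q by (simp add: powr_realpow[symmetric] of_nat_diff)
    also have "\<dots> \<le> 2 * real q / d * h powr (real q * a)"
    proof (intro mult_left_mono powr_mono')
      have "real q * a \<le> real q * (1 - 1 / real q)" using a q by (intro mult_left_mono) auto
      also have "\<dots> = real q - 1" using q by (simp add: field_simps)
      finally show "real q * a \<le> real q - 1" .
    qed (use h d in auto)
    also have "h powr (real q * a) = \<kappa> x powr a"
      using h by (simp add: \<kappa>_def h_def[symmetric] powr_powr[symmetric] powr_realpow)
    finally show ?thesis .
  qed
  show ?thesis
    using \<kappa>_deriv \<kappa>'_cont \<kappa>01 in1 out slope unfolding d_def cutoff_def by blast
qed

lemma product_slope_bound:
  fixes k P a c d :: real
  assumes "0 \<le> P" "P \<le> 1" "0 \<le> k" "0 \<le> a" "a \<le> 1" "\<bar>d\<bar> \<le> c * k powr a" "0 \<le> c"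
  shows "\<bar>d * P\<bar> \<le> c * (k * P) powr a"
proof -
  have "P powr 1 \<le> P powr a" using assms by (intro powr_mono') auto
  then have PP: "P \<le> P powr a" using assms by simp
  have "\<bar>d * P\<bar> \<le> (c * k powr a) * P powr a"
    unfolding abs_mult using assms PP by (intro mult_mono) auto
  then show ?thesis using assms by (simp add: powr_mult mult.assoc)
qed

text \<open>A product of cut-offs in each variable. The slope bounds survive because the remaining factors lie
  between zero and one.\<close>

lemma spacetime_cutoff:
  fixes r R p :: "'n::finite \<Rightarrow> real" and y :: "real^'n" and s \<sigma> \<Sigma> :: real and q :: nat
  assumes rR: "\<And>i. 0 < r i" "\<And>i. r i < R i" and \<sigma>: "0 < \<sigma>" "\<sigma> < \<Sigma>"
    and p: "\<And>i. 2 \<le> p i" "\<And>i. p i \<le> real q"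
  shows "\<exists>\<zeta> g\<zeta>. cont_grad \<zeta> g\<zeta> \<and> (\<forall>z. 0 \<le> \<zeta> z \<and> \<zeta> z \<le> 1) \<and>
    (\<forall>z. (\<forall>i. \<bar>fst z $ i - y $ i\<bar> \<le> r i) \<longrightarrow> \<bar>snd z - s\<bar> \<le> \<sigma> \<longrightarrow> \<zeta> z = 1) \<and>
    (\<forall>z. \<zeta> z \<noteq> 0 \<longrightarrow> (\<forall>i. \<bar>fst z $ i - y $ i\<bar> < R i) \<and> \<bar>snd z - s\<bar> < \<Sigma>) \<and>
    (\<forall>z. \<bar>snd (g\<zeta> z)\<bar> \<le> 2 * real q / (\<Sigma> - \<sigma>) * \<zeta> z powr (1 / 2)) \<and>
    (\<forall>z i. \<bar>fst (g\<zeta> z) $ i\<bar> \<le> 2 * real q / (R i - r i) * \<zeta> z powr (1 - 1 / p i))"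
proof -
  have q: "2 \<le> q" using p[of undefined] by linarith
  have "\<forall>i. \<exists>\<kappa> \<kappa>'. cutoff q (r i) (R i) \<kappa> \<kappa>'"
    by (intro allI interval_cutoff rR q)
  then obtain \<kappa> \<kappa>' where "\<And>i. cutoff q (r i) (R i) (\<kappa> i) (\<kappa>' i)" by metis
  then have \<kappa>:
    "\<And>i x. (\<kappa> i has_real_derivative \<kappa>' i x) (at x)" "\<And>i. continuous_on UNIV (\<kappa>' i)"
    "\<And>i x. 0 \<le> \<kappa> i x" "\<And>i x. \<kappa> i x \<le> 1" "\<And>i x. \<bar>x\<bar> \<le> r i \<Longrightarrow> \<kappa> i x = 1"
    "\<And>i x. R i \<le> \<bar>x\<bar> \<Longrightarrow> \<kappa> i x = 0"
    "\<And>i x a. 0 \<le> a \<Longrightarrow> a \<le> 1 - 1 / real q \<Longrightarrow> \<bar>\<kappa>' i x\<bar> \<le> 2 * real q / (R i - r i) * \<kappa> i x powr a"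
    unfolding cutoff_def by blast+
  obtain \<mu> \<mu>' where "cutoff q \<sigma> \<Sigma> \<mu> \<mu>'"
    using interval_cutoff[OF \<sigma> q] by blast
  then have \<mu>:
    "\<And>x. (\<mu> has_real_derivative \<mu>' x) (at x)" "continuous_on UNIV \<mu>'"
    "\<And>x. 0 \<le> \<mu> x" "\<And>x. \<mu> x \<le> 1" "\<And>x. \<bar>x\<bar> \<le> \<sigma> \<Longrightarrow> \<mu> x = 1"
    "\<And>x. \<Sigma> \<le> \<bar>x\<bar> \<Longrightarrow> \<mu> x = 0"
    "\<And>x a. 0 \<le> a \<Longrightarrow> a \<le> 1 - 1 / real q \<Longrightarrow> \<bar>\<mu>' x\<bar> \<le> 2 * real q / (\<Sigma> - \<sigma>) * \<mu> x powr a"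
    unfolding cutoff_def by blast+
  define k where "k i z = \<kappa> i (fst z $ i - y $ i)" for i and z :: "(real^'n) \<times> real"
  define k' where "k' i z = \<kappa>' i (fst z $ i - y $ i)" for i and z :: "(real^'n) \<times> real"
  define l where "l z = \<mu> (snd z - s)" for z :: "(real^'n) \<times> real"
  define l' where "l' z = \<mu>' (snd z - s)" for z :: "(real^'n) \<times> real"
  define \<zeta> where "\<zeta> z = (\<Prod>i\<in>UNIV. k i z) * l z" for z
  define g\<zeta> where "g\<zeta> z = (\<chi> i. k' i z * ((\<Prod>j\<in>UNIV - {i}. k j z) * l z), l' z * (\<Prod>i\<in>UNIV. k i z))" for z
  have k01: "0 \<le> k i z" "k i z \<le> 1" and l01: "0 \<le> l z" "l z \<le> 1" for i z
    using \<kappa>(3,4) \<mu>(3,4) by (auto simp: k_def l_def)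
  have prod01: "0 \<le> (\<Prod>i\<in>I. k i z)" "(\<Prod>i\<in>I. k i z) \<le> 1" for I z
  proof -
    show "0 \<le> (\<Prod>i\<in>I. k i z)" by (rule prod_nonneg) (use k01 in blast)
    show "(\<Prod>i\<in>I. k i z) \<le> 1" by (rule prod_le_1) (use k01 in blast)
  qed
  have dk: "(k i has_derivative (\<lambda>h. k' i z * (fst h $ i))) (at z)" for i z
  proof -
    have "((\<lambda>z. fst z $ i) has_derivative (\<lambda>h. fst h $ i)) (at z)"
      by (intro bounded_linear_imp_has_derivative bounded_linear_compose[OF bounded_linear_vec_nth bounded_linear_fst])
    from has_derivative_diff[OF this has_derivative_const[of "y $ i"]]
    have "((\<lambda>z. fst z $ i - y $ i) has_derivative (\<lambda>h. fst h $ i)) (at z)" by simp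
    from has_derivative_compose[OF this \<kappa>(1)[unfolded has_field_derivative_def]]
    show ?thesis by (simp add: k_def[abs_def] k'_def)
  qed
  have dl: "(l has_derivative (\<lambda>h. l' z * snd h)) (at z)" for z
  proof -
    have "((\<lambda>z. snd z - s) has_derivative (\<lambda>h. snd h)) (at z)"
      by (auto intro!: derivative_eq_intros)
    from has_derivative_compose[OF this \<mu>(1)[unfolded has_field_derivative_def]]
    show ?thesis by (simp add: l_def[abs_def] l'_def)
  qed
  have cont: "continuous_on UNIV (k i)" "continuous_on UNIV l" for i
    using dk dl by (meson continuous_at_imp_continuous_on has_derivative_continuous)+
  have cont': "continuous_on UNIV (k' i)" "continuous_on UNIV l'" for i
    unfolding k'_def l'_def
    by (intro continuous_on_compose2[OF \<kappa>(2)] continuous_on_compose2[OF \<mu>(2)] continuous_intros; simp)+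
  have "cont_grad \<zeta> g\<zeta>"
    unfolding cont_grad_def
  proof (intro conjI allI)
    fix z
    have "(\<zeta> has_derivative (\<lambda>h. (\<Prod>i\<in>UNIV. k i z) * (l' z * snd h)
      + (\<Sum>i\<in>UNIV. (k' i z * (fst h $ i)) * (\<Prod>j\<in>UNIV - {i}. k j z)) * l z)) (at z)"
      unfolding \<zeta>_def by (intro has_derivative_mult has_derivative_prod dk dl)
    then show "(\<zeta> has_derivative (\<lambda>h. g\<zeta> z \<bullet> h)) (at z)"
      by (rule has_derivative_eq_rhs)
        (simp add: fun_eq_iff g\<zeta>_def inner_prod_def inner_vec_def sum_distrib_left sum_distrib_right mult_ac)
    show "continuous_on UNIV g\<zeta>"
      unfolding g\<zeta>_def by (intro continuous_intros cont cont')
  qed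
  moreover have "0 \<le> \<zeta> z \<and> \<zeta> z \<le> 1" for z
    using prod01[of z UNIV] l01[of z] by (auto simp: \<zeta>_def intro: mult_le_one)
  moreover have "\<zeta> z = 1" if "\<forall>i. \<bar>fst z $ i - y $ i\<bar> \<le> r i" "\<bar>snd z - s\<bar> \<le> \<sigma>" for z
    using that by (simp add: \<zeta>_def k_def l_def \<kappa>(5) \<mu>(5))
  moreover have "(\<forall>i. \<bar>fst z $ i - y $ i\<bar> < R i) \<and> \<bar>snd z - s\<bar> < \<Sigma>" if "\<zeta> z \<noteq> 0" for z
  proof -
    have "\<forall>i. k i z \<noteq> 0" "l z \<noteq> 0" using that by (auto simp: \<zeta>_def)
    then show ?thesis using \<kappa>(6) \<mu>(6) unfolding k_def l_def by (meson not_less)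
  qed
  moreover have "\<bar>snd (g\<zeta> z)\<bar> \<le> 2 * real q / (\<Sigma> - \<sigma>) * \<zeta> z powr (1 / 2)" for z
  proof -
    have "1 / 2 \<le> 1 - 1 / real q" using q by (simp add: field_simps)
    then have "\<bar>l' z * (\<Prod>i\<in>UNIV. k i z)\<bar> \<le> 2 * real q / (\<Sigma> - \<sigma>) * (l z * (\<Prod>i\<in>UNIV. k i z)) powr (1 / 2)"
      using \<mu>(7) \<sigma> by (intro product_slope_bound prod01 l01) (auto simp: l'_def l_def)
    then show ?thesis by (simp add: g\<zeta>_def \<zeta>_def mult.commute)
  qed
  moreover have "\<bar>fst (g\<zeta> z) $ i\<bar> \<le> 2 * real q / (R i - r i) * \<zeta> z powr (1 - 1 / p i)" for z i
  proof -
    let ?P = "(\<Prod>j\<in>UNIV - {i}. k j z) * l z"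
    have P: "0 \<le> ?P" "?P \<le> 1" using prod01[of z "UNIV - {i}"] l01[of z] by (auto intro: mult_le_one)
    have "1 - 1 / p i \<le> 1 - 1 / real q" "0 \<le> 1 - 1 / p i" "1 - 1 / p i \<le> 1"
      using p[of i] by (auto simp: field_simps)
    then have "\<bar>k' i z * ?P\<bar> \<le> 2 * real q / (R i - r i) * (k i z * ?P) powr (1 - 1 / p i)"
      using \<kappa>(7)[of "1 - 1 / p i" i] rR[of i] by (intro product_slope_bound P k01) (auto simp: k'_def k_def)
    moreover have "\<zeta> z = k i z * ?P"
      unfolding \<zeta>_def by (simp add: prod.remove[of UNIV i])
    ultimately show ?thesis by (simp add: g\<zeta>_def)
  qed
  ultimately show ?thesis by blast
qed

section \<open>One step of the iteration\<close>

text \<open>The cylinders of the lower half, with independent half-widths, so that they can be interpolated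
  linearly between the inner and the outer cylinder.\<close>

definition past_box :: "real^'n \<Rightarrow> real \<Rightarrow> ('n::finite \<Rightarrow> real) \<Rightarrow> real \<Rightarrow> ((real^'n) \<times> real) set" where
  "past_box y s R \<Sigma> = {z. (\<forall>i. \<bar>fst z $ i - y $ i\<bar> < R i) \<and> s - \<Sigma> < snd z \<and> snd z \<le> s}"

lemma past_box_measurable:
  fixes y :: "real^'n"
  shows "past_box y s R \<Sigma> \<in> sets borel"
proof -
  have "continuous_on UNIV (\<lambda>z :: (real^'n) \<times> real. fst z $ i - y $ i)" for i
    by (intro continuous_intros)
  then have [measurable]: "(\<lambda>z :: (real^'n) \<times> real. fst z $ i - y $ i) \<in> borel_measurable borel" for i
    by (rule borel_measurable_continuous_UNIV)
  have [measurable]: "(snd :: (real^'n) \<times> real \<Rightarrow> real) \<in> borel_measurable borel"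
    by (intro borel_measurable_continuous_UNIV continuous_intros)
  show ?thesis unfolding past_box_def by measurable
qed

definition closed_box :: "real^'n \<Rightarrow> ('n::finite \<Rightarrow> real) \<Rightarrow> (real^'n) set" where
  "closed_box y R = {x. \<forall>i. \<bar>x $ i - y $ i\<bar> \<le> R i}"

lemma closed_box_compact: "compact (closed_box y R)"
proof -
  have "closed_box y R = cbox (\<chi> i. y $ i - R i) (\<chi> i. y $ i + R i)"
    by (auto simp: closed_box_def mem_box_cart abs_le_iff algebra_simps)
  then show ?thesis by simp
qed

lemma past_box_subset: "past_box y s R \<Sigma> \<subseteq> closed_box y R \<times> {s - \<Sigma>..s}"
  by (auto simp: past_box_def closed_box_def less_imp_le)

lemma past_box_fmeasurable: "past_box y s R \<Sigma> \<in> fmeasurable lborel"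
proof (rule fmeasurableI2[of "closed_box y R \<times> {s - \<Sigma>..s}"])
  have "compact (closed_box y R \<times> {s - \<Sigma>..s})" by (intro compact_Times closed_box_compact) auto
  then show "closed_box y R \<times> {s - \<Sigma>..s} \<in> fmeasurable lborel"
    by (intro fmeasurableI emeasure_compact_finite) (auto intro: borel_compact)
  show "past_box y s R \<Sigma> \<subseteq> closed_box y R \<times> {s - \<Sigma>..s}" by (rule past_box_subset)
  show "past_box y s R \<Sigma> \<in> sets lborel" using past_box_measurable[of y s R \<Sigma>] by simp
qed

lemma measure_exceed_le:
  fixes f :: "'a::euclidean_space \<Rightarrow> real"
  assumes f: "integrable lborel f" and c: "0 < c"
  shows "{z. c \<le> \<bar>f z\<bar>} \<in> fmeasurable lborel" "measure lborel {z. c \<le> \<bar>f z\<bar>} \<le> (LBINT z. \<bar>f z\<bar>) / c"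
proof -
  have i: "integrable lborel (\<lambda>z. \<bar>f z\<bar>)" using f by auto
  have [measurable]: "f \<in> borel_measurable borel" using borel_measurable_integrable[OF f] by simp
  have e: "emeasure lborel {z. c \<le> \<bar>f z\<bar>} \<le> ennreal ((LBINT z. \<bar>f z\<bar>) / c)"
    using integral_Markov_inequality[OF i _ c] by simp
  also have "\<dots> < \<infinity>" by simp
  finally show fm: "{z. c \<le> \<bar>f z\<bar>} \<in> fmeasurable lborel" by (intro fmeasurableI) auto
  have "0 \<le> (LBINT z. \<bar>f z\<bar>) / c" using c by simp
  then show "measure lborel {z. c \<le> \<bar>f z\<bar>} \<le> (LBINT z. \<bar>f z\<bar>) / c"
    using e by (simp add: measure_def enn2real_leI)
qed

text \<open>What the iteration needs to know about a super-solution. Everything is expressed by convolutions with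
  the representatives of \<open>u\<close> and its derivatives.\<close>

locale mollified_supersolution =
  fixes p :: "'n::finite \<Rightarrow> real" and U :: "(real^'n) \<times> real \<Rightarrow> real" and G
    and y :: "real^'n" and s :: real and R' :: "'n \<Rightarrow> real" and \<Sigma>' m :: real
  assumes p: "\<And>i. 2 < p i"
    and iU: "integrable lborel U" and iG: "\<And>i. integrable lborel (G i)"
    and iGp: "\<And>i. integrable lborel (\<lambda>z. \<bar>G i z\<bar> powr p i)"
    and gradient: "\<And>e z0 i. 0 < e \<Longrightarrow>
       cball (fst z0) e \<times> {snd z0 - e..snd z0 + e} \<subseteq> closed_box y R' \<times> {s - \<Sigma>'..s + \<Sigma>'} \<Longrightarrow>
       conv U (\<lambda>w. std_mollifier_grad e w \<bullet> (axis i 1, 0)) z0 = conv (G i) (std_mollifier e) z0"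
    and inequality: "\<And>e z0. 0 < e \<Longrightarrow>
       cball (fst z0) e \<times> {snd z0 - e..snd z0 + e} \<subseteq> closed_box y R' \<times> {s - \<Sigma>'..s + \<Sigma>'} \<Longrightarrow>
       (\<Sum>i\<in>UNIV. conv (\<lambda>w. flux (p i) (G i w)) (\<lambda>w. std_mollifier_grad e w \<bullet> (axis i 1, 0)) z0)
         \<le> conv U (\<lambda>w. std_mollifier_grad e w \<bullet> (0, 1)) z0"
    and lower: "\<And>e z0. 0 < e \<Longrightarrow>
       cball (fst z0) e \<times> {snd z0 - e..snd z0 + e} \<subseteq> closed_box y R' \<times> {s - \<Sigma>'..s + \<Sigma>'} \<Longrightarrow>
       m \<le> conv U (std_mollifier e) z0"
begin

context
  fixes r R L :: "'n \<Rightarrow> real" and \<sigma> \<Sigma> k k' K :: real and q :: nat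
  assumes rR: "\<And>i. 0 < r i" "\<And>i. r i < R i" "\<And>i. R i < R' i"
    and \<sigma>: "0 < \<sigma>" "\<sigma> < \<Sigma>" "\<Sigma> < \<Sigma>'" and k: "k' < k" "k - m \<le> K" and K: "0 \<le> K"
    and q: "\<And>i. p i \<le> real q" and L: "\<And>i. 0 < L i"
begin

definition slope where "slope i = 2 * real q / (R i - r i)"
definition half_gap where "half_gap = ((k - k') / 3) ^ 3 / 6"
definition rate where "rate = K ^ 3 / 3 * (2 * real q / (\<Sigma> - \<sigma>)) + (\<Sum>i\<in>UNIV. K * (K * slope i) powr p i)"
definition mass where "mass = measure lborel {z \<in> past_box y s R \<Sigma>. U z < k}"
definition mass' where "mass' = measure lborel {z \<in> past_box y s r \<sigma>. U z < k'}"

lemma positivity: "0 < slope i" "0 < half_gap" "0 \<le> rate" "0 \<le> mass"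
proof -
  have "0 < real q" using p[of i] q[of i] by linarith
  then show "0 < slope i" using rR[of i] by (simp add: slope_def)
  have c: "0 \<le> slope i" for i using rR[of i] by (simp add: slope_def)
  show "0 < half_gap" using k by (simp add: half_gap_def)
  show "0 \<le> rate" unfolding rate_def using K \<sigma> by (intro add_nonneg_nonneg sum_nonneg) auto
  show "0 \<le> mass" by (simp add: mass_def)
qed

text \<open>The gain for the mollified function at a fine scale. Passing from \<open>U\<close> to its mollification and back
  costs a set of measure \<open>\<delta>\<close> each time; for this the gap between the levels is split into three equal
  parts, of which the outer two separate \<open>U\<close> from the mollified function.\<close>

lemma approximate_gain:
  assumes \<delta>: "0 < \<delta>"
  shows "half_gap * (mass' - \<delta>) \<le> ((rate * (mass + \<delta>) + \<delta>) / (half_gap * (\<Prod>i\<in>UNIV. 2 * L i))) powr (1 / CARD('n))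
    * (\<Sum>i\<in>UNIV. (L i * slope i * K ^ 3 / 3 + K\<^sup>2) * (mass + \<delta>) + K * L i powr p i * (rate * (mass + \<delta>) + \<delta>))"
proof -
  define \<eta> where "\<eta> = (k - k') / 3"
  have \<eta>: "0 < \<eta>" using k by (simp add: \<eta>_def)
  have p2: "\<And>i. 2 \<le> p i" using p less_imp_le by blast
  obtain \<zeta> g\<zeta> where \<zeta>: "cont_grad \<zeta> g\<zeta>" "\<And>z. 0 \<le> \<zeta> z" "\<And>z. \<zeta> z \<le> 1"
    "\<And>z. (\<forall>i. \<bar>fst z $ i - y $ i\<bar> \<le> r i) \<Longrightarrow> \<bar>snd z - s\<bar> \<le> \<sigma> \<Longrightarrow> \<zeta> z = 1"
    "\<And>z i. \<zeta> z \<noteq> 0 \<Longrightarrow> \<bar>fst z $ i - y $ i\<bar> < R i" "\<And>z. \<zeta> z \<noteq> 0 \<Longrightarrow> \<bar>snd z - s\<bar> < \<Sigma>"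
    "\<And>z. \<bar>snd (g\<zeta> z)\<bar> \<le> 2 * real q / (\<Sigma> - \<sigma>) * \<zeta> z powr (1 / 2)"
    "\<And>z i. \<bar>fst (g\<zeta> z) $ i\<bar> \<le> slope i * \<zeta> z powr (1 - 1 / p i)"
    using spacetime_cutoff[of r R \<sigma> \<Sigma> p q y s, OF rR(1,2) \<sigma>(1,2) p2 q] unfolding slope_def by metis
  define e where "e n = inverse (real (Suc n))" for n
  define \<phi> where "\<phi> n = (std_mollifier (e n) :: (real^'n) \<times> real \<Rightarrow> real)" for n
  define g where "g n = (std_mollifier_grad (e n) :: (real^'n) \<times> real \<Rightarrow> (real^'n) \<times> real)" for n
  have e0: "0 < e n" for n by (simp add: e_def)
  have elim: "e \<longlonglongrightarrow> 0" unfolding e_def by (rule LIMSEQ_inverse_real_of_nat)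
  have mol: "mollifier (e n) (\<phi> n) (g n)" for n
    unfolding \<phi>_def g_def by (rule std_mollifier_mollifier[OF e0])
  define E where "E n i z = \<bar>conv (\<lambda>w. flux (p i) (G i w)) (\<phi> n) z - flux (p i) (conv (G i) (\<phi> n) z)\<bar>
    * (1 + \<bar>conv (G i) (\<phi> n) z\<bar>)" for n i z
  have E: "(\<lambda>n. \<integral>z. E n i z \<partial>lborel) \<longlonglongrightarrow> 0" for i
    unfolding E_def by (rule commutator_tendsto_zero[OF mol elim p iG iGp])
  have Esum: "(\<lambda>n. \<Sum>i\<in>UNIV. (2 * K + K\<^sup>2 * slope i) * (LBINT z. E n i z)) \<longlonglongrightarrow> (\<Sum>i\<in>UNIV. (2 * K + K\<^sup>2 * slope i) * 0)"
    by (intro tendsto_sum tendsto_mult_left E)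
  have Usum: "(\<lambda>n. \<integral>z. \<bar>conv U (\<phi> n) z - U z\<bar> \<partial>lborel) \<longlonglongrightarrow> 0"
    using mollifies_integrable[OF mol elim iU] by (simp add: mollifies_def)
  have "eventually (\<lambda>n. (\<Sum>i\<in>UNIV. (2 * K + K\<^sup>2 * slope i) * (LBINT z. E n i z)) < \<delta>) sequentially"
    using order_tendstoD(2)[OF Esum, of \<delta>] \<delta> by simp
  moreover have "eventually (\<lambda>n. (LBINT z. \<bar>conv U (\<phi> n) z - U z\<bar>) < \<delta> * \<eta>) sequentially"
    using order_tendstoD(2)[OF Usum, of "\<delta> * \<eta>"] \<delta> \<eta> by simp
  moreover have "eventually (\<lambda>n. \<forall>i. e n < R' i - R i) sequentially"
    using order_tendstoD(2)[OF elim] rR(3) by (intro eventually_all_finite) simp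
  moreover have "eventually (\<lambda>n. e n < \<Sigma>' - \<Sigma>) sequentially"
    using order_tendstoD(2)[OF elim, of "\<Sigma>' - \<Sigma>"] \<sigma> by simp
  ultimately have "eventually (\<lambda>n. (\<Sum>i\<in>UNIV. (2 * K + K\<^sup>2 * slope i) * (LBINT z. E n i z)) < \<delta> \<and>
    (LBINT z. \<bar>conv U (\<phi> n) z - U z\<bar>) < \<delta> * \<eta> \<and> (\<forall>i. e n < R' i - R i) \<and> e n < \<Sigma>' - \<Sigma>) sequentially"
    by eventually_elim simp
  then obtain n where n: "(\<Sum>i\<in>UNIV. (2 * K + K\<^sup>2 * slope i) * (LBINT z. E n i z)) < \<delta>"
    "(LBINT z. \<bar>conv U (\<phi> n) z - U z\<bar>) < \<delta> * \<eta>" "\<And>i. e n < R' i - R i" "e n < \<Sigma>' - \<Sigma>"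
    using eventually_happens'[OF sequentially_bot] by blast
  define v where "v = conv U (\<phi> n)"
  define gv where "gv z = (\<Sum>b\<in>Basis. conv U (\<lambda>w. g n w \<bullet> b) z *\<^sub>R b)" for z
  define B where "B i = conv (\<lambda>w. flux (p i) (G i w)) (\<phi> n)" for i
  define gB where "gB i z = (\<Sum>b\<in>Basis. conv (\<lambda>w. flux (p i) (G i w)) (\<lambda>w. g n w \<bullet> b) z *\<^sub>R b)" for i z
  have iA: "integrable lborel (\<lambda>w. flux (p i) (G i w))" for i
    by (rule integrable_flux[OF mol p iG iGp])
  have comp: "fst w $ i = w \<bullet> (axis i 1, 0)" "snd w = w \<bullet> (0, 1)" for w :: "(real^'n) \<times> real" and i
    by (simp_all add: inner_prod_def inner_axis)
  have basis: "(axis i 1, 0) \<in> (Basis :: ((real^'n) \<times> real) set)" "(0, 1) \<in> (Basis :: ((real^'n) \<times> real) set)" for i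
    by (auto simp: Basis_prod_def Basis_vec_def)
  have cyl: "cball (fst z) (e n) \<times> {snd z - e n..snd z + e n} \<subseteq> closed_box y R' \<times> {s - \<Sigma>'..s + \<Sigma>'}"
    if "0 < \<zeta> z" for z
  proof -
    have "cball (fst z) (e n) \<subseteq> closed_box y R'"
    proof
      fix x assume x: "x \<in> cball (fst z) (e n)"
      have "\<bar>x $ i - y $ i\<bar> \<le> R' i" for i
      proof -
        have "\<bar>(fst z - x) $ i\<bar> \<le> norm (fst z - x)" by (rule component_le_norm_cart)
        also have "\<dots> \<le> e n" using x by (simp add: dist_norm)
        finally show ?thesis using \<zeta>(5)[of z i] n(3)[of i] that by simp
      qed
      then show "x \<in> closed_box y R'" by (simp add: closed_box_def)
    qed
    moreover have "{snd z - e n..snd z + e n} \<subseteq> {s - \<Sigma>'..s + \<Sigma>'}"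
      using \<zeta>(6)[of z] n(4) that by auto
    ultimately show ?thesis by blast
  qed
  have gvi: "fst (gv z) $ i = conv (G i) (\<phi> n) z" if "0 < \<zeta> z" for z i
    using gradient[OF e0 cyl[OF that], of i]
    by (simp add: comp gv_def conv_gradient_component[OF basis(1)] g_def \<phi>_def)
  interpret approx_supersolution p v gv B gB \<zeta> g\<zeta> "closed_box y R" "s - \<Sigma>" s "k - \<eta>" K
    "2 * real q / (\<Sigma> - \<sigma>)" slope "E n"
  proof
    show "2 \<le> p i" for i by (rule p2)
    show "cont_grad v gv" unfolding v_def gv_def by (rule cont_grad_conv[OF iU mol])
    show "cont_grad (B i) (gB i)" for i unfolding B_def gB_def by (rule cont_grad_conv[OF iA mol])
    show "cont_grad \<zeta> g\<zeta>" by (rule \<zeta>(1))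
    show "compact (closed_box y R)" by (rule closed_box_compact)
    show "\<zeta> (x, t) = 0" if "x \<notin> closed_box y R" for x t
    proof (rule ccontr)
      assume "\<zeta> (x, t) \<noteq> 0"
      then have "\<bar>x $ i - y $ i\<bar> \<le> R i" for i using \<zeta>(5)[of "(x, t)" i] by simp
      then show False using that by (simp add: closed_box_def)
    qed
    show "0 \<le> \<zeta> z" "\<zeta> z \<le> 1" for z by (rule \<zeta>)+
    show "\<zeta> (x, s - \<Sigma>) = 0" for x
    proof (rule ccontr)
      assume "\<zeta> (x, s - \<Sigma>) \<noteq> 0"
      from \<zeta>(6)[OF this] show False using \<sigma> by simp
    qed
    show "s - \<Sigma> \<le> s" "0 \<le> 2 * real q / (\<Sigma> - \<sigma>)" using \<sigma> by auto
    show "0 \<le> slope i" for i using positivity(1)[of i] by simp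
    show "\<bar>snd (g\<zeta> z)\<bar> \<le> 2 * real q / (\<Sigma> - \<sigma>) * \<zeta> z powr (1 / 2)" for z by (rule \<zeta>)
    show "\<bar>fst (g\<zeta> z) $ i\<bar> \<le> slope i * \<zeta> z powr (1 - 1 / p i)" for z i by (rule \<zeta>)
    show "(\<Sum>i\<in>UNIV. fst (gB i z) $ i) \<le> snd (gv z)" if "0 < \<zeta> z" for z
      using inequality[OF e0 cyl[OF that]]
      by (simp add: comp gv_def gB_def conv_gradient_component[OF basis(1)] conv_gradient_component[OF basis(2)] g_def)
    show "k - \<eta> - K \<le> v z" if "0 < \<zeta> z" for z
      using lower[OF e0 cyl[OF that]] k(2) \<eta> by (simp add: v_def \<phi>_def)
    show "0 \<le> K" by (rule K)
    show "integrable lborel (E n i)" for i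
      unfolding E_def by (rule integrable_commutator[OF mol p iG iGp])
    show "0 \<le> E n i z" for i z by (simp add: E_def)
    show "\<bar>B i z - flux (p i) (fst (gv z) $ i)\<bar> * (1 + \<bar>fst (gv z) $ i\<bar>) \<le> E n i z" if "0 < \<zeta> z" for i z
      by (simp add: gvi[OF that] B_def E_def)
  qed
  define X where "X = {z. \<eta> \<le> \<bar>v z - U z\<bar>}"
  have iv: "integrable lborel (\<lambda>z. v z - U z)"
    unfolding v_def by (intro Bochner_Integration.integrable_diff integrable_conv[OF mol] iU)
  have Xf: "X \<in> fmeasurable lborel" unfolding X_def by (rule measure_exceed_le(1)[OF iv \<eta>])
  have X\<delta>: "measure lborel X \<le> \<delta>"
  proof -
    have "measure lborel X \<le> (LBINT z. \<bar>v z - U z\<bar>) / \<eta>"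
      unfolding X_def by (rule measure_exceed_le(2)[OF iv \<eta>])
    also have "\<dots> \<le> \<delta>" using n(2) \<eta> by (simp add: v_def field_simps)
    finally show ?thesis .
  qed
  have [measurable]: "U \<in> borel_measurable borel" using borel_measurable_integrable[OF iU] by simp
  have meas: "{z \<in> past_box y s r' \<sigma>'. U z < t} \<in> fmeasurable lborel" for r' \<sigma>' t
  proof (rule fmeasurableI2[OF past_box_fmeasurable[of y s r' \<sigma>']])
    have "{z \<in> space borel. U z < t} \<in> sets borel" by measurable
    then have "past_box y s r' \<sigma>' \<inter> {z. U z < t} \<in> sets borel"
      using past_box_measurable by (intro sets.Int) auto
    then show "{z \<in> past_box y s r' \<sigma>'. U z < t} \<in> sets lborel" by (simp add: Int_def)
  qed auto
  have Zle: "measure lborel Z \<le> mass + \<delta>"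
  proof -
    have "Z \<subseteq> {z \<in> past_box y s R \<Sigma>. U z < k} \<union> X"
    proof
      fix z assume "z \<in> Z"
      then have z: "snd z \<le> s" "0 < \<zeta> z" "v z < k - \<eta>" by (auto simp: Z_def)
      then have "z \<in> past_box y s R \<Sigma>" using \<zeta>(5)[of z] \<zeta>(6)[of z] by (auto simp: past_box_def)
      then show "z \<in> {z \<in> past_box y s R \<Sigma>. U z < k} \<union> X" using z by (auto simp: X_def)
    qed
    then have "measure lborel Z \<le> measure lborel ({z \<in> past_box y s R \<Sigma>. U z < k} \<union> X)"
      using Z_measurable meas Xf by (intro measure_mono_fmeasurable) auto
    also have "\<dots> \<le> mass + measure lborel X"
      unfolding mass_def by (intro measure_Un_le fmeasurableD meas Xf)
    finally show ?thesis using X\<delta> by linarith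
  qed
  define M where "M = rate * (mass + \<delta>) + \<delta>"
  define P where "P = half_gap * (\<Prod>i\<in>UNIV. 2 * L i)"
  define rr where "rr = (M / P) powr (1 / CARD('n))"
  have P: "0 < P" unfolding P_def using positivity(2) L by (intro mult_pos_pos prod_pos) auto
  have M: "0 < M" unfolding M_def using positivity(3,4) \<delta> by (intro add_nonneg_pos mult_nonneg_nonneg) auto
  \<comment> \<open>the least radius that satisfies the mass condition of the weak-type inequality\<close>
  have rr: "0 < rr" using M P by (simp add: rr_def)
  have "rr ^ CARD('n) = rr powr real CARD('n)" using rr by (simp add: powr_realpow)
  also have "\<dots> = M / P" using M P by (simp add: rr_def powr_powr)
  finally have rrN: "rr ^ CARD('n) = M / P" .
  have bM: "bound \<le> M"
  proof -
    have "approx_supersolution.\<Lambda> p K (2 * real q / (\<Sigma> - \<sigma>)) slope = rate"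
      by (simp add: local.\<Lambda>_def rate_def)
    then have "bound = rate * measure lborel Z + (\<Sum>i\<in>UNIV. (2 * K + K\<^sup>2 * slope i) * (LBINT z. E n i z))"
      by (simp add: bound_def)
    also have "\<dots> \<le> rate * (mass + \<delta>) + \<delta>"
      using Zle n(1) positivity(3) by (intro add_mono mult_left_mono) auto
    finally show ?thesis by (simp add: M_def)
  qed
  have "half_gap * (\<Prod>i\<in>UNIV. 2 * rr * L i) = rr ^ CARD('n) * P"
  proof -
    have "(\<Prod>i\<in>UNIV. 2 * rr * L i) = (\<Prod>i\<in>UNIV. rr * (2 * L i))" by (intro prod.cong) auto
    also have "\<dots> = rr ^ CARD('n) * (\<Prod>i\<in>UNIV. 2 * L i)" by (simp add: prod.distrib)
    finally show ?thesis by (simp add: P_def)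
  qed
  then have Meq: "M \<le> half_gap * (\<Prod>i\<in>UNIV. 2 * rr * L i)" using P by (simp add: rrN)
  have A'le: "mass' \<le> measure lborel {z. s - \<Sigma> \<le> snd z \<and> snd z \<le> s \<and> 2 * half_gap \<le> w z ^ 3 / 3 * \<zeta> z} + \<delta>"
  proof -
    let ?Y = "{z. s - \<Sigma> \<le> snd z \<and> snd z \<le> s \<and> 2 * half_gap \<le> w z ^ 3 / 3 * \<zeta> z}"
    have [measurable]: "w \<in> borel_measurable borel" "\<zeta> \<in> borel_measurable borel"
      using continuity by (auto intro: borel_measurable_continuous_UNIV)
    have [measurable]: "(snd :: (real^'n) \<times> real \<Rightarrow> real) \<in> borel_measurable borel"
      by (intro borel_measurable_continuous_UNIV continuous_intros)
    have "?Y \<subseteq> closed_box y R \<times> {s - \<Sigma>..s}"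
    proof
      fix z assume z: "z \<in> ?Y"
      have "\<zeta> z \<noteq> 0" using z positivity(2) by auto
      then show "z \<in> closed_box y R \<times> {s - \<Sigma>..s}"
        using z \<zeta>(5)[of z] by (auto simp: closed_box_def mem_Times_iff less_imp_le)
    qed
    moreover have "compact (closed_box y R \<times> {s - \<Sigma>..s})" by (intro compact_Times closed_box_compact) auto
    then have "closed_box y R \<times> {s - \<Sigma>..s} \<in> fmeasurable lborel"
      by (intro fmeasurableI emeasure_compact_finite) (auto intro: borel_compact)
    moreover have "?Y \<in> sets lborel"
    proof -
      have "{z \<in> space borel. s - \<Sigma> \<le> snd z \<and> snd z \<le> s \<and> 2 * half_gap \<le> w z ^ 3 / 3 * \<zeta> z} \<in> sets borel"
        by measurable
      then show ?thesis by simp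
    qed
    ultimately have Yf: "?Y \<in> fmeasurable lborel" by (blast intro: fmeasurableI2)
    have "{z \<in> past_box y s r \<sigma>. U z < k'} \<subseteq> ?Y \<union> X"
    proof
      fix z assume z: "z \<in> {z \<in> past_box y s r \<sigma>. U z < k'}"
      have z1: "\<zeta> z = 1"
      proof (rule \<zeta>(4))
        show "\<forall>i. \<bar>fst z $ i - y $ i\<bar> \<le> r i" using z by (simp add: past_box_def less_imp_le)
        show "\<bar>snd z - s\<bar> \<le> \<sigma>" using z by (auto simp: past_box_def)
      qed
      show "z \<in> ?Y \<union> X"
      proof (cases "z \<in> X")
        case False
        then have "v z < U z + \<eta>" by (auto simp: X_def)
        moreover have "k = k' + 3 * \<eta>" by (simp add: \<eta>_def field_simps)
        ultimately have "\<eta> \<le> k - \<eta> - v z" using z by auto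
        then have "\<eta> \<le> w z" by (simp add: w_def)
        then have "\<eta> ^ 3 \<le> w z ^ 3" using \<eta> by (intro power_mono) auto
        then have "2 * half_gap \<le> w z ^ 3 / 3 * \<zeta> z" by (simp add: half_gap_def z1 flip: \<eta>_def)
        then show ?thesis using z \<sigma> by (auto simp: past_box_def)
      qed simp
    qed
    then have "mass' \<le> measure lborel (?Y \<union> X)"
      unfolding mass'_def
      by (rule measure_mono_fmeasurable[OF _ fmeasurableD[OF meas] fmeasurable.Un[OF Yf Xf]])
    also have "\<dots> \<le> measure lborel ?Y + measure lborel X"
      by (intro measure_Un_le fmeasurableD Xf Yf)
    finally show ?thesis using X\<delta> by linarith
  qed
  have "half_gap * (mass' - \<delta>) \<le> half_gap * measure lborel {z. s - \<Sigma> \<le> snd z \<and> snd z \<le> s \<and> 2 * half_gap \<le> w z ^ 3 / 3 * \<zeta> z}"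
    using A'le positivity(2) by (intro mult_left_mono) auto
  also have "\<dots> \<le> rr * (\<Sum>i\<in>UNIV. (L i * slope i * K ^ 3 / 3 + K\<^sup>2) * measure lborel Z + K * L i powr p i * M)"
    by (rule gain[OF L rr positivity(2) bM Meq])
  also have "\<dots> \<le> rr * (\<Sum>i\<in>UNIV. (L i * slope i * K ^ 3 / 3 + K\<^sup>2) * (mass + \<delta>) + K * L i powr p i * M)"
    using rr Zle L positivity(1) K
    by (intro mult_left_mono sum_mono add_right_mono) (auto simp: less_imp_le intro!: add_nonneg_nonneg)
  finally show ?thesis by (simp add: rr_def M_def P_def)
qed

text \<open>The limit \<open>\<delta> \<longlongrightarrow> 0\<close>. On the right-hand side \<open>mass\<close> occurs to the power \<open>1 + 1 / N\<close>, which drives the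
  iteration.\<close>

theorem one_step:
  "half_gap * mass' \<le> (rate * mass / (half_gap * (\<Prod>i\<in>UNIV. 2 * L i))) powr (1 / CARD('n))
    * (mass * (\<Sum>i\<in>UNIV. L i * slope i * K ^ 3 / 3 + K\<^sup>2 + K * L i powr p i * rate))"
proof -
  let ?l = "\<lambda>\<delta>. half_gap * (mass' - \<delta>)"
  let ?r = "\<lambda>\<delta>. ((rate * (mass + \<delta>) + \<delta>) / (half_gap * (\<Prod>i\<in>UNIV. 2 * L i))) powr (1 / CARD('n))
    * (\<Sum>i\<in>UNIV. (L i * slope i * K ^ 3 / 3 + K\<^sup>2) * (mass + \<delta>) + K * L i powr p i * (rate * (mass + \<delta>) + \<delta>))"
  define d where "d n = inverse (real (Suc n))" for n
  have d0: "0 < d n" for n by (simp add: d_def)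
  have d: "d \<longlonglongrightarrow> 0" unfolding d_def by (rule LIMSEQ_inverse_real_of_nat)
  have P: "0 < half_gap * (\<Prod>i\<in>UNIV. 2 * L i)"
    using positivity(2) L by (intro mult_pos_pos prod_pos) auto
  have l: "(\<lambda>n. ?l (d n)) \<longlonglongrightarrow> ?l 0" by (intro tendsto_intros d)
  have r1: "(\<lambda>n. (rate * (mass + d n) + d n) / (half_gap * (\<Prod>i\<in>UNIV. 2 * L i)))
      \<longlonglongrightarrow> (rate * (mass + 0) + 0) / (half_gap * (\<Prod>i\<in>UNIV. 2 * L i))"
    by (intro tendsto_intros d) (use P in linarith)
  have "(\<lambda>n. ((rate * (mass + d n) + d n) / (half_gap * (\<Prod>i\<in>UNIV. 2 * L i))) powr (1 / CARD('n)))
      \<longlonglongrightarrow> ((rate * (mass + 0) + 0) / (half_gap * (\<Prod>i\<in>UNIV. 2 * L i))) powr (1 / CARD('n))"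
    using P positivity(3,4) d0 less_imp_le[OF d0]
    by (intro tendsto_powr' r1 tendsto_const)
      (auto intro!: always_eventually divide_nonneg_nonneg add_nonneg_nonneg mult_nonneg_nonneg)
  then have r: "(\<lambda>n. ?r (d n)) \<longlonglongrightarrow> ?r 0" by (intro tendsto_mult tendsto_sum tendsto_add tendsto_const d)
  have "?l 0 \<le> ?r 0"
    by (rule LIMSEQ_le[OF l r]) (use approximate_gain[OF d0] in blast)
  also have "?r 0 = (rate * mass / (half_gap * (\<Prod>i\<in>UNIV. 2 * L i))) powr (1 / CARD('n))
    * (mass * (\<Sum>i\<in>UNIV. L i * slope i * K ^ 3 / 3 + K\<^sup>2 + K * L i powr p i * rate))"
    by (simp add: sum_distrib_left sum_distrib_right algebra_simps sum.distrib)
  finally show ?thesis by simp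
qed

lemmas one_step_explicit = one_step[unfolded half_gap_def rate_def mass_def mass'_def slope_def]

end

end

section \<open>The iteration\<close>

text \<open>By induction \<open>Y n\<close> decays like \<open>b ^ (- N * n)\<close>: the factor \<open>Y n powr (1 / N)\<close> then compensates \<open>b ^ n\<close>, and the
  bound on \<open>Y 0\<close> takes care of the constant.\<close>

lemma fast_geometric_convergence:
  fixes Y :: "nat \<Rightarrow> real" and C b :: real and N :: nat
  assumes N: "0 < N" and C: "0 < C" and b: "1 < b" and Y: "\<And>n. 0 \<le> Y n"
    and step: "\<And>n. Y (Suc n) \<le> C * b ^ n * Y n powr (1 / N) * Y n"
    and start: "Y 0 \<le> (1 / (C * b ^ N)) ^ N"
  shows "Y \<longlonglongrightarrow> 0"
proof -
  have root: "(x ^ N) powr (1 / N) = x" if "0 < x" for x :: real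
    using that N by (simp add: powr_powr flip: powr_realpow)
  have bound: "Y n \<le> Y 0 / (b ^ N) ^ n" for n
  proof (induction n)
    case (Suc n)
    have "Y n powr (1 / N) \<le> ((1 / (C * b ^ N)) ^ N / (b ^ N) ^ n) powr (1 / N)"
      using order_trans[OF Suc divide_right_mono[OF start]] Y[of n] b by (intro powr_mono2) auto
    also have "(1 / (C * b ^ N)) ^ N / (b ^ N) ^ n = (1 / (C * b ^ N) / b ^ n) ^ N"
    proof -
      have "(b ^ N) ^ n = (b ^ n) ^ N" by (simp add: power_mult[symmetric] mult.commute)
      then show ?thesis by (simp only: power_divide)
    qed
    also have "\<dots> powr (1 / N) = 1 / (C * b ^ N) / b ^ n"
      using C b by (intro root) auto
    finally have "C * b ^ n * Y n powr (1 / N) \<le> C * b ^ n * (1 / (C * b ^ N) / b ^ n)"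
      using C b by (intro mult_left_mono) auto
    also have "\<dots> = 1 / b ^ N" using C b by (simp add: field_simps)
    finally have "C * b ^ n * Y n powr (1 / N) * Y n \<le> 1 / b ^ N * Y n"
      using Y[of n] by (intro mult_right_mono) auto
    also have "\<dots> \<le> 1 / b ^ N * (Y 0 / (b ^ N) ^ n)"
      using Suc b by (intro mult_left_mono) auto
    finally show ?case using step[of n] by simp
  qed simp
  have "(\<lambda>n. Y 0 * inverse (b ^ N) ^ n) \<longlonglongrightarrow> Y 0 * 0"
    using b N by (intro tendsto_mult_left LIMSEQ_realpow_zero) (auto simp: inverse_less_1_iff one_less_power)
  then have lim: "(\<lambda>n. Y 0 / (b ^ N) ^ n) \<longlonglongrightarrow> 0"
    by (simp add: divide_inverse power_inverse)
  show ?thesis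
    by (rule tendsto_sandwich[OF _ _ tendsto_const lim]) (auto intro!: always_eventually Y bound)
qed

lemma measurable_sublevel:
  fixes U :: "(real^'n::finite) \<times> real \<Rightarrow> real"
  assumes "integrable lborel U"
  shows "{z \<in> past_box y s r \<sigma>. U z < t} \<in> fmeasurable lborel"
proof (rule fmeasurableI2[OF past_box_fmeasurable[of y s r \<sigma>]])
  have [measurable]: "U \<in> borel_measurable borel" using borel_measurable_integrable[OF assms] by simp
  have "{z \<in> space borel. U z < t} \<in> sets borel" by measurable
  then have "past_box y s r \<sigma> \<inter> {z. U z < t} \<in> sets borel"
    using past_box_measurable[of y s r \<sigma>] by (intro sets.Int) auto
  then show "{z \<in> past_box y s r \<sigma>. U z < t} \<in> sets lborel" by (simp add: Int_def)
qed auto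

text \<open>The assumption \<open>r i powr p i = \<theta> i * \<tau>\<close> is the intrinsic scaling. It makes all terms of \<open>one_step\<close>
  homogeneous, so that \<open>\<tau>\<close> and the \<open>r i\<close> cancel once the measures are divided by \<open>\<tau> * (\<Prod>i\<in>UNIV. 2 * r i)\<close>.\<close>

theorem de_giorgi_iteration:
  fixes p \<gamma> \<theta> :: "'n::finite \<Rightarrow> real" and \<gamma>0 K a :: real
  assumes p: "\<And>i. 2 < p i" and \<gamma>: "\<And>i. 0 < \<gamma> i" and \<gamma>0: "0 < \<gamma>0" and \<theta>: "\<And>i. 0 < \<theta> i"
    and K: "0 < K" and a: "a < 1"
  shows "\<exists>\<nu>>0. \<forall>U G y s r \<tau> m.
    mollified_supersolution p U G y s (\<lambda>i. r i * (1 + \<gamma> i)) (\<tau> * (1 + \<gamma>0)) m \<longrightarrow>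
    0 < \<tau> \<longrightarrow> (\<forall>i. 0 < r i \<and> r i powr p i = \<theta> i * \<tau>) \<longrightarrow>
    measure lborel {z \<in> past_box y s (\<lambda>i. r i * (1 + \<gamma> i)) (\<tau> * (1 + \<gamma>0)). U z < m + K}
      \<le> \<nu> * (\<tau> * (\<Prod>i\<in>UNIV. 2 * r i)) \<longrightarrow>
    measure lborel {z \<in> past_box y s r \<tau>. U z < m + a * K} = 0"
proof -
  obtain q :: nat where "Max (range p) \<le> real q" using real_arch_simple by blast
  then have q: "p i \<le> real q" for i by (meson Max_ge UNIV_I finite finite_imageI image_eqI order_trans)
  have q2: "2 < real q" using p[of undefined] q[of undefined] by linarith
  define h where "h = (K * (1 - a) / 6) ^ 3 / 6"
  define Ra where "Ra = K ^ 3 / 3 * (8 * real q / \<gamma>0) + (\<Sum>i\<in>UNIV. K * ((8 * real q * K / \<gamma> i) powr p i / \<theta> i))"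
  define Sb where "Sb = (\<Sum>i\<in>UNIV. 8 * real q / \<gamma> i * K ^ 3 / 3 + K\<^sup>2 + K * \<theta> i * Ra)"
  define B where "B = (2::real) ^ q"
  define C where "C = Sb / h * (Ra / h) powr (1 / CARD('n))"
  define b where "b = (8 * B)\<^sup>2"
  have B1: "1 \<le> B" by (simp add: B_def)
  have h: "0 < h" using K a by (simp add: h_def)
  have Ra: "0 < Ra" unfolding Ra_def using K q2 \<gamma>0 \<theta>
    by (intro add_pos_nonneg sum_nonneg mult_nonneg_nonneg divide_nonneg_nonneg) (auto simp: less_imp_le)
  have Sb: "0 < Sb" unfolding Sb_def using K q2 \<gamma> \<theta> Ra
    by (intro sum_pos add_pos_pos mult_pos_pos divide_pos_pos) auto
  have C: "0 < C" using Sb h Ra by (simp add: C_def)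
  have "1 < 8 * B" using B1 by linarith
  then have b: "1 < b" unfolding b_def by (rule one_less_power) simp
  define \<nu> where "\<nu> = (1 / (C * b ^ CARD('n))) ^ CARD('n)"
  have "0 < \<nu>" using C b by (simp add: \<nu>_def)
  moreover have "measure lborel {z \<in> past_box y s r \<tau>. U z < m + a * K} = 0"
    if mol: "mollified_supersolution p U G y s (\<lambda>i. r i * (1 + \<gamma> i)) (\<tau> * (1 + \<gamma>0)) m"
      and \<tau>: "0 < \<tau>" and r: "\<forall>i. 0 < r i \<and> r i powr p i = \<theta> i * \<tau>"
      and init: "measure lborel {z \<in> past_box y s (\<lambda>i. r i * (1 + \<gamma> i)) (\<tau> * (1 + \<gamma>0)). U z < m + K}
        \<le> \<nu> * (\<tau> * (\<Prod>i\<in>UNIV. 2 * r i))"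
    for U G and y :: "real^'n" and s r \<tau> m
  proof -
    have r0: "0 < r i" and rp: "r i powr p i = \<theta> i * \<tau>" for i using r by auto
    have iU: "integrable lborel U" by (rule mollified_supersolution.iU[OF mol])
    \<comment> \<open>half of the gap is left open at \<open>n = 0\<close>, since a step needs some room for mollification\<close>
    define R where "R n i = r i * (1 + \<gamma> i * (1 / 2) ^ Suc n)" for n i
    define \<Sigma> where "\<Sigma> n = \<tau> * (1 + \<gamma>0 * (1 / 2) ^ Suc n)" for n
    define k where "k n = m + K * (a + (1 - a) * (1 / 2) ^ n)" for n
    define A where "A n = measure lborel {z \<in> past_box y s (R n) (\<Sigma> n). U z < k n}" for n
    define V where "V = \<tau> * (\<Prod>i\<in>UNIV. 2 * r i)"
    define Y where "Y n = A n / V" for n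
    have V: "0 < V" unfolding V_def using \<tau> r0 by (intro mult_pos_pos prod_pos) auto
    have A0: "0 \<le> A n" for n by (simp add: A_def)
    have Y0: "0 \<le> Y n" for n using A0 V by (simp add: Y_def)
    have half: "(1 / 2 :: real) ^ Suc n < 1" for n by (rule power_Suc_less_one) simp_all
    have step: "Y (Suc n) \<le> C * b ^ n * Y n powr (1 / CARD('n)) * Y n" for n
    proof -
      have dR: "R n i - R (Suc n) i = r i * \<gamma> i / (4 * 2 ^ n)" for i
        by (simp add: R_def power_one_over field_simps)
      have d\<Sigma>: "\<Sigma> n - \<Sigma> (Suc n) = \<tau> * \<gamma>0 / (4 * 2 ^ n)"
        by (simp add: \<Sigma>_def power_one_over field_simps)
      have dk: "k n - k (Suc n) = K * (1 - a) / (2 * 2 ^ n)"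
        by (simp add: k_def power_one_over field_simps)
      have gap: "((k n - k (Suc n)) / 3) ^ 3 / 6 = h / 8 ^ n"
      proof -
        have "(8::real) ^ n = (2 ^ 3) ^ n" by simp
        also have "\<dots> = (2 ^ n) ^ 3" by (simp only: power_mult[symmetric] mult.commute)
        finally have "(8::real) ^ n = (2 ^ n) ^ 3" .
        then show ?thesis by (simp add: dk h_def power_divide power_mult_distrib)
      qed
      have slope: "2 * real q / (R n i - R (Suc n) i) = 8 * real q * 2 ^ n / (\<gamma> i * r i)" for i
        unfolding dR using r0[of i] \<gamma>[of i] by (simp add: field_simps)
      have slope0: "2 * real q / (\<Sigma> n - \<Sigma> (Suc n)) = 8 * real q * 2 ^ n / (\<gamma>0 * \<tau>)"
        unfolding d\<Sigma> using \<tau> \<gamma>0 by (simp add: field_simps)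
      define rate where "rate = K ^ 3 / 3 * (8 * real q * 2 ^ n / (\<gamma>0 * \<tau>))
        + (\<Sum>i\<in>UNIV. K * (K * (8 * real q * 2 ^ n / (\<gamma> i * r i))) powr p i)"
      define S where "S = (\<Sum>i\<in>UNIV. r i * (8 * real q * 2 ^ n / (\<gamma> i * r i)) * K ^ 3 / 3 + K\<^sup>2 + K * r i powr p i * rate)"
      have one: "h / 8 ^ n * A (Suc n) \<le> (rate * A n / (h / 8 ^ n * (\<Prod>i\<in>UNIV. 2 * r i))) powr (1 / CARD('n)) * (A n * S)"
      proof -
        have "((k n - k (Suc n)) / 3) ^ 3 / 6 * A (Suc n) \<le> ((K ^ 3 / 3 * (2 * real q / (\<Sigma> n - \<Sigma> (Suc n)))
          + (\<Sum>i\<in>UNIV. K * (K * (2 * real q / (R n i - R (Suc n) i))) powr p i)) * A n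
          / (((k n - k (Suc n)) / 3) ^ 3 / 6 * (\<Prod>i\<in>UNIV. 2 * r i))) powr (1 / CARD('n))
          * (A n * (\<Sum>i\<in>UNIV. r i * (2 * real q / (R n i - R (Suc n) i)) * K ^ 3 / 3 + K\<^sup>2
             + K * r i powr p i * (K ^ 3 / 3 * (2 * real q / (\<Sigma> n - \<Sigma> (Suc n)))
          + (\<Sum>i\<in>UNIV. K * (K * (2 * real q / (R n i - R (Suc n) i))) powr p i))))"
          unfolding A_def
        proof (rule mollified_supersolution.one_step_explicit[OF mol])
          show "0 < R (Suc n) i" for i using r0[of i] \<gamma>[of i]
            by (auto simp: R_def intro!: mult_pos_pos add_pos_nonneg)
          show "R (Suc n) i < R n i" for i using dR[of i] r0[of i] \<gamma>[of i]
            by (smt (verit) divide_pos_pos mult_pos_pos zero_less_power)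
          show "R n i < r i * (1 + \<gamma> i)" for i using r0[of i] \<gamma>[of i] half[of n] by (simp add: R_def del: power_Suc)
          show "0 < \<Sigma> (Suc n)" using \<tau> \<gamma>0 by (auto simp: \<Sigma>_def intro!: mult_pos_pos add_pos_nonneg)
          show "\<Sigma> (Suc n) < \<Sigma> n" using d\<Sigma> \<tau> \<gamma>0 by (smt (verit) divide_pos_pos mult_pos_pos zero_less_power)
          show "\<Sigma> n < \<tau> * (1 + \<gamma>0)" using \<tau> \<gamma>0 half[of n] by (simp add: \<Sigma>_def del: power_Suc)
          have "0 < k n - k (Suc n)" unfolding dk using K a by simp
          then show "k (Suc n) < k n" by simp
          have "a + (1 - a) * (1 / 2) ^ n \<le> a + (1 - a) * 1"
            using a by (intro add_left_mono mult_left_mono power_le_one) auto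
          then have "K * (a + (1 - a) * (1 / 2) ^ n) \<le> K * 1" using K by (intro mult_left_mono) auto
          then show "k n - m \<le> K" by (simp add: k_def)
        qed (use K q r0 in auto)
        then show ?thesis unfolding gap slope slope0 rate_def S_def .
      qed
      have two: "(2::real) ^ n \<le> B ^ n" using q2 B1 unfolding B_def
        by (intro power_mono self_le_power) auto
      have "8 * real q * 2 ^ n / (\<gamma>0 * \<tau>) \<le> 8 * real q * B ^ n / (\<gamma>0 * \<tau>)"
        using two \<gamma>0 \<tau> by (intro divide_right_mono mult_left_mono) auto
      from mult_left_mono[OF this, of "K ^ 3 / 3"] have r1: "K ^ 3 / 3 * (8 * real q * 2 ^ n / (\<gamma>0 * \<tau>)) \<le> B ^ n / \<tau> * (K ^ 3 / 3 * (8 * real q / \<gamma>0))"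
        using K by (simp add: mult_ac)
      have r2: "K * (K * (8 * real q * 2 ^ n / (\<gamma> i * r i))) powr p i
        \<le> B ^ n / \<tau> * (K * ((8 * real q * K / \<gamma> i) powr p i / \<theta> i))" for i
      proof -
        have "(2 ^ n) powr p i \<le> (2 ^ n) powr real q" by (intro powr_mono q) auto
        also have "\<dots> = (2 ^ n) ^ q" by (rule powr_realpow) simp
        also have "\<dots> = B ^ n" by (simp only: B_def power_mult[symmetric] mult.commute)
        finally have B2: "(2 ^ n) powr p i \<le> B ^ n" .
        have "(K * (8 * real q * 2 ^ n / (\<gamma> i * r i))) powr p i = ((8 * real q * K / \<gamma> i) * 2 ^ n / r i) powr p i"
          by (simp add: mult_ac)
        also have "\<dots> = (8 * real q * K / \<gamma> i) powr p i * (2 ^ n) powr p i / (\<theta> i * \<tau>)"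
          using K \<gamma>[of i] r0[of i] by (simp add: powr_divide powr_mult rp)
        also have "\<dots> \<le> (8 * real q * K / \<gamma> i) powr p i * B ^ n / (\<theta> i * \<tau>)"
          using B2 \<theta>[of i] \<tau> by (intro divide_right_mono mult_left_mono) auto
        finally have "K * (K * (8 * real q * 2 ^ n / (\<gamma> i * r i))) powr p i
          \<le> K * ((8 * real q * K / \<gamma> i) powr p i * B ^ n / (\<theta> i * \<tau>))"
          using K by (intro mult_left_mono) auto
        then show ?thesis by (simp add: mult_ac)
      qed
      have rate_le: "rate \<le> B ^ n / \<tau> * Ra"
        unfolding rate_def Ra_def distrib_left sum_distrib_left by (intro add_mono r1 sum_mono r2)
      have rate0: "0 \<le> rate" unfolding rate_def using K q2 \<gamma>0 \<tau>
        by (intro add_nonneg_nonneg sum_nonneg mult_nonneg_nonneg) auto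
      have Bn: "1 \<le> B ^ n" using B1 by (rule one_le_power)
      have S_le: "S \<le> B ^ n * Sb"
        unfolding S_def Sb_def sum_distrib_left
      proof (rule sum_mono)
        fix i
        have "r i * (8 * real q * 2 ^ n / (\<gamma> i * r i)) * K ^ 3 / 3 = 2 ^ n * (8 * real q / \<gamma> i * K ^ 3 / 3)"
          using r0[of i] by simp
        also have "\<dots> \<le> B ^ n * (8 * real q / \<gamma> i * K ^ 3 / 3)"
          using two K \<gamma>[of i] by (intro mult_right_mono) (auto intro!: mult_nonneg_nonneg divide_nonneg_nonneg)
        finally have s1: "r i * (8 * real q * 2 ^ n / (\<gamma> i * r i)) * K ^ 3 / 3 \<le> B ^ n * (8 * real q / \<gamma> i * K ^ 3 / 3)" .
        have s2: "K\<^sup>2 \<le> B ^ n * K\<^sup>2" using mult_right_mono[OF Bn, of "K\<^sup>2"] by simp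
        have "K * r i powr p i * rate \<le> K * r i powr p i * (B ^ n / \<tau> * Ra)"
          using K by (intro mult_left_mono rate_le) auto
        also have "\<dots> = B ^ n * (K * \<theta> i * Ra)" using \<tau> by (simp add: rp)
        finally have s3: "K * r i powr p i * rate \<le> B ^ n * (K * \<theta> i * Ra)" .
        show "r i * (8 * real q * 2 ^ n / (\<gamma> i * r i)) * K ^ 3 / 3 + K\<^sup>2 + K * r i powr p i * rate
          \<le> B ^ n * (8 * real q / \<gamma> i * K ^ 3 / 3 + K\<^sup>2 + K * \<theta> i * Ra)"
          unfolding distrib_left by (intro add_mono s1 s2 s3)
      qed
      have arg: "rate * A n / (h / 8 ^ n * (\<Prod>i\<in>UNIV. 2 * r i)) \<le> (8 * B) ^ n * (Ra / h) * Y n"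
      proof -
        have P: "0 < (\<Prod>i\<in>UNIV. 2 * r i)" using r0 by (intro prod_pos) auto
        have "rate * A n / (h / 8 ^ n * (\<Prod>i\<in>UNIV. 2 * r i))
          \<le> (B ^ n / \<tau> * Ra) * A n / (h / 8 ^ n * (\<Prod>i\<in>UNIV. 2 * r i))"
          using h P A0 rate_le by (intro divide_right_mono mult_right_mono) auto
        also have "\<dots> = (8 * B) ^ n * (Ra / h) * Y n"
          using \<tau> h P by (simp add: Y_def V_def power_mult_distrib field_simps)
        finally show ?thesis .
      qed
      have pw: "(rate * A n / (h / 8 ^ n * (\<Prod>i\<in>UNIV. 2 * r i))) powr (1 / CARD('n))
        \<le> (8 * B) ^ n * (Ra / h) powr (1 / CARD('n)) * Y n powr (1 / CARD('n))"
      proof -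
        have P: "0 \<le> (\<Prod>i\<in>UNIV. 2 * r i)" using r0 by (intro prod_nonneg) (auto simp: less_imp_le)
        have "(rate * A n / (h / 8 ^ n * (\<Prod>i\<in>UNIV. 2 * r i))) powr (1 / CARD('n))
          \<le> ((8 * B) ^ n * (Ra / h) * Y n) powr (1 / CARD('n))"
          using arg rate0 A0[of n] h P by (intro powr_mono2) auto
        also have "\<dots> = ((8 * B) ^ n) powr (1 / CARD('n)) * (Ra / h) powr (1 / CARD('n)) * Y n powr (1 / CARD('n))"
          by (simp only: powr_mult)
        also have "\<dots> \<le> (8 * B) ^ n * (Ra / h) powr (1 / CARD('n)) * Y n powr (1 / CARD('n))"
        proof (intro mult_right_mono)
          have "((8 * B) ^ n) powr (1 / CARD('n)) \<le> ((8 * B) ^ n) powr 1"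
            using B1 by (intro powr_mono one_le_power) auto
          then show "((8 * B) ^ n) powr (1 / CARD('n)) \<le> (8 * B) ^ n" using B1 by simp
        qed auto
        finally show ?thesis .
      qed
      have "h / 8 ^ n * A (Suc n) \<le> ((8 * B) ^ n * (Ra / h) powr (1 / CARD('n)) * Y n powr (1 / CARD('n))) * (A n * (B ^ n * Sb))"
        using B1 Ra h less_imp_le[OF \<gamma>] less_imp_le[OF r0] by (intro order_trans[OF one] mult_mono pw mult_left_mono S_le A0 mult_nonneg_nonneg)
          (auto simp: S_def less_imp_le K intro!: sum_nonneg add_nonneg_nonneg mult_nonneg_nonneg divide_nonneg_nonneg rate0 \<gamma> r0)
      then have "8 ^ n / h * (h / 8 ^ n * A (Suc n)) \<le> 8 ^ n / h * (((8 * B) ^ n * (Ra / h) powr (1 / CARD('n)) * Y n powr (1 / CARD('n))) * (A n * (B ^ n * Sb)))"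
        using h by (intro mult_left_mono) auto
      also have "8 ^ n / h * (h / 8 ^ n * A (Suc n)) = A (Suc n)" using h by simp
      also have "8 ^ n / h * (((8 * B) ^ n * (Ra / h) powr (1 / CARD('n)) * Y n powr (1 / CARD('n))) * (A n * (B ^ n * Sb)))
        = C * b ^ n * Y n powr (1 / CARD('n)) * A n"
        using power_mult_distrib[of "8::real" 8 n]
        by (simp add: C_def b_def power_mult_distrib power2_eq_square mult_ac)
      finally have "A (Suc n) / V \<le> C * b ^ n * Y n powr (1 / CARD('n)) * A n / V"
        using V by (intro divide_right_mono) auto
      then show ?thesis by (simp add: Y_def)
    qed
    have start: "Y 0 \<le> (1 / (C * b ^ CARD('n))) ^ CARD('n)"
    proof -
      have "A 0 \<le> measure lborel {z \<in> past_box y s (\<lambda>i. r i * (1 + \<gamma> i)) (\<tau> * (1 + \<gamma>0)). U z < m + K}"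
        unfolding A_def
      proof (rule measure_mono_fmeasurable[OF _ fmeasurableD[OF measurable_sublevel[OF iU]] measurable_sublevel[OF iU]])
        have "R 0 i \<le> r i * (1 + \<gamma> i)" for i using r0[of i] \<gamma>[of i] by (simp add: R_def)
        moreover have "\<Sigma> 0 \<le> \<tau> * (1 + \<gamma>0)" using \<tau> \<gamma>0 by (simp add: \<Sigma>_def)
        moreover have "k 0 = m + K" by (simp add: k_def)
        ultimately show "{z \<in> past_box y s (R 0) (\<Sigma> 0). U z < k 0}
          \<subseteq> {z \<in> past_box y s (\<lambda>i. r i * (1 + \<gamma> i)) (\<tau> * (1 + \<gamma>0)). U z < m + K}"
          by (fastforce simp: past_box_def intro: less_le_trans)
      qed
      then have "A 0 \<le> \<nu> * V" using init by (simp add: V_def)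
      then show ?thesis using V by (simp add: Y_def \<nu>_def field_simps)
    qed
    have "Y \<longlonglongrightarrow> 0"
      by (rule fast_geometric_convergence[OF _ C b Y0 step start]) simp
    moreover have "measure lborel {z \<in> past_box y s r \<tau>. U z < m + a * K} / V \<le> Y n" for n
      unfolding Y_def A_def
    proof (intro divide_right_mono measure_mono_fmeasurable[OF _ fmeasurableD[OF measurable_sublevel[OF iU]] measurable_sublevel[OF iU]])
      have "r i \<le> R n i" for i using r0[of i] \<gamma>[of i] by (simp add: R_def)
      moreover have "\<tau> \<le> \<Sigma> n" using \<tau> \<gamma>0 by (simp add: \<Sigma>_def)
      moreover have "m + a * K \<le> k n" using K a by (simp add: k_def algebra_simps)
      ultimately show "{z \<in> past_box y s r \<tau>. U z < m + a * K} \<subseteq> {z \<in> past_box y s (R n) (\<Sigma> n). U z < k n}"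
        by (fastforce simp: past_box_def intro: less_le_trans)
    qed (use V in auto)
    ultimately have "measure lborel {z \<in> past_box y s r \<tau>. U z < m + a * K} / V \<le> 0"
      by (intro LIMSEQ_le_const) auto
    then show ?thesis using V by (simp add: divide_le_0_iff measure_le_0_iff)
  qed
  ultimately show ?thesis by blast
qed

section \<open>The critical mass lemma\<close>

definition half_width :: "('n::finite \<Rightarrow> real) \<Rightarrow> real \<Rightarrow> real \<Rightarrow> 'n \<Rightarrow> real" where
  "half_width p M \<rho> i = M powr ((p i - 2) / p i) * \<rho> powr (harm_mean p / p i)"

lemma translate_cyl_minus:
  "(+) (y, s) ` cyl_minus p M \<rho> = past_box y s (half_width p M \<rho>) (\<rho> powr harm_mean p)"
proof (intro equalityI subsetI)
  fix z assume "z \<in> past_box y s (half_width p M \<rho>) (\<rho> powr harm_mean p)"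
  then have "(fst z - y, snd z - s) \<in> cyl_minus p M \<rho>"
    by (auto simp: past_box_def cyl_minus_def cyl_base_def half_width_def)
  moreover have "z = (y, s) + (fst z - y, snd z - s)" by (simp add: prod_eq_iff)
  ultimately show "z \<in> (+) (y, s) ` cyl_minus p M \<rho>" by (rule rev_image_eqI)
qed (auto simp: past_box_def cyl_minus_def cyl_base_def half_width_def)

lemma translate_cyl_full:
  "(+) (y, s) ` cyl_full p M \<rho> = {z. (\<forall>i. \<bar>fst z $ i - y $ i\<bar> < half_width p M \<rho> i) \<and>
     s - \<rho> powr harm_mean p < snd z \<and> snd z \<le> s + \<rho> powr harm_mean p}"
proof (intro equalityI subsetI)
  fix z assume "z \<in> {z. (\<forall>i. \<bar>fst z $ i - y $ i\<bar> < half_width p M \<rho> i) \<and>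
     s - \<rho> powr harm_mean p < snd z \<and> snd z \<le> s + \<rho> powr harm_mean p}"
  then have "(fst z - y, snd z - s) \<in> cyl_full p M \<rho>"
    by (auto simp: cyl_full_def cyl_base_def half_width_def)
  moreover have "z = (y, s) + (fst z - y, snd z - s)" by (simp add: prod_eq_iff)
  ultimately show "z \<in> (+) (y, s) ` cyl_full p M \<rho>" by (rule rev_image_eqI)
qed (auto simp: cyl_full_def cyl_base_def half_width_def)

lemma measure_cyl_minus_le:
  fixes p :: "'n::finite \<Rightarrow> real"
  assumes "\<And>i. 0 \<le> half_width p M \<rho> i"
  shows "measure lebesgue (cyl_minus p M \<rho>) \<le> \<rho> powr harm_mean p * (\<Prod>i\<in>UNIV. 2 * half_width p M \<rho> i)"
proof -
  let ?w = "half_width p M \<rho>" and ?\<tau> = "\<rho> powr harm_mean p"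
  let ?B = "cbox (\<chi> i. - ?w i) (\<chi> i. ?w i) :: (real^'n) set" and ?J = "{- ?\<tau>..0}"
  have sub: "cyl_minus p M \<rho> \<subseteq> ?B \<times> ?J"
    by (auto simp: cyl_minus_def cyl_base_def half_width_def mem_box_cart abs_less_iff less_imp_le minus_less_iff)
  have ne: "?B \<noteq> {}" using assms by (auto simp: interval_ne_empty_cart intro: order_trans[of _ 0])
  have eq: "emeasure lborel (?B \<times> ?J) = ennreal (?\<tau> * (\<Prod>i\<in>UNIV. 2 * ?w i))"
  proof -
    have "measure lborel ?B = (\<Prod>i\<in>UNIV. 2 * ?w i)"
      by (simp add: content_cbox_cart[OF ne])
    then have B: "emeasure lborel ?B = ennreal (\<Prod>i\<in>UNIV. 2 * ?w i)"
      using emeasure_lborel_cbox_finite[of "\<chi> i. - ?w i" "\<chi> i. ?w i"]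
      by (simp add: emeasure_eq_ennreal_measure)
    have "emeasure lborel (?B \<times> ?J) = emeasure (lborel \<Otimes>\<^sub>M lborel) (?B \<times> ?J)" by (simp add: lborel_prod)
    also have "\<dots> = emeasure lborel ?B * emeasure lborel ?J"
      by (rule lborel.emeasure_pair_measure_Times) auto
    also have "\<dots> = ennreal (?\<tau> * (\<Prod>i\<in>UNIV. 2 * ?w i))"
      using assms by (simp add: B ennreal_mult prod_nonneg mult.commute)
    finally show ?thesis .
  qed
  have BJ: "?B \<times> ?J \<in> sets lborel" by (auto intro!: borel_closed closed_Times)
  have 0: "0 \<le> ?\<tau> * (\<Prod>i\<in>UNIV. 2 * ?w i)" using assms by (intro mult_nonneg_nonneg prod_nonneg) auto
  have "emeasure lebesgue (cyl_minus p M \<rho>) \<le> emeasure lebesgue (?B \<times> ?J)"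
    using BJ sub by (intro emeasure_mono) auto
  also have "\<dots> = ennreal (?\<tau> * (\<Prod>i\<in>UNIV. 2 * ?w i))" using eq BJ by (simp add: emeasure_completion)
  finally show ?thesis using 0 by (simp add: measure_def enn2real_leI)
qed

text \<open>The iteration is applied to a compact cylinder strictly between the inner and the outer one. The
  half-way factors \<open>1 + \<gamma> i\<close> depend only on the exponents, and so does the ratio \<open>\<kappa>\<close> between the measure of
  the outer cylinder and the normalisation of the iteration.\<close>

theorem critical_mass_supersolution:
  fixes p :: "'n::finite \<Rightarrow> real" and \<theta> K a :: real
  assumes p: "\<And>i. 2 < p i" and \<theta>: "0 < \<theta>" and K: "0 < K" and a: "a < 1"
  shows "\<exists>\<nu>. 0 < \<nu> \<and> \<nu> < 1 \<and> (\<forall>(\<Omega> :: (real^'n) set) T u y s \<rho> m.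
    0 < \<rho> \<longrightarrow> compactly_contained ((+) (y, s) ` cyl_full p \<theta> (2 * \<rho>)) (spacetime \<Omega> T) \<longrightarrow>
    local_weak_supersolution p \<Omega> T u \<longrightarrow>
    (AE z in lebesgue. z \<in> (+) (y, s) ` cyl_full p \<theta> (2 * \<rho>) \<longrightarrow> m \<le> u z) \<longrightarrow>
    measure lebesgue ({z. u z \<le> m + K} \<inter> (+) (y, s) ` cyl_minus p \<theta> (2 * \<rho>))
      \<le> \<nu> * measure lebesgue (cyl_minus p \<theta> (2 * \<rho>)) \<longrightarrow>
    (AE z in lebesgue. z \<in> (+) (y, s) ` cyl_minus p \<theta> \<rho> \<longrightarrow> m + a * K \<le> u z))"
proof -
  define P where "P = harm_mean p"
  have p0: "0 < p i" for i using p[of i] by linarith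
  have P: "0 < P" unfolding P_def harm_mean_def using p0
    by (intro divide_pos_pos sum_pos) auto
  \<comment> \<open>doubling the radius multiplies the half-widths by \<open>2 powr (P / p i)\<close>; this is the middle\<close>
  define \<gamma> where "\<gamma> i = (2 powr (P / p i) - 1) / 2" for i
  define \<gamma>0 where "\<gamma>0 = (2 powr P - 1) / 2"
  have g1: "1 < 2 powr (P / p i)" for i using P p0[of i] by (intro gr_one_powr) auto
  have g2: "1 < 2 powr P" using P by (intro gr_one_powr) auto
  have \<gamma>: "0 < \<gamma> i" "1 + \<gamma> i < 2 powr (P / p i)" for i using g1[of i] by (auto simp: \<gamma>_def field_simps)
  have \<gamma>0: "0 < \<gamma>0" "1 + \<gamma>0 < 2 powr P" using g2 by (auto simp: \<gamma>0_def field_simps)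
  define \<Theta> where "\<Theta> i = \<theta> powr (p i - 2)" for i
  have \<Theta>: "0 < \<Theta> i" for i using \<theta> by (simp add: \<Theta>_def)
  obtain \<nu>0 where \<nu>0: "0 < \<nu>0" and iteration: "\<forall>U G y s r \<tau> m.
    mollified_supersolution p U G y s (\<lambda>i. r i * (1 + \<gamma> i)) (\<tau> * (1 + \<gamma>0)) m \<longrightarrow>
    0 < \<tau> \<longrightarrow> (\<forall>i. 0 < r i \<and> r i powr p i = \<Theta> i * \<tau>) \<longrightarrow>
    measure lborel {z \<in> past_box y s (\<lambda>i. r i * (1 + \<gamma> i)) (\<tau> * (1 + \<gamma>0)). U z < m + K}
      \<le> \<nu>0 * (\<tau> * (\<Prod>i\<in>UNIV. 2 * r i)) \<longrightarrow>
    measure lborel {z \<in> past_box y s r \<tau>. U z < m + a * K} = 0"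
    using de_giorgi_iteration[where p=p and \<gamma>=\<gamma> and \<theta>=\<Theta>, OF p \<gamma>(1) \<gamma>0(1) \<Theta> K a]
    by (elim exE conjE) (rule that)
  define \<kappa> where "\<kappa> = 2 powr P * (\<Prod>i\<in>UNIV. 2 powr (P / p i))"
  have \<kappa>: "0 < \<kappa>" unfolding \<kappa>_def by (intro mult_pos_pos prod_pos) auto
  define \<nu> where "\<nu> = min (1 / 2) (\<nu>0 / \<kappa>)"
  have \<nu>: "0 < \<nu>" "\<nu> < 1" "\<nu> * \<kappa> \<le> \<nu>0" using \<nu>0 \<kappa> by (auto simp: \<nu>_def min_def field_simps)
  show ?thesis
  proof (intro exI[of _ \<nu>] conjI \<nu>(1,2) allI impI)
    fix \<Omega> :: "(real^'n) set" and T u y s \<rho> m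
    assume \<rho>: "0 < \<rho>"
      and cc: "compactly_contained ((+) (y, s) ` cyl_full p \<theta> (2 * \<rho>)) (spacetime \<Omega> T)"
      and super: "local_weak_supersolution p \<Omega> T u"
      and lower: "AE z in lebesgue. z \<in> (+) (y, s) ` cyl_full p \<theta> (2 * \<rho>) \<longrightarrow> m \<le> u z"
      and small: "measure lebesgue ({z. u z \<le> m + K} \<inter> (+) (y, s) ` cyl_minus p \<theta> (2 * \<rho>))
        \<le> \<nu> * measure lebesgue (cyl_minus p \<theta> (2 * \<rho>))"
    define r where "r = half_width p \<theta> \<rho>"
    define \<tau> where "\<tau> = \<rho> powr P"
    define R where "R i = r i * (1 + \<gamma> i)" for i
    define \<Sigma> where "\<Sigma> = \<tau> * (1 + \<gamma>0)"
    have r0: "0 < r i" for i using \<theta> \<rho> by (simp add: r_def half_width_def)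
    have \<tau>0: "0 < \<tau>" using \<rho> by (simp add: \<tau>_def)
    have double: "half_width p \<theta> (2 * \<rho>) i = r i * 2 powr (P / p i)" "(2 * \<rho>) powr P = \<tau> * 2 powr P" for i
      by (simp_all add: half_width_def r_def P_def \<tau>_def powr_mult)
    have R: "0 < R i" "R i < half_width p \<theta> (2 * \<rho>) i" for i
      using r0[of i] \<gamma>[of i] by (simp_all add: R_def double)
    have \<Sigma>: "0 < \<Sigma>" "\<Sigma> < (2 * \<rho>) powr P" using \<tau>0 \<gamma>0 by (simp_all add: \<Sigma>_def double)
    have rp: "r i powr p i = \<Theta> i * \<tau>" for i
      using p0[of i] by (simp add: r_def half_width_def \<Theta>_def \<tau>_def powr_mult powr_powr P_def)
    have boxsub: "closed_box y R \<times> {s - \<Sigma>..s + \<Sigma>} \<subseteq> (+) (y, s) ` cyl_full p \<theta> (2 * \<rho>)"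
    proof
      fix z assume z: "z \<in> closed_box y R \<times> {s - \<Sigma>..s + \<Sigma>}"
      then have "\<bar>fst z $ i - y $ i\<bar> < half_width p \<theta> (2 * \<rho>) i" for i
        by (intro le_less_trans[OF _ R(2)]) (auto simp: closed_box_def)
      then show "z \<in> (+) (y, s) ` cyl_full p \<theta> (2 * \<rho>)"
        unfolding translate_cyl_full using z \<Sigma>(2) by (auto simp: P_def)
    qed
    also have "\<dots> \<subseteq> spacetime \<Omega> T"
      using cc closure_subset unfolding compactly_contained_def by blast
    finally have sub: "closed_box y R \<times> {s - \<Sigma>..s + \<Sigma>} \<subseteq> \<Omega> \<times> {-T<..<T}" by (simp add: spacetime_def)
    have y: "y \<in> closed_box y R" using R(1) by (simp add: closed_box_def less_imp_le)
    then have K0: "closed_box y R \<subseteq> \<Omega>" and I0: "{s - \<Sigma>..s + \<Sigma>} \<subseteq> {-T<..<T}"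
      using sub \<Sigma>(1) by (auto simp: times_subset_iff)
    have low: "AE z in lborel. z \<in> closed_box y R \<times> {s - \<Sigma>..s + \<Sigma>} \<longrightarrow> m \<le> u z"
      using lower boxsub unfolding AE_completion_iff by (auto elim!: eventually_mono)
    obtain U G where UG: "integrable lborel U" "AE z in lborel. z \<in> closed_box y R \<times> {s - \<Sigma>..s + \<Sigma>} \<longrightarrow> U z = u z"
      and mol: "mollified_supersolution p U G y s R \<Sigma> m"
      by (rule mollified_supersolution_exists[OF super p closed_box_compact K0 compact_Icc I0 low])
        (rule that, assumption+, unfold_locales, (rule p | assumption)+)
    have box_u: "past_box y s r' \<sigma>' \<subseteq> closed_box y R \<times> {s - \<Sigma>..s + \<Sigma>}"
      if "\<And>i. r' i \<le> R i" "\<sigma>' \<le> \<Sigma>" for r' \<sigma>'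
    proof
      fix z assume z: "z \<in> past_box y s r' \<sigma>'"
      then have "\<bar>fst z $ i - y $ i\<bar> \<le> R i" for i
        by (intro order_trans[OF _ that(1)]) (auto simp: past_box_def less_imp_le)
      then show "z \<in> closed_box y R \<times> {s - \<Sigma>..s + \<Sigma>}"
        using z that(2) \<Sigma>(1) by (auto simp: past_box_def closed_box_def mem_Times_iff)
    qed
    have "measure lborel {z \<in> past_box y s R \<Sigma>. U z < m + K} \<le> \<nu>0 * (\<tau> * (\<Prod>i\<in>UNIV. 2 * r i))"
    proof -
      let ?S1 = "{z \<in> past_box y s R \<Sigma>. U z < m + K}"
      let ?S2 = "{z. u z \<le> m + K} \<inter> (+) (y, s) ` cyl_minus p \<theta> (2 * \<rho>)"
      let ?Q = "(+) (y, s) ` cyl_minus p \<theta> (2 * \<rho>)"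
      have S1: "?S1 \<in> fmeasurable lborel" by (rule measurable_sublevel[OF UG(1)])
      have Q: "?Q \<in> fmeasurable lebesgue"
        unfolding translate_cyl_minus
        using past_box_fmeasurable[of y s "half_width p \<theta> (2 * \<rho>)" "(2 * \<rho>) powr harm_mean p"]
        by (auto simp: fmeasurable_def)
      obtain Du where "spatial_gradient p \<Omega> T u Du" using super by (auto simp: local_weak_supersolution_def)
      then have mu: "u \<in> borel_measurable (lebesgue_on (spacetime \<Omega> T))"
        by (simp add: spatial_gradient_def Lp_loc_time_def)
      have "?Q \<subseteq> (+) (y, s) ` cyl_full p \<theta> (2 * \<rho>)"
        by (intro image_mono) (auto simp: cyl_minus_def cyl_full_def intro: order_trans)
      also have "\<dots> \<subseteq> spacetime \<Omega> T"
        using cc closure_subset unfolding compactly_contained_def by blast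
      finally have "u \<in> borel_measurable (lebesgue_on ?Q)" by (rule measurable_restrict_mono[OF mu])
      then have "{z \<in> space (lebesgue_on ?Q). u z \<le> m + K} \<in> sets (lebesgue_on ?Q)" by measurable
      then have "?S2 \<in> sets (lebesgue_on ?Q)" by (simp add: space_restrict_space Int_def conj_commute)
      then have S2s: "?S2 \<in> sets lebesgue"
        using Q by (subst (asm) sets_restrict_space_iff) auto
      then have S2: "?S2 \<in> fmeasurable lebesgue" by (rule fmeasurableI2[OF Q _, rotated]) auto
      have "past_box y s R \<Sigma> \<subseteq> ?Q"
      proof
        fix z assume z: "z \<in> past_box y s R \<Sigma>"
        then have "\<bar>fst z $ i - y $ i\<bar> < half_width p \<theta> (2 * \<rho>) i" for i
          by (intro less_trans[OF _ R(2)]) (auto simp: past_box_def)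
        then show "z \<in> ?Q"
          unfolding translate_cyl_minus using z \<Sigma>(2) by (auto simp: past_box_def P_def)
      qed
      moreover have "AE z in lebesgue. z \<in> closed_box y R \<times> {s - \<Sigma>..s + \<Sigma>} \<longrightarrow> U z = u z"
        using UG(2) by (rule AE_completion)
      ultimately have "AE z in lebesgue. z \<in> ?S1 \<longrightarrow> z \<in> ?S2"
        using box_u[of R \<Sigma>] by (auto elim!: eventually_mono)
      then have "emeasure lebesgue ?S1 \<le> emeasure lebesgue ?S2"
        using S2s by (rule emeasure_mono_AE)
      then have "measure lebesgue ?S1 \<le> measure lebesgue ?S2"
        using S2 unfolding measure_def by (intro enn2real_mono) (auto simp: fmeasurable_def)
      then have "measure lborel ?S1 \<le> measure lebesgue ?S2"
        by (simp add: measure_completion[OF fmeasurableD[OF S1]])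
      also have "\<dots> \<le> \<nu> * ((2 * \<rho>) powr harm_mean p * (\<Prod>i\<in>UNIV. 2 * half_width p \<theta> (2 * \<rho>) i))"
        using \<nu>(1) less_imp_le[OF less_trans[OF R]]
        by (intro order_trans[OF small] mult_left_mono measure_cyl_minus_le) auto
      also have "\<dots> = (\<nu> * \<kappa>) * (\<tau> * (\<Prod>i\<in>UNIV. 2 * r i))"
        unfolding P_def[symmetric] double \<kappa>_def by (simp add: prod.distrib mult_ac)
      also have "\<dots> \<le> \<nu>0 * (\<tau> * (\<Prod>i\<in>UNIV. 2 * r i))"
        using \<nu>(3) \<tau>0 r0 by (intro mult_right_mono mult_nonneg_nonneg prod_nonneg) (auto simp: less_imp_le)
      finally show ?thesis .
    qed
    then have "measure lborel {z \<in> past_box y s r \<tau>. U z < m + a * K} = 0"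
      by (intro iteration[rule_format, of U G y s r \<tau> m])
        (use mol r0 rp \<tau>0 in \<open>simp_all add: R_def[abs_def] \<Sigma>_def\<close>)
    then have "{z \<in> past_box y s r \<tau>. U z < m + a * K} \<in> null_sets lborel"
      using measurable_sublevel[OF UG(1), of y s r \<tau> "m + a * K"]
      by (intro null_setsI fmeasurableD) (simp_all add: emeasure_eq_measure2)
    then have "AE z in lborel. z \<notin> {z \<in> past_box y s r \<tau>. U z < m + a * K}"
      by (rule AE_not_in)
    moreover have "past_box y s r \<tau> \<subseteq> closed_box y R \<times> {s - \<Sigma>..s + \<Sigma>}"
      using r0 \<gamma>(1) \<gamma>0(1) \<tau>0 by (intro box_u) (auto simp: R_def \<Sigma>_def less_imp_le)
    ultimately have "AE z in lborel. z \<in> past_box y s r \<tau> \<longrightarrow> m + a * K \<le> u z"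
      using UG(2) by (auto elim!: eventually_elim2)
    then show "AE z in lebesgue. z \<in> (+) (y, s) ` cyl_minus p \<theta> \<rho> \<longrightarrow> m + a * K \<le> u z"
      unfolding translate_cyl_minus by (intro AE_completion) (simp add: r_def \<tau>_def P_def)
  qed
qed

section \<open>Sub-solutions as negatives of super-solutions\<close>

lemma Lp_loc_uminus: "Lp_loc q U f \<Longrightarrow> Lp_loc q U (\<lambda>x. - f x)"
  by (simp add: Lp_loc_def borel_measurable_uminus)

lemma Lp_loc_time_uminus: "Lp_loc_time q \<Omega> T f \<Longrightarrow> Lp_loc_time q \<Omega> T (\<lambda>x. - f x)"
  by (simp add: Lp_loc_time_def borel_measurable_uminus)

lemma has_weak_partial_uminus:
  "has_weak_partial i \<Omega> f g \<Longrightarrow> has_weak_partial i \<Omega> (\<lambda>x. - f x) (\<lambda>x. - g x)"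
  by (simp add: has_weak_partial_def Lp_loc_uminus set_lebesgue_integral_def)

lemma C0_L2_loc_uminus:
  assumes "C0_L2_loc \<Omega> T u"
  shows "C0_L2_loc \<Omega> T (\<lambda>z. - u z)"
proof -
  have eq: "(- x - - y)\<^sup>2 = (x - y)\<^sup>2" for x y :: real by (simp add: power2_commute)
  show ?thesis
    using assms unfolding C0_L2_loc_def eq by (auto intro: Lp_loc_uminus)
qed

lemma spatial_gradient_uminus:
  assumes "spatial_gradient p \<Omega> T u Du"
  shows "spatial_gradient p \<Omega> T (\<lambda>z. - u z) (\<lambda>i z. - Du i z)"
  unfolding spatial_gradient_def
proof (intro conjI allI)
  show "Lp_loc_time 1 \<Omega> T (\<lambda>z. - u z)" "Lp_loc_time 1 \<Omega> T (\<lambda>z. - Du i z)"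
    "Lp_loc_time (p i) \<Omega> T (\<lambda>z. - Du i z)" for i
    using assms by (auto simp: spatial_gradient_def intro: Lp_loc_time_uminus)
  fix i
  have "AE t in lebesgue. t \<in> {-T<..<T} \<longrightarrow> has_weak_partial i \<Omega> (\<lambda>x. u (x, t)) (\<lambda>x. Du i (x, t))"
    using assms by (simp add: spatial_gradient_def)
  then show "AE t in lebesgue. t \<in> {-T<..<T} \<longrightarrow>
      has_weak_partial i \<Omega> (\<lambda>x. - u (x, t)) (\<lambda>x. - Du i (x, t))"
  proof eventually_elim
    case (elim t)
    then show ?case
      using has_weak_partial_uminus[of i \<Omega> "\<lambda>x. u (x, t)" "\<lambda>x. Du i (x, t)"] by blast
  qed
qed

lemma weak_form_uminus:
  "weak_form p (\<lambda>z. - u z) (\<lambda>i z. - Du i z) K t1 t2 \<phi> = - weak_form p u Du K t1 t2 \<phi>"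
proof -
  have neg: "(LINT z:S|lebesgue. h' z) = - (LINT z:S|lebesgue. h z)" if "\<And>z. h' z = - h z"
    for S :: "'c::euclidean_space set" and h h' :: "'c \<Rightarrow> real"
    unfolding set_lebesgue_integral_def that by simp
  have "(LINT z:K \<times> {t1..t2}|lebesgue. - (- u z) * ddir (0, 1) \<phi> z
      + (\<Sum>i\<in>UNIV. \<bar>- Du i z\<bar> powr (p i - 2) * (- Du i z) * ddir (axis i 1, 0) \<phi> z))
    = - (LINT z:K \<times> {t1..t2}|lebesgue. - u z * ddir (0, 1) \<phi> z
      + (\<Sum>i\<in>UNIV. \<bar>Du i z\<bar> powr (p i - 2) * Du i z * ddir (axis i 1, 0) \<phi> z))"
    by (rule neg) (simp add: sum_negf)
  moreover have "(LINT x:K|lebesgue. - u (x, t) * \<phi> (x, t)) = - (LINT x:K|lebesgue. u (x, t) * \<phi> (x, t))" for t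
    by (rule neg) simp
  ultimately show ?thesis unfolding weak_form_def by simp
qed

lemma subsolution_uminus:
  assumes "local_weak_subsolution p \<Omega> T u"
  shows "local_weak_supersolution p \<Omega> T (\<lambda>z. - u z)"
proof -
  obtain Du where Du: "spatial_gradient p \<Omega> T u Du"
    "\<And>t1 t2 K \<phi>. -T < t1 \<Longrightarrow> t1 < t2 \<Longrightarrow> t2 < T \<Longrightarrow> compact K \<Longrightarrow> K \<subseteq> \<Omega> \<Longrightarrow>
          admissible_test \<Omega> T K \<phi> \<Longrightarrow> weak_form p u Du K t1 t2 \<phi> \<le> 0"
    using assms unfolding local_weak_subsolution_def by blast
  show ?thesis
    unfolding local_weak_supersolution_def
  proof (intro conjI exI[of _ "\<lambda>i z. - Du i z"] allI impI)
    show "C0_L2_loc \<Omega> T (\<lambda>z. - u z)"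
      using assms by (intro C0_L2_loc_uminus) (simp add: local_weak_subsolution_def)
    show "spatial_gradient p \<Omega> T (\<lambda>z. - u z) (\<lambda>i z. - Du i z)" by (rule spatial_gradient_uminus[OF Du(1)])
  qed (simp add: weak_form_uminus Du(2))
qed

lemma AE_le_of_ess_sup_on:
  assumes "A \<in> sets lebesgue" "ess_sup_on A u \<le> ereal M"
  shows "AE z in lebesgue. z \<in> A \<longrightarrow> u z \<le> M"
proof -
  have "AE z in lebesgue_on A. ereal (u z) \<le> ess_sup_on A u"
    unfolding ess_sup_on_def by (rule esssup_AE)
  then have "AE z in lebesgue_on A. u z \<le> M"
    by eventually_elim (use assms(2) order_trans in fastforce)
  then show ?thesis using assms(1) by (subst (asm) AE_restrict_space_iff) auto
qed

lemma ess_sup_on_uminus: "ess_sup_on A (\<lambda>z. - u z) = - ess_inf_on A u"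
  by (simp add: ess_sup_on_def ess_inf_on_def)

lemma cyl_full_measurable:
  "(+) (y, s) ` cyl_full p M \<rho> \<in> sets lebesgue"
proof -
  have "continuous_on UNIV (\<lambda>z :: (real^'a) \<times> real. fst z $ i - y $ i)" for i and y :: "real^'a"
    by (intro continuous_intros)
  then have [measurable]: "(\<lambda>z :: (real^'a) \<times> real. fst z $ i - y $ i) \<in> borel_measurable borel" for i and y :: "real^'a"
    by (rule borel_measurable_continuous_UNIV)
  have [measurable]: "(snd :: (real^'a) \<times> real \<Rightarrow> real) \<in> borel_measurable borel"
    by (intro borel_measurable_continuous_UNIV continuous_intros)
  have "(+) (y, s) ` cyl_full p M \<rho> \<in> sets borel"
    unfolding translate_cyl_full by measurable
  then show ?thesis by simp
qed

theorem lemma3p2: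
  fixes p :: "'n::{finite,linorder} \<Rightarrow> real" and \<theta> \<omega> \<xi> a :: real
  assumes "CARD('n) > 1"
    and "harm_mean p < real CARD('n)"
    and "mono p" and "\<forall>i. 2 < p i" and "\<forall>i. p i < sobolev_exp p"
    and "\<theta> > 0" and "\<omega> > 0" and "0 < \<xi>" and "\<xi> \<le> 1" and "0 < a" and "a < 1"
  shows "\<exists>\<nu>m \<nu>p :: real. 0 < \<nu>m \<and> \<nu>m < 1 \<and> 0 < \<nu>p \<and> \<nu>p < 1 \<and>
    (\<forall>(\<Omega> :: (real^('n::{finite,linorder})) set) T u y s \<rho> (\<mu>m :: ereal) (\<mu>p :: ereal).
       open \<Omega> \<longrightarrow> bounded \<Omega> \<longrightarrow> T > 0 \<longrightarrow>
       (y, s) \<in> spacetime \<Omega> T \<longrightarrow> \<rho> > 0 \<longrightarrow>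
       compactly_contained ((+) (y, s) ` cyl_full p \<theta> (2 * \<rho>)) (spacetime \<Omega> T) \<longrightarrow>
       \<mu>m \<le> ess_inf_on ((+) (y, s) ` cyl_full p \<theta> (2 * \<rho>)) u \<longrightarrow>
       ess_inf_on ((+) (y, s) ` cyl_full p \<theta> (2 * \<rho>)) u
         \<le> ess_sup_on ((+) (y, s) ` cyl_full p \<theta> (2 * \<rho>)) u \<longrightarrow>
       ess_sup_on ((+) (y, s) ` cyl_full p \<theta> (2 * \<rho>)) u \<le> \<mu>p \<longrightarrow>
       (local_weak_supersolution p \<Omega> T u \<longrightarrow>
        locally_bounded_below (spacetime \<Omega> T) u \<longrightarrow>
        \<bar>\<mu>m\<bar> \<noteq> \<infinity> \<longrightarrow>
        measure lebesgue ({z. ereal (u z) \<le> \<mu>m + ereal (\<xi> * \<omega>)} \<inter>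
                          (+) (y, s) ` cyl_minus p \<theta> (2 * \<rho>))
          \<le> \<nu>m * measure lebesgue (cyl_minus p \<theta> (2 * \<rho>)) \<longrightarrow>
        (AE z in lebesgue. z \<in> (+) (y, s) ` cyl_minus p \<theta> \<rho> \<longrightarrow>
           ereal (u z) \<ge> \<mu>m + ereal (a * \<xi> * \<omega>))) \<and>
       (local_weak_subsolution p \<Omega> T u \<longrightarrow>
        locally_bounded_above (spacetime \<Omega> T) u \<longrightarrow>
        \<bar>\<mu>p\<bar> \<noteq> \<infinity> \<longrightarrow>
        measure lebesgue ({z. ereal (u z) \<ge> \<mu>p - ereal (\<xi> * \<omega>)} \<inter>
                          (+) (y, s) ` cyl_minus p \<theta> (2 * \<rho>))
          \<le> \<nu>p * measure lebesgue (cyl_minus p \<theta> (2 * \<rho>)) \<longrightarrow>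
        (AE z in lebesgue. z \<in> (+) (y, s) ` cyl_minus p \<theta> \<rho> \<longrightarrow>
           ereal (u z) \<le> \<mu>p - ereal (a * \<xi> * \<omega>))))"
proof -
  have p: "2 < p i" for i using assms by blast
  have K: "0 < \<xi> * \<omega>" using assms by simp
  obtain \<nu> where \<nu>: "0 < \<nu>" "\<nu> < 1" and critical: "\<forall>(\<Omega> :: (real^('n::{finite,linorder})) set) T u y s \<rho> m.
    0 < \<rho> \<longrightarrow> compactly_contained ((+) (y, s) ` cyl_full p \<theta> (2 * \<rho>)) (spacetime \<Omega> T) \<longrightarrow>
    local_weak_supersolution p \<Omega> T u \<longrightarrow>
    (AE z in lebesgue. z \<in> (+) (y, s) ` cyl_full p \<theta> (2 * \<rho>) \<longrightarrow> m \<le> u z) \<longrightarrow>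
    measure lebesgue ({z. u z \<le> m + \<xi> * \<omega>} \<inter> (+) (y, s) ` cyl_minus p \<theta> (2 * \<rho>))
      \<le> \<nu> * measure lebesgue (cyl_minus p \<theta> (2 * \<rho>)) \<longrightarrow>
    (AE z in lebesgue. z \<in> (+) (y, s) ` cyl_minus p \<theta> \<rho> \<longrightarrow> m + a * (\<xi> * \<omega>) \<le> u z)"
    using critical_mass_supersolution[where p=p and \<theta>=\<theta> and K="\<xi> * \<omega>" and a=a, OF p \<open>\<theta> > 0\<close> K \<open>a < 1\<close>]
    by (elim exE conjE) (rule that)
  show ?thesis
  proof (intro exI[of _ \<nu>] conjI \<nu> allI impI)
    fix \<Omega> :: "(real^('n::{finite,linorder})) set" and T :: real and u :: "(real^('n::{finite,linorder})) \<times> real \<Rightarrow> real" and y :: "real^('n::{finite,linorder})" and s \<rho> :: real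
      and \<mu>m \<mu>p :: ereal
    let ?Q = "(+) (y, s) ` cyl_full p \<theta> (2 * \<rho>)" and ?Qm = "(+) (y, s) ` cyl_minus p \<theta> (2 * \<rho>)"
    assume \<rho>: "\<rho> > 0" and cc: "compactly_contained ?Q (spacetime \<Omega> T)"
    show "AE z in lebesgue. z \<in> (+) (y, s) ` cyl_minus p \<theta> \<rho> \<longrightarrow> ereal (u z) \<ge> \<mu>m + ereal (a * \<xi> * \<omega>)"
      if inf: "\<mu>m \<le> ess_inf_on ?Q u" and super: "local_weak_supersolution p \<Omega> T u" and fin: "\<bar>\<mu>m\<bar> \<noteq> \<infinity>"
        and small: "measure lebesgue ({z. ereal (u z) \<le> \<mu>m + ereal (\<xi> * \<omega>)} \<inter> ?Qm)
          \<le> \<nu> * measure lebesgue (cyl_minus p \<theta> (2 * \<rho>))"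
    proof -
      obtain m where m: "\<mu>m = ereal m" using fin by (cases \<mu>m) auto
      have "ess_sup_on ?Q (\<lambda>z. - u z) \<le> ereal (- m)"
        using inf unfolding ess_sup_on_uminus m by (simp add: ereal_uminus_le_reorder)
      then have "AE z in lebesgue. z \<in> ?Q \<longrightarrow> m \<le> u z"
        using AE_le_of_ess_sup_on[OF cyl_full_measurable] by fastforce
      then have "AE z in lebesgue. z \<in> (+) (y, s) ` cyl_minus p \<theta> \<rho> \<longrightarrow> m + a * (\<xi> * \<omega>) \<le> u z"
        using small by (intro critical[rule_format, OF \<rho> cc super]) (simp_all add: m)
      then show ?thesis by (simp add: m mult.assoc)
    qed
    show "AE z in lebesgue. z \<in> (+) (y, s) ` cyl_minus p \<theta> \<rho> \<longrightarrow> ereal (u z) \<le> \<mu>p - ereal (a * \<xi> * \<omega>)"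
      if sup: "ess_sup_on ?Q u \<le> \<mu>p" and sub: "local_weak_subsolution p \<Omega> T u" and fin: "\<bar>\<mu>p\<bar> \<noteq> \<infinity>"
        and small: "measure lebesgue ({z. ereal (u z) \<ge> \<mu>p - ereal (\<xi> * \<omega>)} \<inter> ?Qm)
          \<le> \<nu> * measure lebesgue (cyl_minus p \<theta> (2 * \<rho>))"
    proof -
      obtain m where m: "\<mu>p = ereal m" using fin by (cases \<mu>p) auto
      have "AE z in lebesgue. z \<in> ?Q \<longrightarrow> u z \<le> m"
        using AE_le_of_ess_sup_on[OF cyl_full_measurable] sup by (simp add: m)
      then have low: "AE z in lebesgue. z \<in> ?Q \<longrightarrow> - m \<le> - u z" by simp
      have "{z. - u z \<le> - m + \<xi> * \<omega>} = {z. ereal (u z) \<ge> \<mu>p - ereal (\<xi> * \<omega>)}" by (auto simp: m)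
      then have "AE z in lebesgue. z \<in> (+) (y, s) ` cyl_minus p \<theta> \<rho> \<longrightarrow> - m + a * (\<xi> * \<omega>) \<le> - u z"
        using small by (intro critical[rule_format, OF \<rho> cc subsolution_uminus[OF sub] low]) simp_all
      then show ?thesis by (rule eventually_mono) (auto simp: m mult.assoc)
    qed
  qed
qed

end
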